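(* Let $m\ge 1$ be a fixed integer, let $W_n$ and $P_n$ be the Wiener index and the internal path length of the $m$-ary recursive tree with highest label $n$, and let $$(W_n^\ast,P_n^\ast)^T:=\Big(\frac{W_n-\mathbb E[W_n]}{n^2},\ \frac{P_n-\mathbb E[P_n]}{n}\Big)^T .$$ Let $(V_1,\dots,V_{m+1})$ be $\mathrm{Dirichlet}(1/m,\dots,1/m)$-distributed and set $$A_r:=\begin{pmatrix} V_r^2 & mV_r(1-V_r)\\ 0& V_r\end{pmatrix}\ (1\le r\le m+1),\qquad b:=\begin{pmatrix} b_1\\ b_2\end{pmatrix},$$ $$b_1:=m^2\Big(\sum_{r=1}^{m+1}V_r(\ln(V_r)-V_r)+\sum_{r=1}^m V_r(1-V_r)+1\Big),\qquad b_2:=m\Big(\sum_{r=1}^{m+1}V_r\ln(V_r)+1-V_{m+1}\Big).$$ Define the map $T:\mathcal M^2_{0,2}\to\mathcal M^2_{0,2}$ by $$T(\nu):=\mathcal L\Big(\sum_{r=1}^{m+1}A_r\begin{pmatrix}W^{(r)}\\P^{(r)}\end{pmatrix}+b\Big),$$ where $(W^{(1)},P^{(1)}),\dots,(W^{(m+1)},P^{(m+1)}),(V_1,\dots,V_{m+1})$ are independent and $\mathcal L((W^{(r)},P^{(r)})^T)=\nu$ for all $1\le r\le m+1$. Then $T$ has a unique fixed point $\mathcal L((W,P)^T)$ in $\mathcal M^2_{0,2}$, and, as $n\to\infty$, $$\begin{pmatrix}W_n^\ast\\P_n^\ast\end{pmatrix}\ \overset{\ell_2}{\longrightarrow}\ 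\begin{pmatrix}W\\P\end{pmatrix}.$$
   Context: Fix an integer $m\ge 1$. The $m$-ary recursive tree grows as follows. It starts as a single root node labeled $1$. For each $n\ge 1$, given the tree with highest label $n$ (which has $m(n-1)+1$ nodes), one of its nodes is selected uniformly at random, and $m$ new nodes, all receiving the label $n+1$, are attached as children of the selected node. In the tree with highest label $n$, the internal path length $P_n$ is the sum of the depths (edge distances to the root) of all nodes, and the Wiener index $W_n$ is the sum of the edge distances over all unordered pairs of nodes. $\mathcal L(X)$ denotes the law of $X$. $\mathcal M^2_{0,2}$ is the set of laws $\mathcal L(X)$ of random vectors $X$ in $\mathbb R^2$ with $\mathbb E[\|X\|^2]<\infty$ and $\mathbb E[X]=0$. On it, the Wasserstein metric is $\ell_2(\mu,\nu)=\inf\{\mathbb E[\|Y-Z\|^2]^{1/2}:\mathcal L(Y)=\mu,\ \mathcal L(Z)=\nu\}$, and $X_n\overset{\ell_2}{\longrightarrow}X$ means $\ell_2(\mathcal L(X_n),\mathcal L(X))\to0$. The convention $0\ln 0:=0$ is used. *)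

theory Defs
  imports "HOL-Probability.Probability"
begin

section \<open>The m-ary recursive tree\<close>

text \<open>
  A node is a pair of its label and an index that separates the \<open>m\<close> nodes sharing that label;
  the root is \<open>(1, 0)\<close>. A tree is its node set together with its set of (parent, child) edges.
\<close>

type_synonym node = "nat \<times> nat"
type_synonym tree = "node set \<times> (node \<times> node) set"

definition root_node :: node where
  "root_node = (1, 0)"

definition new_nodes :: "nat \<Rightarrow> nat \<Rightarrow> node set" where
  "new_nodes m l = {l} \<times> {..<m}"

definition attach :: "nat \<Rightarrow> nat \<Rightarrow> tree \<Rightarrow> node \<Rightarrow> tree" where
  "attach m l t v = (fst t \<union> new_nodes m l, snd t \<union> {v} \<times> new_nodes m l)"

text \<open>The tree with highest label \<open>n\<close>. Only \<open>n \<ge> 1\<close> is meaningful; the value at \<open>0\<close> is a dummy.\<close>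

fun recursive_tree :: "nat \<Rightarrow> nat \<Rightarrow> tree pmf" where
  "recursive_tree m 0 = return_pmf ({root_node}, {})"
| "recursive_tree m (Suc 0) = return_pmf ({root_node}, {})"
| "recursive_tree m (Suc (Suc n)) =
     bind_pmf (recursive_tree m (Suc n))
       (\<lambda>t. map_pmf (attach m (Suc (Suc n)) t) (pmf_of_set (fst t)))"

definition edge_dist :: "tree \<Rightarrow> node \<Rightarrow> node \<Rightarrow> nat" where
  "edge_dist t u v = (LEAST k. (u, v) \<in> (snd t \<union> (snd t)\<inverse>) ^^ k)"

definition path_length :: "tree \<Rightarrow> real" where
  "path_length t = (\<Sum>v\<in>fst t. real (edge_dist t root_node v))"

text \<open>In the double sum every unordered pair of distinct nodes occurs twice and the diagonal
  contributes nothing.\<close>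

definition wiener_index :: "tree \<Rightarrow> real" where
  "wiener_index t = (\<Sum>u\<in>fst t. \<Sum>v\<in>fst t. real (edge_dist t u v)) / 2"

definition normalized_law :: "nat \<Rightarrow> nat \<Rightarrow> (real^2) measure" where
  "normalized_law m n =
     distr (measure_pmf (recursive_tree m n)) borel
       (\<lambda>t. vector
          [(wiener_index t - measure_pmf.expectation (recursive_tree m n) wiener_index) / (real n)\<^sup>2,
           (path_length t - measure_pmf.expectation (recursive_tree m n) path_length) / real n])"

section \<open>Centred square-integrable laws and the Wasserstein metric\<close>

definition M02 :: "(real^2) measure set" where
  "M02 = {\<nu>. prob_space \<nu> \<and> sets \<nu> = sets borel \<and>
            integrable \<nu> (\<lambda>x. (norm x)\<^sup>2) \<and> integral\<^sup>L \<nu> (\<lambda>x. x) = 0}"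

text \<open>A coupling is the joint law of a pair \<open>(Y, Z)\<close> with the prescribed marginal laws.\<close>

definition couplings ::
  "(real^2) measure \<Rightarrow> (real^2) measure \<Rightarrow> ((real^2) \<times> (real^2)) measure set" where
  "couplings \<mu> \<nu> =
     {\<pi>. prob_space \<pi> \<and> sets \<pi> = sets (borel \<Otimes>\<^sub>M borel) \<and>
          distr \<pi> borel fst = \<mu> \<and> distr \<pi> borel snd = \<nu>}"

text \<open>For \<open>\<mu>\<close>, \<open>\<nu>\<close> in \<open>M02\<close> the set of couplings is nonempty and all the integrals
  are finite, so neither the infimum nor the integral falls back on a default value.\<close>

definition wasserstein2 :: "(real^2) measure \<Rightarrow> (real^2) measure \<Rightarrow> real" where
  "wasserstein2 \<mu> \<nu> =
     (INF \<pi>\<in>couplings \<mu> \<nu>. sqrt (\<integral>p. (norm (fst p - snd p))\<^sup>2 \<partial>\<pi>))"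

section \<open>The Dirichlet distribution\<close>

text \<open>
  The law of \<open>(V\<^sub>1, \<dots>, V\<^sub>k\<^sub>+\<^sub>1)\<close>, where \<open>(V\<^sub>1, \<dots>, V\<^sub>k)\<close> has the Dirichlet density with
  respect to Lebesgue measure on the open simplex and \<open>V\<^sub>k\<^sub>+\<^sub>1\<close> is one minus the sum of the others.
\<close>

definition dirichlet_density :: "nat \<Rightarrow> (nat \<Rightarrow> real) \<Rightarrow> (nat \<Rightarrow> real) \<Rightarrow> real" where
  "dirichlet_density k \<alpha> x =
     (if (\<forall>i\<in>{1..k}. 0 < x i) \<and> (\<Sum>i=1..k. x i) < 1
      then Gamma (\<Sum>i=1..k+1. \<alpha> i) / (\<Prod>i=1..k+1. Gamma (\<alpha> i))
             * (\<Prod>i=1..k. x i powr (\<alpha> i - 1))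
             * (1 - (\<Sum>i=1..k. x i)) powr (\<alpha> (k+1) - 1)
      else 0)"

definition dirichlet :: "nat \<Rightarrow> (nat \<Rightarrow> real) \<Rightarrow> (nat \<Rightarrow> real) measure" where
  "dirichlet k \<alpha> =
     distr (density (\<Pi>\<^sub>M i\<in>{1..k}. lborel) (\<lambda>x. ennreal (dirichlet_density k \<alpha> x)))
       (\<Pi>\<^sub>M i\<in>{1..k+1}. borel)
       (\<lambda>x. \<lambda>i\<in>{1..k+1}. if i \<le> k then x i else 1 - (\<Sum>j=1..k. x j))"

section \<open>The limit map\<close>

definition A_mat :: "nat \<Rightarrow> (nat \<Rightarrow> real) \<Rightarrow> nat \<Rightarrow> real^2^2" where
  "A_mat m V r = vector [vector [(V r)\<^sup>2, real m * V r * (1 - V r)],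
                         vector [0,        V r]]"

definition b_vec :: "nat \<Rightarrow> (nat \<Rightarrow> real) \<Rightarrow> real^2" where
  "b_vec m V = vector
     [(real m)\<^sup>2 * ((\<Sum>r=1..m+1. V r * (ln (V r) - V r)) + (\<Sum>r=1..m. V r * (1 - V r)) + 1),
      real m * ((\<Sum>r=1..m+1. V r * ln (V r)) + 1 - V (m+1))]"

text \<open>Independence of \<open>X\<^sub>1, \<dots>, X\<^sub>m\<^sub>+\<^sub>1, V\<close> is realised by taking the product measure.\<close>

definition T_map :: "nat \<Rightarrow> (real^2) measure \<Rightarrow> (real^2) measure" where
  "T_map m \<nu> =
     distr ((\<Pi>\<^sub>M r\<in>{1..m+1}. \<nu>) \<Otimes>\<^sub>M dirichlet m (\<lambda>_. 1 / real m)) borel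
       (\<lambda>(X, V). (\<Sum>r=1..m+1. A_mat m V r *v X r) + b_vec m V)"

end

theory Submission
  imports Defs "HOL-Real_Asymp.Real_Asymp"
begin

text \<open>
  Existence and convergence are obtained without a contraction argument. With
  \<open>N\<^sub>n = m (n - 1) + 1\<close>, both \<open>(P\<^sub>n - E P\<^sub>n) / N\<^sub>n\<close> and \<open>(W\<^sub>n - E W\<^sub>n) / (N\<^sub>n N\<^sub>n\<^sub>+\<^sub>1)\<close> are martingales along
  the growing tree, with explicit means, and their increments are controlled by the mean square
  depth, which is \<open>O(ln\<^sup>2 n)\<close>. Hence the normalised vector converges in square mean on the space
  of growth histories, and its limit law \<open>\<nu>\<close> satisfies the Wasserstein statement at once.

  That \<open>\<nu>\<close> is a fixed point follows by cutting the tree at the root. Given the sizes of the \<open>m + 1\<close>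
  pieces, the pieces are independent trees of the same kind, so the normalised vector satisfies the
  recursion with the exact matrices \<open>A\<^sub>r\<close>, evaluated at the proportions of the pieces, and a toll
  that is uniformly close to \<open>b\<close>. The proportions form a Polya urn; its rising factorial moments are
  the Dirichlet moments, and the Stone-Weierstrass theorem upgrades this to convergence of
  expectations of continuous functions on the simplex. Testing with Lipschitz functions gives
  \<open>T \<nu> = \<nu>\<close>, and testing with the coordinates gives \<open>E b = 0\<close>.

  For uniqueness, \<open>T\<close> contracts the cost of couplings of two fixed points once the second coordinate
  is weighted heavily enough.
\<close>

section \<open>Distances under attachment\<close>

text \<open>A contraction proof would need two facts in advance: that \<open>b\<close> has mean
  zero, without which \<open>T\<close> does not preserve centred laws, and that \<open>M02\<close>
  is complete. Constructing the limit as a random vector first avoids the second and yields the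
  first as a by-product. The normalisers come from the one-step means. Attaching at a uniform node
  multiplies the conditional mean of P_n by N_{n+1}/N_n and that of W_n by N_{n+2}/N_n, up to
  deterministic terms; N_n and N_n N_{n+1} grow by exactly these factors. The node set with highest
  label n is the same in every realisation and only the edges are random. Hence all parents can be
  drawn independently beforehand, which gives the space of histories, and the component sizes evolve
  as an urn of their own. The obstacle in the recursion is that a component may stay small while the
  whole tree grows, so its distance to the limit need not be small. Its coefficient, however, is at
  most a multiple of its share; therefore the estimates keep a factor \<open>V r\<close> and errors
  are only claimed to be small after weighting by the share.\<close>

abbreviation sym_edges :: "tree \<Rightarrow> (node \<times> node) set" where
  "sym_edges t \<equiv> snd t \<union> (snd t)\<inverse>"

text \<open>The node set is deterministic, only the edges are random; sampling a node therefore
  never depends on the tree beyond its highest label. Connectedness guarantees that the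
  \<open>LEAST\<close> in \<open>edge_dist\<close> is attained.\<close>

definition valid_tree :: "nat \<Rightarrow> nat \<Rightarrow> tree \<Rightarrow> bool" where
  "valid_tree m n t \<longleftrightarrow> n \<ge> 1 \<and> fst t = insert root_node ({2..n} \<times> {..<m}) \<and>
     snd t \<subseteq> fst t \<times> fst t \<and> (\<forall>u\<in>fst t. \<forall>v\<in>fst t. (u, v) \<in> (sym_edges t)\<^sup>*)"

lemma edge_dist_le: "(u, v) \<in> sym_edges t ^^ k \<Longrightarrow> edge_dist t u v \<le> k"
  unfolding edge_dist_def by (rule Least_le)

lemma edge_dist_relpow: "(u, v) \<in> (sym_edges t)\<^sup>* \<Longrightarrow> (u, v) \<in> sym_edges t ^^ edge_dist t u v"
  unfolding edge_dist_def by (rule LeastI_ex) (simp add: rtrancl_imp_relpow)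

lemma edge_dist_self [simp]: "edge_dist t u u = 0"
  using edge_dist_le[of u u 0 t] by simp

lemma edge_dist_sym: "edge_dist t u v = edge_dist t v u"
proof -
  have "(a, b) \<in> sym_edges t ^^ k \<Longrightarrow> (b, a) \<in> sym_edges t ^^ k" for a b k
  proof (induction k arbitrary: b)
    case (Suc k)
    then obtain c where "(a, c) \<in> sym_edges t ^^ k" "(c, b) \<in> sym_edges t" by auto
    with Suc.IH[of c] have "(c, a) \<in> sym_edges t ^^ k" "(b, c) \<in> sym_edges t" by auto
    then show ?case by (metis relpow_Suc_I2)
  qed auto
  then show ?thesis unfolding edge_dist_def by metis
qed

lemma valid_tree_finite: "valid_tree m n t \<Longrightarrow> finite (fst t)"
  by (auto simp: valid_tree_def)

lemma valid_tree_root: "valid_tree m n t \<Longrightarrow> root_node \<in> fst t"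
  by (auto simp: valid_tree_def)

lemma valid_tree_card: "valid_tree m n t \<Longrightarrow> card (fst t) = m * (n - 1) + 1"
  by (auto simp: valid_tree_def root_node_def card_insert_if)

lemma valid_tree_relpow:
  "valid_tree m n t \<Longrightarrow> u \<in> fst t \<Longrightarrow> v \<in> fst t \<Longrightarrow> (u, v) \<in> sym_edges t ^^ edge_dist t u v"
  by (rule edge_dist_relpow) (auto simp: valid_tree_def)

lemma new_nodes_fresh: "valid_tree m n t \<Longrightarrow> new_nodes m (Suc n) \<inter> fst t = {}"
  by (auto simp: valid_tree_def new_nodes_def root_node_def)

lemma finite_new_nodes [simp]: "finite (new_nodes m l)"
  and card_new_nodes [simp]: "card (new_nodes m l) = m"
  by (auto simp: new_nodes_def)

lemma fst_attach [simp]: "fst (attach m l t v) = fst t \<union> new_nodes m l"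
  by (simp add: attach_def)

context
  fixes m n :: nat and t :: tree and v :: node
  assumes valid: "valid_tree m n t" and v: "v \<in> fst t"
begin

text \<open>The retraction onto the old tree that sends each new leaf to its parent. Every new edge
  collapses to a point, so walks never become longer and new leaves cannot create shortcuts between
  old nodes.\<close>

private definition "retr x = (if x \<in> new_nodes m (Suc n) then v else x)"

private lemma edge_endpoints: "(a, b) \<in> sym_edges t \<Longrightarrow> a \<in> fst t \<and> b \<in> fst t"
  using valid by (auto simp: valid_tree_def)

private lemma sym_edges_attach:
  "sym_edges (attach m (Suc n) t v) =
    sym_edges t \<union> {v} \<times> new_nodes m (Suc n) \<union> new_nodes m (Suc n) \<times> {v}"
  by (auto simp: attach_def)

private lemma retr_old: "x \<in> fst t \<Longrightarrow> retr x = x"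
  using new_nodes_fresh[OF valid] by (auto simp: retr_def)

private lemma retr_relpow:
  "(a, b) \<in> sym_edges (attach m (Suc n) t v) ^^ k \<Longrightarrow>
     \<exists>j\<le>k. (retr a, retr b) \<in> sym_edges t ^^ j"
proof (induction k arbitrary: b)
  case (Suc k)
  then obtain c where c: "(a, c) \<in> sym_edges (attach m (Suc n) t v) ^^ k"
    "(c, b) \<in> sym_edges (attach m (Suc n) t v)" by auto
  from Suc.IH[OF c(1)] obtain j where j: "j \<le> k" "(retr a, retr c) \<in> sym_edges t ^^ j" by auto
  have "retr c = retr b \<or> (retr c, retr b) \<in> sym_edges t"
  proof -
    consider "(c, b) \<in> sym_edges t" | "c = v" "b \<in> new_nodes m (Suc n)"
      | "b = v" "c \<in> new_nodes m (Suc n)"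
      using c(2) unfolding sym_edges_attach by blast
    then show ?thesis
    proof cases
      case 1
      then show ?thesis using retr_old edge_endpoints by metis
    next
      case 2
      then show ?thesis using retr_old[OF v] by (simp add: retr_def)
    next
      case 3
      then show ?thesis using retr_old[OF v] by (simp add: retr_def)
    qed
  qed
  then show ?case
  proof
    assume "retr c = retr b" then show ?thesis using j by (metis le_SucI)
  next
    assume "(retr c, retr b) \<in> sym_edges t"
    then have "(retr a, retr b) \<in> sym_edges t ^^ Suc j" using j(2) by auto
    then show ?thesis using j(1) by (meson Suc_le_mono)
  qed
qed auto

private lemma relpow_attach_mono:
  "(a, b) \<in> sym_edges t ^^ k \<Longrightarrow> (a, b) \<in> sym_edges (attach m (Suc n) t v) ^^ k"
proof (induction k arbitrary: b)
  case (Suc k)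
  then obtain c where c: "(a, c) \<in> sym_edges t ^^ k" "(c, b) \<in> sym_edges t" by auto
  then have "(c, b) \<in> sym_edges (attach m (Suc n) t v)" unfolding sym_edges_attach by blast
  with Suc.IH[OF c(1)] show ?case by auto
qed auto

lemma valid_tree_attach: "valid_tree m (Suc n) (attach m (Suc n) t v)"
proof -
  let ?t = "attach m (Suc n) t v"
  have n: "n \<ge> 1" using valid by (simp add: valid_tree_def)
  have to_v: "(a, v) \<in> (sym_edges ?t)\<^sup>* \<and> (v, a) \<in> (sym_edges ?t)\<^sup>*" if "a \<in> fst ?t" for a
  proof (cases "a \<in> fst t")
    case True
    then have "(a, v) \<in> (sym_edges t)\<^sup>*" "(v, a) \<in> (sym_edges t)\<^sup>*"
      using valid v by (auto simp: valid_tree_def)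
    moreover have "(sym_edges t)\<^sup>* \<subseteq> (sym_edges ?t)\<^sup>*"
      unfolding sym_edges_attach by (rule rtrancl_mono) blast
    ultimately show ?thesis by blast
  next
    case False
    with that have "a \<in> new_nodes m (Suc n)" by auto
    then have "(a, v) \<in> sym_edges ?t" "(v, a) \<in> sym_edges ?t" unfolding sym_edges_attach by auto
    then show ?thesis by blast
  qed
  have "{2..Suc n} \<times> {..<m} = {2..n} \<times> {..<m} \<union> new_nodes m (Suc n)"
    using n by (auto simp: new_nodes_def)
  then have "fst ?t = insert root_node ({2..Suc n} \<times> {..<m})"
    using valid by (simp add: valid_tree_def)
  moreover have "snd ?t \<subseteq> fst ?t \<times> fst ?t"
    using valid v by (auto simp: valid_tree_def attach_def)
  moreover have "\<forall>a\<in>fst ?t. \<forall>b\<in>fst ?t. (a, b) \<in> (sym_edges ?t)\<^sup>*"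
    using to_v by (meson rtrancl_trans)
  ultimately show ?thesis unfolding valid_tree_def by simp
qed

lemma edge_dist_attach_old:
  assumes "a \<in> fst t" "b \<in> fst t"
  shows "edge_dist (attach m (Suc n) t v) a b = edge_dist t a b"
proof (rule antisym)
  show "edge_dist (attach m (Suc n) t v) a b \<le> edge_dist t a b"
    by (intro edge_dist_le relpow_attach_mono valid_tree_relpow[OF valid] assms)
  have "(a, b) \<in> sym_edges (attach m (Suc n) t v) ^^ edge_dist (attach m (Suc n) t v) a b"
    by (rule valid_tree_relpow[OF valid_tree_attach]) (use assms in auto)
  from retr_relpow[OF this] obtain j where "j \<le> edge_dist (attach m (Suc n) t v) a b"
    "(a, b) \<in> sym_edges t ^^ j" using assms retr_old by auto
  then show "edge_dist t a b \<le> edge_dist (attach m (Suc n) t v) a b"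
    using edge_dist_le order_trans by blast
qed

lemma edge_dist_attach_new_old:
  assumes a: "a \<in> fst t" and w: "w \<in> new_nodes m (Suc n)"
  shows "edge_dist (attach m (Suc n) t v) w a = edge_dist t v a + 1"
proof -
  let ?t = "attach m (Suc n) t v"
  have ne: "w \<noteq> a" using new_nodes_fresh[OF valid] a w by auto
  have "edge_dist ?t a w \<le> Suc (edge_dist t a v)"
  proof (rule edge_dist_le)
    have "(a, v) \<in> sym_edges ?t ^^ edge_dist t a v"
      by (intro relpow_attach_mono valid_tree_relpow[OF valid] a v)
    moreover have "(v, w) \<in> sym_edges ?t" using w unfolding sym_edges_attach by auto
    ultimately show "(a, w) \<in> sym_edges ?t ^^ Suc (edge_dist t a v)" by auto
  qed
  moreover have "Suc (edge_dist t a v) \<le> edge_dist ?t a w"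
  proof -
    have *: "(a, w) \<in> sym_edges ?t ^^ edge_dist ?t a w"
      by (rule valid_tree_relpow[OF valid_tree_attach]) (use assms in auto)
    with ne obtain k where k: "edge_dist ?t a w = Suc k" by (cases "edge_dist ?t a w") auto
    with * obtain c where c: "(a, c) \<in> sym_edges ?t ^^ k" "(c, w) \<in> sym_edges ?t" by auto
    \<comment> \<open>A new node has \<open>v\<close> as its only neighbour, so the last step of any
      walk to \<open>w\<close> starts at \<open>v\<close>.\<close>
    have "c = v" using c(2) w new_nodes_fresh[OF valid] edge_endpoints[of c w] v
      unfolding sym_edges_attach by auto
    with retr_relpow[OF c(1)] obtain j where "j \<le> k" "(a, v) \<in> sym_edges t ^^ j"
      using retr_old a v by auto
    then show ?thesis using k edge_dist_le by fastforce
  qed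
  ultimately show ?thesis by (simp add: edge_dist_sym)
qed

lemma edge_dist_attach_new_new:
  assumes a: "a \<in> new_nodes m (Suc n)" and w: "w \<in> new_nodes m (Suc n)" and ne: "a \<noteq> w"
  shows "edge_dist (attach m (Suc n) t v) a w = 2"
proof -
  let ?t = "attach m (Suc n) t v"
  have "edge_dist ?t a w \<le> 2"
  proof (rule edge_dist_le)
    have "(a, v) \<in> sym_edges ?t" "(v, w) \<in> sym_edges ?t"
      using a w unfolding sym_edges_attach by auto
    then show "(a, w) \<in> sym_edges ?t ^^ 2" unfolding numeral_2_eq_2 relpow.simps by blast
  qed
  moreover have "2 \<le> edge_dist ?t a w"
  proof -
    have *: "(a, w) \<in> sym_edges ?t ^^ edge_dist ?t a w"
      by (rule valid_tree_relpow[OF valid_tree_attach]) (use assms in auto)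
    with ne obtain k where k: "edge_dist ?t a w = Suc k" by (cases "edge_dist ?t a w") auto
    have "k \<noteq> 0"
    proof
      assume "k = 0"
      with * k have "(a, w) \<in> sym_edges ?t" by auto
      then show False using a w v new_nodes_fresh[OF valid] edge_endpoints
        unfolding sym_edges_attach by fast
    qed
    then show ?thesis using k by auto
  qed
  ultimately show ?thesis by simp
qed

lemma sum_nodes_attach:
  fixes g :: "node \<Rightarrow> real"
  shows "(\<Sum>x\<in>fst (attach m (Suc n) t v). g x) = (\<Sum>x\<in>fst t. g x) + (\<Sum>x\<in>new_nodes m (Suc n). g x)"
  using new_nodes_fresh[OF valid] valid_tree_finite[OF valid] by (simp add: sum.union_disjoint Int_commute)

end

section \<open>Invariants of the random tree\<close>

lemma valid_tree_single: "valid_tree m 1 ({root_node}, {})"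
  by (auto simp: valid_tree_def)

lemma valid_recursive_tree:
  "n \<ge> 1 \<Longrightarrow> t \<in> set_pmf (recursive_tree m n) \<Longrightarrow> valid_tree m n t"
proof (induction n arbitrary: t)
  case (Suc n)
  show ?case
  proof (cases n)
    case 0
    then show ?thesis using Suc.prems valid_tree_single by simp
  next
    case (Suc n')
    with Suc.prems obtain s where s: "s \<in> set_pmf (recursive_tree m n)"
      "t \<in> attach m (Suc n) s ` set_pmf (pmf_of_set (fst s))"
      by auto
    have vs: "valid_tree m n s" using Suc.IH s(1) Suc by simp
    then have "set_pmf (pmf_of_set (fst s)) = fst s"
      using valid_tree_finite[OF vs] valid_tree_root[OF vs] by (intro set_pmf_of_set) auto
    then show ?thesis using s(2) valid_tree_attach[OF vs] by auto
  qed
qed simp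

lemma finite_set_recursive_tree: "n \<ge> 1 \<Longrightarrow> finite (set_pmf (recursive_tree m n))"
proof (induction n)
  case (Suc n)
  show ?case
  proof (cases n)
    case (Suc n')
    have "finite (set_pmf (pmf_of_set (fst s)))" if "s \<in> set_pmf (recursive_tree m n)" for s
    proof -
      have vs: "valid_tree m n s" using valid_recursive_tree that Suc by simp
      show ?thesis
        using valid_tree_finite[OF vs] valid_tree_root[OF vs] by (subst set_pmf_of_set) auto
    qed
    then show ?thesis using Suc Suc.IH by auto
  qed simp
qed simp

section \<open>One-step changes of the tree statistics\<close>

text \<open>Divided by the number of nodes this is the mean square depth, the only quantity needed
  to control the increments of both martingales.\<close>

definition depth_square_sum :: "tree \<Rightarrow> real" where
  "depth_square_sum t = (\<Sum>v\<in>fst t. (real (edge_dist t root_node v))\<^sup>2)"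

definition total_dist :: "tree \<Rightarrow> node \<Rightarrow> real" where
  "total_dist t v = (\<Sum>u\<in>fst t. real (edge_dist t v u))"

context
  fixes m n :: nat and t :: tree and v :: node
  assumes valid: "valid_tree m n t" and v: "v \<in> fst t"
begin

lemma path_length_attach:
  "path_length (attach m (Suc n) t v) = path_length t + real m * (real (edge_dist t root_node v) + 1)"
proof -
  note r = valid_tree_root[OF valid]
  have "(\<Sum>x\<in>new_nodes m (Suc n). real (edge_dist (attach m (Suc n) t v) root_node x))
      = (\<Sum>x\<in>new_nodes m (Suc n). real (edge_dist t root_node v) + 1)"
    by (intro sum.cong refl) (simp add: edge_dist_sym[of _ root_node] edge_dist_attach_new_old[OF valid v r])
  then show ?thesis
    unfolding path_length_def sum_nodes_attach[OF valid v]
    by (simp add: edge_dist_attach_old[OF valid v r] algebra_simps)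
qed

lemma depth_square_sum_attach:
  "depth_square_sum (attach m (Suc n) t v) =
     depth_square_sum t + real m * (real (edge_dist t root_node v) + 1)\<^sup>2"
proof -
  note r = valid_tree_root[OF valid]
  have "(\<Sum>x\<in>new_nodes m (Suc n). (real (edge_dist (attach m (Suc n) t v) root_node x))\<^sup>2)
      = (\<Sum>x\<in>new_nodes m (Suc n). (real (edge_dist t root_node v) + 1)\<^sup>2)"
    by (intro sum.cong refl) (simp add: edge_dist_sym[of _ root_node] edge_dist_attach_new_old[OF valid v r] add.commute)
  then show ?thesis
    unfolding depth_square_sum_def sum_nodes_attach[OF valid v]
    by (simp add: edge_dist_attach_old[OF valid v r] algebra_simps)
qed

text \<open>Each of the m new leaves is one step further from every old node than \<open>v\<close>
  is, which gives the first correction. The m(m-1)/2 pairs of new leaves are at distance 2 and give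
  the second.\<close>

lemma wiener_index_attach:
  "wiener_index (attach m (Suc n) t v) =
     wiener_index t + real m * (total_dist t v + real (card (fst t))) + real m * (real m - 1)"
proof -
  let ?t = "attach m (Suc n) t v" and ?N = "new_nodes m (Suc n)"
  let ?d = "\<lambda>a b. real (edge_dist ?t a b)"
  have old: "(\<Sum>a\<in>fst t. \<Sum>b\<in>fst t. ?d a b) = 2 * wiener_index t"
    unfolding wiener_index_def by (simp add: edge_dist_attach_old[OF valid v])
  have mixed: "(\<Sum>a\<in>?N. \<Sum>b\<in>fst t. ?d a b) = real m * (total_dist t v + real (card (fst t)))"
    by (simp add: edge_dist_attach_new_old[OF valid v] total_dist_def sum.distrib algebra_simps)
  have mixed': "(\<Sum>a\<in>fst t. \<Sum>b\<in>?N. ?d a b) = (\<Sum>a\<in>?N. \<Sum>b\<in>fst t. ?d a b)"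
    by (subst sum.swap) (simp add: edge_dist_sym)
  have "(\<Sum>b\<in>?N. ?d a b) = 2 * (real m - 1)" if a: "a \<in> ?N" for a
  proof -
    have "(\<Sum>b\<in>?N. ?d a b) = ?d a a + (\<Sum>b\<in>?N - {a}. ?d a b)"
      using a by (simp add: sum.remove)
    also have "(\<Sum>b\<in>?N - {a}. ?d a b) = (\<Sum>b\<in>?N - {a}. 2)"
      using a by (intro sum.cong refl) (auto simp: edge_dist_attach_new_new[OF valid v])
    moreover have "m \<ge> 1" using a by (auto simp: new_nodes_def)
    ultimately show ?thesis using a by (simp add: card_Diff_singleton)
  qed
  then have new: "(\<Sum>a\<in>?N. \<Sum>b\<in>?N. ?d a b) = real m * (2 * (real m - 1))"
    by simp
  have "2 * wiener_index ?t = (\<Sum>a\<in>fst t. \<Sum>b\<in>fst t. ?d a b) + (\<Sum>a\<in>fst t. \<Sum>b\<in>?N. ?d a b)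
      + (\<Sum>a\<in>?N. \<Sum>b\<in>fst t. ?d a b) + (\<Sum>a\<in>?N. \<Sum>b\<in>?N. ?d a b)"
    unfolding wiener_index_def sum_nodes_attach[OF valid v] by (simp add: sum.distrib)
  then show ?thesis using old mixed mixed' new by (simp add: algebra_simps)
qed

lemma edge_dist_triangle_root:
  assumes "u \<in> fst t"
  shows "edge_dist t v u \<le> edge_dist t root_node v + edge_dist t root_node u"
proof -
  note r = valid_tree_root[OF valid]
  have "(v, u) \<in> sym_edges t ^^ (edge_dist t v root_node + edge_dist t root_node u)"
    unfolding relpow_add using valid_tree_relpow[OF valid v r] valid_tree_relpow[OF valid r assms] by blast
  then show ?thesis using edge_dist_le edge_dist_sym by metis
qed

end

lemma sum_total_dist: "(\<Sum>v\<in>fst t. total_dist t v) = 2 * wiener_index t"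
  by (simp add: total_dist_def wiener_index_def)

section \<open>Means and martingales\<close>

text \<open>The node count as a real polynomial in n, free of truncated subtraction. At n = 0 its
  value 1 - m has no meaning, so positivity is available only from n = 1 on.\<close>

definition tree_size :: "nat \<Rightarrow> nat \<Rightarrow> real" where
  "tree_size m n = real m * (real n - 1) + 1"

text \<open>This is the mean depth E P_n / N_n: since E P_{n+1} = (N_{n+1}/N_n) E P_n + m, division
  by N_{n+1} leaves an increment of m/N_{n+1}.\<close>

definition harm_sum :: "nat \<Rightarrow> nat \<Rightarrow> real" where
  "harm_sum m n = (\<Sum>k=2..n. real m / tree_size m k)"

definition path_mean :: "nat \<Rightarrow> nat \<Rightarrow> real" where
  "path_mean m n = tree_size m n * harm_sum m n"

text \<open>The solution of E W_{n+1} = (N_{n+2}/N_n) E W_n + m (N_n + m - 1) with value 0 at n = 1,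
  arranged so that the leading part N^2 (h - 1) is visible.\<close>

definition wiener_mean :: "nat \<Rightarrow> nat \<Rightarrow> real" where
  "wiener_mean m n = (tree_size m n)\<^sup>2 * (harm_sum m n - 1) + tree_size m n * (real m * harm_sum m n + 1)"

lemma tree_size_pos: "n \<ge> 1 \<Longrightarrow> tree_size m n > 0"
  by (simp add: tree_size_def add_nonneg_pos)

lemma tree_size_Suc: "tree_size m (Suc n) = tree_size m n + real m"
  by (simp add: tree_size_def algebra_simps)

lemma card_tree_size: "valid_tree m n t \<Longrightarrow> real (card (fst t)) = tree_size m n"
proof -
  assume v: "valid_tree m n t"
  then have "n \<ge> 1" by (simp add: valid_tree_def)
  then show ?thesis by (simp add: valid_tree_card[OF v] tree_size_def of_nat_diff)
qed

lemma harm_sum_Suc: "n \<ge> 1 \<Longrightarrow> harm_sum m (Suc n) = harm_sum m n + real m / tree_size m (Suc n)"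
  by (simp add: harm_sum_def)

lemma harm_sum_1 [simp]: "harm_sum m (Suc 0) = 0"
  by (simp add: harm_sum_def)

lemma harm_sum_nonneg: "harm_sum m n \<ge> 0"
  unfolding harm_sum_def using tree_size_pos by (intro sum_nonneg divide_nonneg_pos) auto

text \<open>After dividing numerator and denominator by m the sum becomes a harmonic sum shifted by
  1/m, whose distance to the logarithm converges by the limit formula for the digamma
  function.\<close>

lemma harm_sum_ln_convergent:
  assumes "m \<ge> 1"
  shows "convergent (\<lambda>n. harm_sum m n - ln (tree_size m n))"
proof -
  \<comment> \<open>The term k = 0 of the shifted harmonic sum is \<open>real m\<close> and
    corresponds to the root, which \<open>harm_sum\<close> leaves out.\<close>
  have eq: "harm_sum m (Suc n) = (\<Sum>k<Suc n. inverse (1 / real m + real k)) - real m" for n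
  proof (induction n)
    case (Suc n)
    have "real m / tree_size m (Suc (Suc n)) = inverse (1 / real m + real (Suc n))"
      using assms by (simp add: tree_size_def field_simps)
    then show ?case using Suc by (simp add: harm_sum_Suc)
  qed simp
  have "(\<lambda>n. of_real (ln (real n)) - (\<Sum>k<n. inverse (1 / real m + of_nat k))) \<longlonglongrightarrow> Digamma (1 / real m)"
    using assms by (intro Digamma_LIMSEQ) simp
  moreover have "(\<lambda>n. ln (real m * (real (Suc n) - 1) + 1) - ln (real (Suc n))) \<longlonglongrightarrow> ln (real m)"
  proof -
    have "real m > 0" using assms by simp
    then show ?thesis by real_asymp
  qed
  ultimately have "(\<lambda>n. - (ln (real (Suc n)) - (\<Sum>k<Suc n. inverse (1 / real m + real k))) - real m
      - (ln (tree_size m (Suc n)) - ln (real (Suc n)))) \<longlonglongrightarrow> - Digamma (1 / real m) - real m - ln (real m)"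
    unfolding tree_size_def
    by (intro tendsto_intros) (auto dest: LIMSEQ_Suc)
  then have "(\<lambda>n. harm_sum m (Suc n) - ln (tree_size m (Suc n))) \<longlonglongrightarrow> - Digamma (1 / real m) - real m - ln (real m)"
    by (simp add: eq algebra_simps)
  then have "(\<lambda>n. harm_sum m n - ln (tree_size m n)) \<longlonglongrightarrow> - Digamma (1 / real m) - real m - ln (real m)"
    by (rule LIMSEQ_imp_Suc)
  then show ?thesis by (rule convergentI)
qed

text \<open>The bracket bounds the mean square depth, m/N_{n+1} is the scale of one step, and the 4
  comes from \<open>sum_total_dist_square_le\<close>. The same bound serves both
  martingales.\<close>

definition increment_bound :: "nat \<Rightarrow> nat \<Rightarrow> real" where
  "increment_bound m n = 4 * (real m)\<^sup>2 * ((harm_sum m n)\<^sup>2 + harm_sum m n) / (tree_size m (Suc n))\<^sup>2"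

lemma increment_bound_nonneg: "increment_bound m n \<ge> 0"
  unfolding increment_bound_def using harm_sum_nonneg by (intro divide_nonneg_nonneg) auto

lemma summable_increment_bound:
  assumes "m \<ge> 1"
  shows "summable (increment_bound m)"
proof -
  obtain C where C: "\<And>n. \<bar>harm_sum m n - ln (tree_size m n)\<bar> \<le> C" "C > 0"
  proof -
    obtain K where "0 < K" "\<forall>n. norm (harm_sum m n - ln (tree_size m n)) \<le> K"
      using convergent_imp_Bseq[OF harm_sum_ln_convergent[OF assms]] by (rule BseqE)
    then show ?thesis by (intro that[of K]) auto
  qed
  have m: "real m \<ge> 1" using assms by simp
  have "increment_bound m n \<le>
     4 * (real m)\<^sup>2 * ((C + ln (real m * real n + 1))\<^sup>2 + (C + ln (real m * real n + 1))) / (real m * real n + 1)\<^sup>2" if n: "n \<ge> 1" for n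
  proof -
    have "harm_sum m n \<le> C + ln (tree_size m n)" using C(1)[of n] by linarith
    also have "ln (tree_size m n) \<le> ln (real m * real n + 1)"
      using tree_size_pos[OF n, of m] by (intro ln_mono) (auto simp: tree_size_def algebra_simps)
    finally have "harm_sum m n \<le> C + ln (real m * real n + 1)" by simp
    moreover have size: "tree_size m (Suc n) = real m * real n + 1" by (simp add: tree_size_def)
    ultimately show ?thesis
      unfolding increment_bound_def size using harm_sum_nonneg[of m n]
      by (intro divide_right_mono mult_left_mono add_mono power_mono) auto
  qed
  then have "increment_bound m \<in> O(\<lambda>n. 4 * (real m)\<^sup>2 * ((C + ln (real m * real n + 1))\<^sup>2 + (C + ln (real m * real n + 1))) / (real m * real n + 1)\<^sup>2)"
    using increment_bound_nonneg
    by (intro bigoI[of _ 1] eventually_mono[OF eventually_ge_at_top[of 1]])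
       (simp only: real_norm_def abs_of_nonneg mult_1, meson abs_ge_self order_trans)
  \<comment> \<open>The bound is of order ln^2 n / n^2; the exponent -3/2 lies strictly between -2
    and -1, so it absorbs the logarithms and is still summable.\<close>
  also have "(\<lambda>n. 4 * (real m)\<^sup>2 * ((C + ln (real m * real n + 1))\<^sup>2 + (C + ln (real m * real n + 1))) / (real m * real n + 1)\<^sup>2) \<in> O(\<lambda>n. real n powr (-3/2))"
  proof -
    have "real m > 0" using m by simp
    then show ?thesis by real_asymp
  qed
  finally have "increment_bound m \<in> O(\<lambda>n. real n powr (-3/2))" .
  then show ?thesis
    by (rule summable_comparison_test_bigo[rotated]) (simp add: summable_real_powr_iff)
qed

section \<open>Expectations over the random tree\<close>

abbreviation tree_expectation :: "nat \<Rightarrow> nat \<Rightarrow> (tree \<Rightarrow> real) \<Rightarrow> real" where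
  "tree_expectation m n \<equiv> measure_pmf.expectation (recursive_tree m n)"

lemma integrable_recursive_tree:
  fixes f :: "tree \<Rightarrow> 'b::{banach, second_countable_topology}"
  shows "n \<ge> 1 \<Longrightarrow> integrable (measure_pmf (recursive_tree m n)) f"
  by (intro integrable_measure_pmf_finite finite_set_recursive_tree)

lemma tree_expectation_cong:
  assumes "n \<ge> 1" "\<And>t. valid_tree m n t \<Longrightarrow> f t = g t"
  shows "tree_expectation m n f = tree_expectation m n g"
  using assms valid_recursive_tree by (intro integral_cong_AE) (auto simp: AE_measure_pmf_iff)

lemma tree_expectation_mono:
  assumes "n \<ge> 1" "\<And>t. valid_tree m n t \<Longrightarrow> f t \<le> g t"
  shows "tree_expectation m n f \<le> tree_expectation m n g"
  using assms valid_recursive_tree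
  by (intro integral_mono_AE integrable_recursive_tree) (auto simp: AE_measure_pmf_iff)

lemma set_pmf_nodes: "valid_tree m n t \<Longrightarrow> set_pmf (pmf_of_set (fst t)) = fst t"
  using valid_tree_finite[of m n t] valid_tree_root[of m n t] by (intro set_pmf_of_set) auto

lemma tree_expectation_Suc:
  assumes n: "n \<ge> 1"
  shows "tree_expectation m (Suc n) f =
    tree_expectation m n (\<lambda>t. (\<Sum>v\<in>fst t. f (attach m (Suc n) t v)) / tree_size m n)"
proof -
  let ?S = "set_pmf (recursive_tree m n)"
  have fin: "finite ?S" by (rule finite_set_recursive_tree[OF n])
  have v: "valid_tree m n t" if "t \<in> ?S" for t using valid_recursive_tree[OF n that] .
  have fin_attach: "finite (set_pmf (map_pmf (attach m (Suc n) t) (pmf_of_set (fst t))))" if "t \<in> ?S" for t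
    using valid_tree_finite[OF v[OF that]] by (simp add: set_pmf_nodes[OF v[OF that]])
  have "recursive_tree m (Suc n) = bind_pmf (recursive_tree m n)
       (\<lambda>t. map_pmf (attach m (Suc n) t) (pmf_of_set (fst t)))"
    using n by (cases n) auto
  then have "tree_expectation m (Suc n) f =
    (\<Sum>t\<in>?S. pmf (recursive_tree m n) t *\<^sub>R measure_pmf.expectation (map_pmf (attach m (Suc n) t) (pmf_of_set (fst t))) f)"
    using fin by (simp only:) (intro pmf_expectation_bind, auto intro: fin_attach simp del: set_map_pmf)
  also have "\<dots> = (\<Sum>t\<in>?S. pmf (recursive_tree m n) t *\<^sub>R ((\<Sum>v\<in>fst t. f (attach m (Suc n) t v)) / tree_size m n))"
  proof (intro sum.cong refl arg_cong2[of _ _ _ _ "(*\<^sub>R)"])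
    fix t assume "t \<in> ?S"
    note v = v[OF this]
    have "fst t \<noteq> {}" using valid_tree_root[OF v] by auto
    then show "measure_pmf.expectation (map_pmf (attach m (Suc n) t) (pmf_of_set (fst t))) f
        = (\<Sum>v\<in>fst t. f (attach m (Suc n) t v)) / tree_size m n"
      using valid_tree_finite[OF v] by (simp add: integral_pmf_of_set card_tree_size[OF v])
  qed
  also have "\<dots> = tree_expectation m n (\<lambda>t. (\<Sum>v\<in>fst t. f (attach m (Suc n) t v)) / tree_size m n)"
    by (rule integral_measure_pmf[OF fin, symmetric]) (auto simp: set_pmf_iff)
  finally show ?thesis .
qed

section \<open>Orthogonality of martingale increments\<close>

text \<open>Labels record the history, so the tree at time k is a function of any later tree; edges
  are kept according to the label of their child endpoint. Two times of a martingale can thus be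
  compared under the single law \<open>recursive_tree m n\<close>.\<close>

definition restr :: "nat \<Rightarrow> tree \<Rightarrow> tree" where
  "restr k t = ({x \<in> fst t. fst x \<le> k}, {e \<in> snd t. fst (snd e) \<le> k})"

lemma restr_attach: "k \<le> n \<Longrightarrow> restr k (attach m (Suc n) t v) = restr k t"
  by (auto simp: restr_def attach_def new_nodes_def)

lemma restr_valid: "valid_tree m n t \<Longrightarrow> restr n t = t"
  by (cases t) (auto simp: restr_def valid_tree_def root_node_def)

text \<open>The martingale property for each fixed tree: the average over the uniformly chosen
  parent, multiplied by the number of nodes. No conditional expectation has to be formed.\<close>

locale tree_martingale =
  fixes m :: nat and M :: "nat \<Rightarrow> tree \<Rightarrow> real"
  assumes average: "\<And>n t. valid_tree m n t \<Longrightarrow>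
    (\<Sum>v\<in>fst t. M (Suc n) (attach m (Suc n) t v)) = tree_size m n * M n t"
    and start: "M 1 ({root_node}, {}) = 0"
begin

lemma mean_zero: "n \<ge> 1 \<Longrightarrow> tree_expectation m n (M n) = 0"
proof (induction n rule: nat_induct_at_least)
  case base
  show ?case using start by simp
next
  case (Suc n)
  have "tree_expectation m (Suc n) (M (Suc n)) = tree_expectation m n (M n)"
    unfolding tree_expectation_Suc[OF Suc.hyps]
    using Suc.hyps tree_size_pos[of n m] by (intro tree_expectation_cong) (auto simp: average)
  then show ?case using Suc.IH by simp
qed

text \<open>Given the tree at time n, the past value c = \<open>M k (restr k t)\<close> is a
  constant that attachment does not change, and the one-step mean is \<open>M n t\<close>. Hence the
  conditional mean of the squared distance to c splits into its value at time n plus the conditional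
  variance of one step, and the variances add up.\<close>

lemma increment_square:
  assumes k: "1 \<le> k" "k \<le> n"
    and e: "\<And>i. i \<ge> 1 \<Longrightarrow>
      tree_expectation m i (\<lambda>t. (\<Sum>v\<in>fst t. (M (Suc i) (attach m (Suc i) t v) - M i t)\<^sup>2) / tree_size m i) \<le> e i"
  shows "tree_expectation m n (\<lambda>t. (M n t - M k (restr k t))\<^sup>2) \<le> (\<Sum>i=k..<n. e i)"
  using k(2)
proof (induction n rule: nat_induct_at_least)
  case base
  have "tree_expectation m k (\<lambda>t. (M k t - M k (restr k t))\<^sup>2) = tree_expectation m k (\<lambda>t. 0)"
    using k by (intro tree_expectation_cong) (auto simp: restr_valid)
  then show ?case by simp
next
  case (Suc n)
  have n: "n \<ge> 1" using Suc.hyps k by simp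
  have "tree_expectation m (Suc n) (\<lambda>t. (M (Suc n) t - M k (restr k t))\<^sup>2)
      = tree_expectation m n (\<lambda>t. (M n t - M k (restr k t))\<^sup>2 +
        (\<Sum>v\<in>fst t. (M (Suc n) (attach m (Suc n) t v) - M n t)\<^sup>2) / tree_size m n)"
    unfolding tree_expectation_Suc[OF n]
  proof (intro tree_expectation_cong n)
    fix t assume v: "valid_tree m n t"
    let ?x = "\<lambda>v. M (Suc n) (attach m (Suc n) t v)" and ?c = "M k (restr k t)"
    have "(\<Sum>v\<in>fst t. (?x v - ?c)\<^sup>2)
      = (\<Sum>v\<in>fst t. (?x v - M n t)\<^sup>2 + (2 * (M n t - ?c) * ?x v + (?c\<^sup>2 - (M n t)\<^sup>2)))"
      by (intro sum.cong refl) (simp add: power2_eq_square algebra_simps)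
    also have "\<dots> = (\<Sum>v\<in>fst t. (?x v - M n t)\<^sup>2) + 2 * (M n t - ?c) * (tree_size m n * M n t)
        + tree_size m n * (?c\<^sup>2 - (M n t)\<^sup>2)"
      by (simp add: sum.distrib average[OF v] card_tree_size[OF v] flip: sum_distrib_left)
    also have "\<dots> = (\<Sum>v\<in>fst t. (?x v - M n t)\<^sup>2) + tree_size m n * (M n t - ?c)\<^sup>2"
      by (simp add: power2_eq_square algebra_simps)
    finally show "(\<Sum>v\<in>fst t. (?x v - M k (restr k (attach m (Suc n) t v)))\<^sup>2) / tree_size m n
      = (M n t - ?c)\<^sup>2 + (\<Sum>v\<in>fst t. (?x v - M n t)\<^sup>2) / tree_size m n"
      using Suc.hyps tree_size_pos[OF n, of m] by (simp add: restr_attach add_divide_distrib)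
  qed
  also have "\<dots> = tree_expectation m n (\<lambda>t. (M n t - M k (restr k t))\<^sup>2) +
      tree_expectation m n (\<lambda>t. (\<Sum>v\<in>fst t. (M (Suc n) (attach m (Suc n) t v) - M n t)\<^sup>2) / tree_size m n)"
    by (intro Bochner_Integration.integral_add integrable_recursive_tree n)
  also have "\<dots> \<le> (\<Sum>i=k..<n. e i) + e n"
    by (intro add_mono Suc.IH e n)
  finally show ?case using Suc.hyps by simp
qed

end

section \<open>The two martingales and the exact means\<close>

definition path_martingale :: "nat \<Rightarrow> nat \<Rightarrow> tree \<Rightarrow> real" where
  "path_martingale m n t = (path_length t - path_mean m n) / tree_size m n"

text \<open>Summing \<open>total_dist\<close> over all possible parents gives twice the Wiener
  index, so the conditional mean grows by 1 + 2m/N_n = N_{n+2}/N_n. The normaliser must grow by the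
  same factor, which forces the product of two consecutive sizes.\<close>

definition wiener_martingale :: "nat \<Rightarrow> nat \<Rightarrow> tree \<Rightarrow> real" where
  "wiener_martingale m n t =
     (wiener_index t - wiener_mean m n) / (tree_size m n * tree_size m (Suc n))"

lemma sum_path_length_attach:
  assumes v: "valid_tree m n t"
  shows "(\<Sum>v\<in>fst t. path_length (attach m (Suc n) t v)) =
    tree_size m (Suc n) * path_length t + real m * tree_size m n"
proof -
  have "(\<Sum>v\<in>fst t. path_length (attach m (Suc n) t v))
    = (\<Sum>v\<in>fst t. path_length t + real m * (real (edge_dist t root_node v) + 1))"
    by (intro sum.cong refl path_length_attach[OF v])
  also have "\<dots> = tree_size m n * path_length t + real m * (path_length t + tree_size m n)"
    by (simp add: sum.distrib card_tree_size[OF v] path_length_def[of t] flip: sum_distrib_left)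
  finally show ?thesis by (simp add: tree_size_Suc algebra_simps)
qed

lemma sum_wiener_index_attach:
  assumes v: "valid_tree m n t"
  shows "(\<Sum>v\<in>fst t. wiener_index (attach m (Suc n) t v)) =
    tree_size m (Suc (Suc n)) * wiener_index t + real m * tree_size m n * (tree_size m n + real m - 1)"
proof -
  have "(\<Sum>v\<in>fst t. wiener_index (attach m (Suc n) t v))
    = (\<Sum>v\<in>fst t. wiener_index t + real m * (total_dist t v + tree_size m n) + real m * (real m - 1))"
    by (intro sum.cong refl) (simp add: wiener_index_attach[OF v] card_tree_size[OF v])
  also have "\<dots> = tree_size m n * wiener_index t + real m * (2 * wiener_index t + tree_size m n * tree_size m n)
     + tree_size m n * (real m * (real m - 1))"
    by (simp add: sum.distrib card_tree_size[OF v] sum_total_dist flip: sum_distrib_left)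
  finally show ?thesis by (simp add: tree_size_Suc algebra_simps)
qed

lemma path_length_single [simp]: "path_length ({root_node}, {}) = 0"
  and wiener_index_single [simp]: "wiener_index ({root_node}, {}) = 0"
  and depth_square_sum_single [simp]: "depth_square_sum ({root_node}, {}) = 0"
  by (simp_all add: path_length_def wiener_index_def depth_square_sum_def)

lemma tree_martingale_path: "tree_martingale m (path_martingale m)"
proof
  fix n t assume v: "valid_tree m n t"
  have n: "n \<ge> 1" using v by (simp add: valid_tree_def)
  let ?N = "tree_size m n" and ?N' = "tree_size m (Suc n)"
  have pos: "?N > 0" "?N' > 0" using n by (auto intro: tree_size_pos)
  have "(\<Sum>v\<in>fst t. path_martingale m (Suc n) (attach m (Suc n) t v))
    = ((\<Sum>v\<in>fst t. path_length (attach m (Suc n) t v)) - ?N * path_mean m (Suc n)) / ?N'"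
    unfolding path_martingale_def
    by (simp add: sum_subtractf card_tree_size[OF v] flip: sum_divide_distrib)
  also have "\<dots> = ?N * path_martingale m n t"
    unfolding sum_path_length_attach[OF v] path_martingale_def path_mean_def harm_sum_Suc[OF n]
    using pos by (simp add: field_simps)
  finally show "(\<Sum>v\<in>fst t. path_martingale m (Suc n) (attach m (Suc n) t v))
    = ?N * path_martingale m n t" .
next
  show "path_martingale m 1 ({root_node}, {}) = 0"
    by (simp add: path_martingale_def path_mean_def)
qed

lemma tree_martingale_wiener: "tree_martingale m (wiener_martingale m)"
proof
  fix n t assume v: "valid_tree m n t"
  have n: "n \<ge> 1" using v by (simp add: valid_tree_def)
  let ?N = "tree_size m n" and ?N' = "tree_size m (Suc n)" and ?N'' = "tree_size m (Suc (Suc n))"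
  let ?h = "harm_sum m n"
  have pos: "?N > 0" "?N' > 0" "?N'' > 0" using n by (auto intro: tree_size_pos)
  have h: "?N' * harm_sum m (Suc n) = ?N' * ?h + real m"
    using pos by (simp add: harm_sum_Suc[OF n] field_simps)
  have "wiener_mean m (Suc n) = ?N' * (?N' * harm_sum m (Suc n)) - ?N'\<^sup>2 + real m * (?N' * harm_sum m (Suc n)) + ?N'"
    by (simp add: wiener_mean_def power2_eq_square algebra_simps)
  then have w: "wiener_mean m (Suc n) =
      ?N' * (?N' * ?h + real m) - ?N'\<^sup>2 + real m * (?N' * ?h + real m) + ?N'"
    unfolding h .
  \<comment> \<open>This is the recursion of \<open>wiener_mean\<close> with denominators cleared;
    it makes the deterministic part match the random part.\<close>
  have key: "real m * ?N * (?N + real m - 1) - ?N * wiener_mean m (Suc n) = - ?N'' * wiener_mean m n"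
    unfolding w wiener_mean_def[of m n] tree_size_Suc by (simp add: power2_eq_square algebra_simps)
  have "(\<Sum>v\<in>fst t. wiener_martingale m (Suc n) (attach m (Suc n) t v))
    = ((\<Sum>v\<in>fst t. wiener_index (attach m (Suc n) t v)) - ?N * wiener_mean m (Suc n)) / (?N' * ?N'')"
    unfolding wiener_martingale_def
    by (simp add: sum_subtractf card_tree_size[OF v] flip: sum_divide_distrib)
  also have "\<dots> = ?N'' * (wiener_index t - wiener_mean m n) / (?N' * ?N'')"
    unfolding sum_wiener_index_attach[OF v] using key by (simp add: algebra_simps)
  also have "\<dots> = ?N * wiener_martingale m n t"
    unfolding wiener_martingale_def using pos by simp
  finally show "(\<Sum>v\<in>fst t. wiener_martingale m (Suc n) (attach m (Suc n) t v))
    = ?N * wiener_martingale m n t" .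
next
  show "wiener_martingale m 1 ({root_node}, {}) = 0"
    by (simp add: wiener_martingale_def wiener_mean_def tree_size_def)
qed

lemma expectation_path_length:
  assumes n: "n \<ge> 1"
  shows "tree_expectation m n path_length = path_mean m n"
proof -
  have "0 = tree_expectation m n (path_martingale m n)"
    using tree_martingale.mean_zero[OF tree_martingale_path n] by simp
  also have "\<dots> = (tree_expectation m n path_length - path_mean m n) / tree_size m n"
    unfolding path_martingale_def by (simp add: integrable_recursive_tree[OF n])
  finally show ?thesis using tree_size_pos[OF n, of m] by simp
qed

lemma expectation_wiener_index:
  assumes n: "n \<ge> 1"
  shows "tree_expectation m n wiener_index = wiener_mean m n"
proof -
  have "0 = tree_expectation m n (wiener_martingale m n)"
    using tree_martingale.mean_zero[OF tree_martingale_wiener n] by simp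
  also have "\<dots> = (tree_expectation m n wiener_index - wiener_mean m n) / (tree_size m n * tree_size m (Suc n))"
    unfolding wiener_martingale_def by (simp add: integrable_recursive_tree[OF n])
  finally show ?thesis using tree_size_pos[OF n, of m] tree_size_pos[of "Suc n" m] by simp
qed

text \<open>The normalised mean grows by (2 m h + m)/N_{n+1} in one step. With d = m/N_{n+1} the
  right-hand side grows by 2 h d + d + d^2, which is larger by the square d^2.\<close>

lemma expectation_depth_square_sum:
  assumes "n \<ge> 1"
  shows "tree_expectation m n depth_square_sum / tree_size m n \<le> (harm_sum m n)\<^sup>2 + harm_sum m n"
  using assms
proof (induction n rule: nat_induct_at_least)
  case (Suc n)
  note n = Suc.hyps
  let ?N = "tree_size m n" and ?N' = "tree_size m (Suc n)" and ?h = "harm_sum m n"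
  have pos: "?N > 0" "?N' > 0" using n by (auto intro: tree_size_pos)
  have "tree_expectation m (Suc n) depth_square_sum =
    tree_expectation m n (\<lambda>t. ?N' / ?N * depth_square_sum t + (2 * real m / ?N * path_length t + real m))"
    unfolding tree_expectation_Suc[OF n]
  proof (intro tree_expectation_cong n)
    fix t assume v: "valid_tree m n t"
    have "(\<Sum>v\<in>fst t. depth_square_sum (attach m (Suc n) t v))
      = (\<Sum>v\<in>fst t. depth_square_sum t + (real m * (real (edge_dist t root_node v))\<^sup>2
           + 2 * real m * real (edge_dist t root_node v) + real m))"
      by (intro sum.cong refl) (simp add: depth_square_sum_attach[OF v] power2_eq_square algebra_simps)
    also have "\<dots> = ?N * depth_square_sum t + (real m * depth_square_sum t + 2 * real m * path_length t + ?N * real m)"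
      by (simp add: sum.distrib card_tree_size[OF v] depth_square_sum_def[of t] path_length_def[of t]
            flip: sum_distrib_left)
    finally show "(\<Sum>v\<in>fst t. depth_square_sum (attach m (Suc n) t v)) / ?N
      = ?N' / ?N * depth_square_sum t + (2 * real m / ?N * path_length t + real m)"
      using pos by (simp add: tree_size_Suc field_simps)
  qed
  also have "\<dots> = ?N' / ?N * tree_expectation m n depth_square_sum + (2 * real m / ?N * (?N * ?h) + real m)"
    using expectation_path_length[OF n, of m]
    by (simp add: path_mean_def integrable_recursive_tree[OF n])
  also have "\<dots> / ?N' = tree_expectation m n depth_square_sum / ?N + (2 * real m * ?h + real m) / ?N'"
    using pos by (simp add: field_simps)
  also have "\<dots> \<le> ?h\<^sup>2 + ?h + (2 * real m * ?h + real m) / ?N'"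
    using Suc.IH by simp
  also have "\<dots> \<le> (?h + real m / ?N')\<^sup>2 + (?h + real m / ?N')"
    by (simp add: power2_eq_square algebra_simps add_divide_distrib)
  finally show ?case by (simp add: harm_sum_Suc[OF n])
qed simp

text \<open>The mean minimises the mean square deviation, so the increments may be measured from any
  convenient centre \<open>c\<close>.\<close>

lemma sum_square_deviation_le:
  fixes x :: "'a \<Rightarrow> real"
  assumes "(\<Sum>v\<in>A. x v) = real (card A) * \<mu>"
  shows "(\<Sum>v\<in>A. (x v - \<mu>)\<^sup>2) \<le> (\<Sum>v\<in>A. (x v - c)\<^sup>2)"
proof -
  have "(\<Sum>v\<in>A. (x v - c)\<^sup>2) - (\<Sum>v\<in>A. (x v - \<mu>)\<^sup>2) = (\<Sum>v\<in>A. 2 * (\<mu> - c) * x v + (c\<^sup>2 - \<mu>\<^sup>2))"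
    unfolding sum_subtractf[symmetric] by (intro sum.cong refl) (simp add: power2_eq_square algebra_simps)
  also have "\<dots> = 2 * (\<mu> - c) * (real (card A) * \<mu>) + real (card A) * (c\<^sup>2 - \<mu>\<^sup>2)"
    by (simp add: sum.distrib assms flip: sum_distrib_left)
  also have "\<dots> = real (card A) * (\<mu> - c)\<^sup>2"
    by (simp add: power2_eq_square algebra_simps)
  finally show ?thesis by (smt (verit) mult_nonneg_nonneg of_nat_0_le_iff zero_le_power2)
qed

lemma path_martingale_increment:
  assumes i: "i \<ge> 1"
  shows "tree_expectation m i (\<lambda>t. (\<Sum>v\<in>fst t. (path_martingale m (Suc i) (attach m (Suc i) t v) - path_martingale m i t)\<^sup>2) / tree_size m i)
    \<le> increment_bound m i"
proof -
  let ?N = "tree_size m i" and ?N' = "tree_size m (Suc i)"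
  have pos: "?N > 0" "?N' > 0" using i by (auto intro: tree_size_pos)
  have "tree_expectation m i (\<lambda>t. (\<Sum>v\<in>fst t. (path_martingale m (Suc i) (attach m (Suc i) t v) - path_martingale m i t)\<^sup>2) / ?N)
    \<le> tree_expectation m i (\<lambda>t. (real m / ?N')\<^sup>2 / ?N * depth_square_sum t)"
  proof (intro tree_expectation_mono i)
    fix t assume v: "valid_tree m i t"
    let ?x = "\<lambda>v. path_martingale m (Suc i) (attach m (Suc i) t v)"
    \<comment> \<open>The value produced by attaching at the root. Relative to this centre the
      deviation is exactly m/N_{i+1} times the depth of the chosen node.\<close>
    define c where "c = (path_length t + real m - path_mean m (Suc i)) / ?N'"
    have "(\<Sum>v\<in>fst t. (?x v - path_martingale m i t)\<^sup>2) \<le> (\<Sum>v\<in>fst t. (?x v - c)\<^sup>2)"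
      using tree_martingale.average[OF tree_martingale_path v]
      by (intro sum_square_deviation_le) (simp add: card_tree_size[OF v])
    also have "\<dots> = (\<Sum>v\<in>fst t. (real m / ?N')\<^sup>2 * (real (edge_dist t root_node v))\<^sup>2)"
    proof (intro sum.cong refl)
      fix v' assume v': "v' \<in> fst t"
      have "?x v' - c = real m / ?N' * real (edge_dist t root_node v')"
        unfolding path_martingale_def path_length_attach[OF v v'] c_def
        by (simp add: diff_divide_distrib[symmetric] algebra_simps)
      then show "(?x v' - c)\<^sup>2 = (real m / ?N')\<^sup>2 * (real (edge_dist t root_node v'))\<^sup>2"
        by (simp only: power_mult_distrib)
    qed
    also have "\<dots> = (real m / ?N')\<^sup>2 * depth_square_sum t"
      by (simp only: depth_square_sum_def sum_distrib_left)
    finally show "(\<Sum>v\<in>fst t. (?x v - path_martingale m i t)\<^sup>2) / ?N \<le> (real m / ?N')\<^sup>2 / ?N * depth_square_sum t"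
      using pos by (simp add: divide_right_mono)
  qed
  also have "\<dots> = (real m / ?N')\<^sup>2 * (tree_expectation m i depth_square_sum / ?N)"
    by simp
  also have "\<dots> \<le> (real m / ?N')\<^sup>2 * ((harm_sum m i)\<^sup>2 + harm_sum m i)"
    by (intro mult_left_mono expectation_depth_square_sum i) simp
  also have "\<dots> \<le> increment_bound m i"
    using harm_sum_nonneg[of m i] unfolding increment_bound_def
    by (simp add: power_divide divide_right_mono mult_right_mono)
  finally show ?thesis .
qed

text \<open>Routing every path through the root bounds \<open>total_dist t a\<close> by N times the
  depth of \<open>a\<close> plus the path length. After squaring, Cauchy-Schwarz turns the squared
  path length into N times \<open>depth_square_sum\<close>; the two parts contribute 2 each.\<close>

lemma sum_total_dist_square_le:
  assumes v: "valid_tree m n t"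
  shows "(\<Sum>v\<in>fst t. (total_dist t v)\<^sup>2) \<le> 4 * (tree_size m n)\<^sup>2 * depth_square_sum t"
proof -
  let ?D = "\<lambda>v. real (edge_dist t root_node v)" and ?N = "tree_size m n"
  have N: "?N \<ge> 0" using card_tree_size[OF v] by (metis of_nat_0_le_iff)
  have "(\<Sum>v\<in>fst t. (total_dist t v)\<^sup>2) \<le> (\<Sum>v\<in>fst t. 2 * (path_length t)\<^sup>2 + 2 * ?N\<^sup>2 * (?D v)\<^sup>2)"
  proof (intro sum_mono)
    fix a assume a: "a \<in> fst t"
    have "total_dist t a \<le> (\<Sum>u\<in>fst t. ?D a + ?D u)"
      unfolding total_dist_def
      by (intro sum_mono) (metis edge_dist_triangle_root[OF v a] of_nat_add of_nat_le_iff)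
    also have "\<dots> = ?N * ?D a + path_length t"
      by (simp add: sum.distrib card_tree_size[OF v] path_length_def)
    finally have "(total_dist t a)\<^sup>2 \<le> (?N * ?D a + path_length t)\<^sup>2"
      by (intro power_mono) (auto simp: total_dist_def sum_nonneg)
    also have "\<dots> \<le> 2 * (path_length t)\<^sup>2 + 2 * ?N\<^sup>2 * (?D a)\<^sup>2"
      using sum_squares_bound[of "?N * ?D a" "path_length t"]
      by (simp add: power2_sum power_mult_distrib algebra_simps)
    finally show "(total_dist t a)\<^sup>2 \<le> 2 * (path_length t)\<^sup>2 + 2 * ?N\<^sup>2 * (?D a)\<^sup>2" .
  qed
  also have "\<dots> = 2 * ?N * (path_length t)\<^sup>2 + 2 * ?N\<^sup>2 * depth_square_sum t"
    by (simp add: sum.distrib card_tree_size[OF v] depth_square_sum_def flip: sum_distrib_left)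
  also have "\<dots> \<le> 2 * ?N * (?N * depth_square_sum t) + 2 * ?N\<^sup>2 * depth_square_sum t"
    using N sum_squared_le_sum_of_squares[of ?D "fst t"]
    unfolding path_length_def depth_square_sum_def
    by (intro add_right_mono mult_left_mono) (simp_all add: card_tree_size[OF v] mult.commute)
  finally show ?thesis by (simp add: power2_eq_square ac_simps)
qed

lemma wiener_martingale_increment:
  assumes i: "i \<ge> 1"
  shows "tree_expectation m i (\<lambda>t. (\<Sum>v\<in>fst t. (wiener_martingale m (Suc i) (attach m (Suc i) t v) - wiener_martingale m i t)\<^sup>2) / tree_size m i)
    \<le> increment_bound m i"
proof -
  let ?N = "tree_size m i" and ?N' = "tree_size m (Suc i)" and ?N'' = "tree_size m (Suc (Suc i))"
  let ?K = "(real m / (?N' * ?N''))\<^sup>2"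
  have pos: "?N > 0" "?N' > 0" "?N'' > 0" using i by (auto intro: tree_size_pos)
  have "tree_expectation m i (\<lambda>t. (\<Sum>v\<in>fst t. (wiener_martingale m (Suc i) (attach m (Suc i) t v) - wiener_martingale m i t)\<^sup>2) / ?N)
    \<le> tree_expectation m i (\<lambda>t. ?K * (4 * ?N\<^sup>2) / ?N * depth_square_sum t)"
  proof (intro tree_expectation_mono i)
    fix t assume v: "valid_tree m i t"
    let ?x = "\<lambda>v. wiener_martingale m (Suc i) (attach m (Suc i) t v)"
    \<comment> \<open>The new Wiener index without its \<open>total_dist\<close> term; all other
      terms are the same for every parent, so the deviation becomes a multiple of
      \<open>total_dist\<close>.\<close>
    define c where "c = (wiener_index t + real m * ?N + real m * (real m - 1) - wiener_mean m (Suc i)) / (?N' * ?N'')"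
    have "(\<Sum>v\<in>fst t. (?x v - wiener_martingale m i t)\<^sup>2) \<le> (\<Sum>v\<in>fst t. (?x v - c)\<^sup>2)"
      using tree_martingale.average[OF tree_martingale_wiener v]
      by (intro sum_square_deviation_le) (simp add: card_tree_size[OF v])
    also have "\<dots> = (\<Sum>v\<in>fst t. ?K * (total_dist t v)\<^sup>2)"
    proof (intro sum.cong refl)
      fix v' assume v': "v' \<in> fst t"
      have "?x v' - c = real m / (?N' * ?N'') * total_dist t v'"
        unfolding wiener_martingale_def wiener_index_attach[OF v v'] c_def card_tree_size[OF v]
        by (simp add: diff_divide_distrib[symmetric] algebra_simps)
      then show "(?x v' - c)\<^sup>2 = ?K * (total_dist t v')\<^sup>2"
        by (simp only: power_mult_distrib)
    qed
    also have "\<dots> = ?K * (\<Sum>v\<in>fst t. (total_dist t v)\<^sup>2)"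
      by (simp only: sum_distrib_left)
    also have "\<dots> \<le> ?K * (4 * ?N\<^sup>2 * depth_square_sum t)"
      by (intro mult_left_mono sum_total_dist_square_le[OF v]) simp
    finally show "(\<Sum>v\<in>fst t. (?x v - wiener_martingale m i t)\<^sup>2) / ?N \<le> ?K * (4 * ?N\<^sup>2) / ?N * depth_square_sum t"
      using pos by (simp add: divide_right_mono mult.assoc)
  qed
  also have "\<dots> = ?K * (4 * ?N\<^sup>2) * (tree_expectation m i depth_square_sum / ?N)"
    by simp
  also have "\<dots> \<le> ?K * (4 * ?N\<^sup>2) * ((harm_sum m i)\<^sup>2 + harm_sum m i)"
    by (intro mult_left_mono expectation_depth_square_sum i) simp
  \<comment> \<open>The factor N_i from \<open>total_dist\<close> is matched by the second size in
    the normaliser, so the step has the same scale as for the path length.\<close>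
  also have "\<dots> = increment_bound m i * (?N / ?N'')\<^sup>2"
    unfolding increment_bound_def by (simp add: power_divide power_mult_distrib)
  also have "\<dots> \<le> increment_bound m i * 1"
    using pos increment_bound_nonneg[of m i]
    by (intro mult_left_mono power_le_one) (auto simp: tree_size_Suc)
  finally show ?thesis by simp
qed

section \<open>Growth histories and the square mean limit\<close>

lemma integrable_square_diff:
  fixes u v :: "'a \<Rightarrow> real"
  assumes [measurable]: "u \<in> borel_measurable M" "v \<in> borel_measurable M"
    and "integrable M (\<lambda>x. (u x)\<^sup>2)" "integrable M (\<lambda>x. (v x)\<^sup>2)"
  shows "integrable M (\<lambda>x. (u x - v x)\<^sup>2)"
proof (rule Bochner_Integration.integrable_bound)
  show "integrable M (\<lambda>x. 2 * (u x)\<^sup>2 + 2 * (v x)\<^sup>2)" using assms by auto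
  have "(a - b)\<^sup>2 \<le> 2 * a\<^sup>2 + 2 * b\<^sup>2" for a b :: real
    using zero_le_power2[of "a + b"] by (simp add: power2_diff power2_sum)
  then show "AE x in M. norm ((u x - v x)\<^sup>2) \<le> norm (2 * (u x)\<^sup>2 + 2 * (v x)\<^sup>2)"
    by (intro AE_I2) (metis abs_ge_self abs_power2 order_trans real_norm_def)
qed measurable

text \<open>Riesz-Fischer by a fast subsequence: squared increments of size 4^-j have first moments
  of size 2^-j, so the increments are almost surely absolutely summable, and Fatou's lemma carries
  the mean square bound over to the limit. Index 0 is excluded because trees start at n = 1.\<close>

lemma (in prob_space) L2_complete:
  fixes f :: "nat \<Rightarrow> 'a \<Rightarrow> real"
  assumes meas [measurable]: "\<And>n. f n \<in> borel_measurable M"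
    and sq: "\<And>n. integrable M (\<lambda>x. (f n x)\<^sup>2)"
    and cauchy: "\<And>k n. 1 \<le> k \<Longrightarrow> k \<le> n \<Longrightarrow> (\<integral>x. (f n x - f k x)\<^sup>2 \<partial>M) \<le> e k"
    and e: "e \<longlonglongrightarrow> 0"
  shows "\<exists>g\<in>borel_measurable M. integrable M (\<lambda>x. (g x)\<^sup>2) \<and>
    (\<forall>n\<ge>1. integrable M (\<lambda>x. (f n x - g x)\<^sup>2)) \<and> (\<lambda>n. \<integral>x. (f n x - g x)\<^sup>2 \<partial>M) \<longlonglongrightarrow> 0"
proof -
  note diff_sq = integrable_square_diff
  have nn: "(\<integral>\<^sup>+x. ennreal ((f n x - f k x)\<^sup>2) \<partial>M) \<le> ennreal (e k)" if "1 \<le> k" "k \<le> n" for k n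
    using cauchy[OF that] diff_sq[OF meas meas sq sq]
    by (subst nn_integral_eq_integral) (auto intro: ennreal_leI)
  have "\<exists>N. \<forall>k\<ge>N. e k \<le> (1/4) ^ j" for j :: nat
    using LIMSEQ_D[OF e, of "(1/4) ^ j"] by (simp add: less_imp_le abs_less_iff) (meson less_imp_le)
  then obtain N where N: "\<And>j k. N j \<le> k \<Longrightarrow> e k \<le> (1/4) ^ j" by metis
  \<comment> \<open>Summing all \<open>N i\<close> makes the subsequence monotone and beyond every
    threshold; the term 1 + j keeps it positive and unbounded.\<close>
  define r where "r j = 1 + j + (\<Sum>i\<le>j. N i)" for j :: nat
  have r1: "1 \<le> r j" and rN: "N j \<le> r j" and rS: "r j \<le> r (Suc j)" for j
    unfolding r_def using member_le_sum[of j "{..j}" N] by auto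
  have r_mono: "r i \<le> r j" if "i \<le> j" for i j using rS that by (rule lift_Suc_mono_le)
  define d where "d j x = f (r (Suc j)) x - f (r j) x" for j x
  have [measurable]: "d j \<in> borel_measurable M" for j unfolding d_def by measurable
  have d: "(\<integral>\<^sup>+x. ennreal \<bar>d j x\<bar> \<partial>M) \<le> ennreal ((1/2) ^ j)" for j
  proof -
    \<comment> \<open>The arithmetic-geometric mean inequality with weight 2^j replaces
      Cauchy-Schwarz; on a space of total mass one both terms integrate to at most 2^-j / 2.\<close>
    have "\<bar>a\<bar> \<le> (1/2) ^ j / 2 + 2 ^ j / 2 * a\<^sup>2" for a :: real
    proof -
      have "0 \<le> (2 ^ j * \<bar>a\<bar> - 1)\<^sup>2 / (2 * 2 ^ j)" by simp
      also have "\<dots> = (1/2) ^ j / 2 + 2 ^ j / 2 * a\<^sup>2 - \<bar>a\<bar>"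
        by (simp add: power2_eq_square field_simps power_divide)
      finally show ?thesis by simp
    qed
    then have "(\<integral>\<^sup>+x. ennreal \<bar>d j x\<bar> \<partial>M) \<le> (\<integral>\<^sup>+x. ennreal ((1/2) ^ j / 2) + ennreal (2 ^ j / 2) * ennreal ((d j x)\<^sup>2) \<partial>M)"
      by (intro nn_integral_mono) (simp add: ennreal_mult' [symmetric] flip: ennreal_plus)
    also have "\<dots> = ennreal ((1/2) ^ j / 2) + ennreal (2 ^ j / 2) * (\<integral>\<^sup>+x. ennreal ((d j x)\<^sup>2) \<partial>M)"
      by (simp add: nn_integral_add nn_integral_cmult emeasure_space_1)
    also have "\<dots> \<le> ennreal ((1/2) ^ j / 2) + ennreal (2 ^ j / 2) * ennreal ((1/4) ^ j)"
      unfolding d_def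
      by (intro add_left_mono mult_left_mono order_trans[OF nn[OF r1 rS] ennreal_leI[OF N[OF rN]]]) simp
    also have "\<dots> = ennreal ((1/2) ^ j / 2 + 2 ^ j / 2 * (1/4) ^ j)"
      by (simp add: ennreal_mult' [symmetric] flip: ennreal_plus)
    also have "(1/2) ^ j / 2 + 2 ^ j / 2 * (1/4) ^ j = ((1/2) ^ j :: real)"
      by (simp add: field_simps power_divide flip: power_mult_distrib)
    finally show ?thesis .
  qed
  have "(\<integral>\<^sup>+x. (\<Sum>j. ennreal \<bar>d j x\<bar>) \<partial>M) = (\<Sum>j. \<integral>\<^sup>+x. ennreal \<bar>d j x\<bar> \<partial>M)"
    by (rule nn_integral_suminf) measurable
  also have "\<dots> \<le> (\<Sum>j. ennreal ((1/2) ^ j))"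
    by (intro suminf_le d) auto
  also have "\<dots> < \<infinity>"
    by (simp add: suminf_ennreal2 summable_geometric less_top[symmetric])
  finally have "AE x in M. (\<Sum>j. ennreal \<bar>d j x\<bar>) \<noteq> \<infinity>"
    by (intro nn_integral_PInf_AE) auto
  then have conv: "AE x in M. convergent (\<lambda>j. f (r j) x)"
  proof eventually_elim
    fix x assume "(\<Sum>j. ennreal \<bar>d j x\<bar>) \<noteq> \<infinity>"
    then have "summable (\<lambda>j. \<bar>d j x\<bar>)"
      by (intro summable_suminf_not_top) auto
    then have "summable (\<lambda>j. f (r (Suc j)) x - f (r j) x)"
      unfolding d_def by (rule summable_rabs_cancel)
    moreover have "(\<Sum>i<n. f (r (Suc i)) x - f (r i) x) = f (r n) x - f (r 0) x" for n
      by (induction n) auto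
    ultimately show "convergent (\<lambda>j. f (r j) x)"
      by (simp add: summable_iff_convergent convergent_diff_const_right_iff)
  qed
  \<comment> \<open>Outside the almost sure set of convergence \<open>lim\<close> is an arbitrary
    value, which is harmless under the integral.\<close>
  define g where "g x = lim (\<lambda>j. f (r j) x)" for x
  have [measurable]: "g \<in> borel_measurable M" unfolding g_def by measurable
  have lim: "AE x in M. (\<lambda>j. f (r j) x) \<longlonglongrightarrow> g x"
    using conv unfolding g_def by eventually_elim (simp add: convergent_LIMSEQ_iff)
  have bound: "(\<integral>\<^sup>+x. ennreal ((f k x - g x)\<^sup>2) \<partial>M) \<le> ennreal (e k)" if k: "1 \<le> k" for k
  proof -
    have "(\<integral>\<^sup>+x. ennreal ((f k x - g x)\<^sup>2) \<partial>M) = (\<integral>\<^sup>+x. liminf (\<lambda>j. ennreal ((f k x - f (r j) x)\<^sup>2)) \<partial>M)"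
      using lim
    proof (intro nn_integral_cong_AE, eventually_elim)
      fix x assume "(\<lambda>j. f (r j) x) \<longlonglongrightarrow> g x"
      then have "(\<lambda>j. ennreal ((f k x - f (r j) x)\<^sup>2)) \<longlonglongrightarrow> ennreal ((f k x - g x)\<^sup>2)"
        by (intro tendsto_ennrealI tendsto_intros)
      from lim_imp_Liminf[OF _ this] show "ennreal ((f k x - g x)\<^sup>2) = liminf (\<lambda>j. ennreal ((f k x - f (r j) x)\<^sup>2))"
        by simp
    qed
    also have "\<dots> \<le> liminf (\<lambda>j. \<integral>\<^sup>+x. ennreal ((f k x - f (r j) x)\<^sup>2) \<partial>M)"
      by (intro nn_integral_liminf) measurable
    also have "\<dots> \<le> ennreal (e k)"
    proof (rule Liminf_le)
      show "\<forall>\<^sub>F j in sequentially. (\<integral>\<^sup>+x. ennreal ((f k x - f (r j) x)\<^sup>2) \<partial>M) \<le> ennreal (e k)"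
        using eventually_ge_at_top[of k]
      proof eventually_elim
        fix j assume "k \<le> j"
        then have "k \<le> r j" unfolding r_def by simp
        from nn[OF k this] show "(\<integral>\<^sup>+x. ennreal ((f k x - f (r j) x)\<^sup>2) \<partial>M) \<le> ennreal (e k)"
          by (simp add: power2_commute)
      qed
    qed simp
    finally show ?thesis .
  qed
  have fg: "integrable M (\<lambda>x. (f n x - g x)\<^sup>2)" if "n \<ge> 1" for n
    using bound[OF that] by (intro integrableI_bounded) (auto simp: le_less_trans)
  \<comment> \<open>Writing the limit as f_1 minus the error f_1 - g makes its square
    integrable.\<close>
  have "integrable M (\<lambda>x. (f 1 x - (f 1 x - g x))\<^sup>2)"
    using fg[of 1] sq by (rule_tac integrable_square_diff) auto
  then have "integrable M (\<lambda>x. (g x)\<^sup>2)" by simp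
  moreover have "(\<lambda>n. \<integral>x. (f n x - g x)\<^sup>2 \<partial>M) \<longlonglongrightarrow> 0"
  proof (rule tendsto_sandwich[OF _ _ tendsto_const])
    have "(\<integral>x. (f k x - g x)\<^sup>2 \<partial>M) \<le> max 0 (e k)" if "1 \<le> k" for k
    proof -
      have "ennreal (\<integral>x. (f k x - g x)\<^sup>2 \<partial>M) \<le> ennreal (max 0 (e k))"
        using bound[OF that] fg[OF that]
        by (subst nn_integral_eq_integral[symmetric]) (auto simp: max_def ennreal_neg split: if_splits)
      then show ?thesis by (subst (asm) ennreal_le_iff) auto
    qed
    then show "\<forall>\<^sub>F n in sequentially. (\<integral>x. (f n x - g x)\<^sup>2 \<partial>M) \<le> max 0 (e n)"
      by (intro eventually_mono[OF eventually_ge_at_top[of 1]]) auto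
    show "(\<lambda>n. max 0 (e n)) \<longlonglongrightarrow> 0" using tendsto_max[OF tendsto_const[of 0] e] by simp
  qed auto
  ultimately show ?thesis using fg by (intro bexI[of _ g]) auto
qed

section \<open>The space of growth histories\<close>

definition nodes_upto :: "nat \<Rightarrow> nat \<Rightarrow> node set" where
  "nodes_upto m n = insert root_node ({2..n} \<times> {..<m})"

text \<open>The coordinate \<open>\<omega> n\<close> is the parent of the nodes labelled n + 1. Its
  range depends on n alone, so a product measure suffices and all trees live on one probability
  space.\<close>

definition choice_space :: "nat \<Rightarrow> (nat \<Rightarrow> node) measure" where
  "choice_space m = (\<Pi>\<^sub>M n\<in>UNIV. measure_pmf (pmf_of_set (nodes_upto m n)))"

fun grow :: "nat \<Rightarrow> nat \<Rightarrow> (nat \<Rightarrow> node) \<Rightarrow> tree" where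
  "grow m 0 \<omega> = ({root_node}, {})"
| "grow m (Suc 0) \<omega> = ({root_node}, {})"
| "grow m (Suc (Suc n)) \<omega> = attach m (Suc (Suc n)) (grow m (Suc n) \<omega>) (\<omega> (Suc n))"

lemma grow_cong: "(\<And>i. i < n \<Longrightarrow> \<omega> i = \<omega>' i) \<Longrightarrow> grow m n \<omega> = grow m n \<omega>'"
  by (induction m n \<omega> rule: grow.induct) auto

lemma grow_labels_le:
  "n \<ge> 1 \<Longrightarrow> fst (grow m n \<omega>) \<subseteq> {x. fst x \<le> n} \<and> snd (grow m n \<omega>) \<subseteq> {e. fst (snd e) \<le> n}"
proof (induction m n \<omega> rule: grow.induct)
  case (3 m n \<omega>)
  then have IH: "fst (grow m (Suc n) \<omega>) \<subseteq> {x. fst x \<le> Suc n}"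
    "snd (grow m (Suc n) \<omega>) \<subseteq> {e. fst (snd e) \<le> Suc n}" by auto
  have "{x :: node. fst x \<le> Suc n} \<subseteq> {x. fst x \<le> Suc (Suc n)}"
    "{e :: node \<times> node. fst (snd e) \<le> Suc n} \<subseteq> {e. fst (snd e) \<le> Suc (Suc n)}" by auto
  with IH have "fst (grow m (Suc n) \<omega>) \<subseteq> {x. fst x \<le> Suc (Suc n)}"
    "snd (grow m (Suc n) \<omega>) \<subseteq> {e. fst (snd e) \<le> Suc (Suc n)}" by (meson order_trans)+
  then show ?case unfolding grow.simps attach_def fst_conv snd_conv
    by (intro conjI Un_least) (auto simp: new_nodes_def)
qed (auto simp: root_node_def)

lemma restr_grow:
  assumes "1 \<le> k" "k \<le> n"
  shows "restr k (grow m n \<omega>) = grow m k \<omega>"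
  using assms(2,1)
proof (induction n rule: dec_induct)
  case base
  then show ?case using grow_labels_le[of k m \<omega>] by (cases "grow m k \<omega>") (auto simp: restr_def)
next
  case (step n)
  then obtain n' where "n = Suc n'" by (cases n) auto
  then show ?case using step by (simp add: restr_attach)
qed

lemma prob_space_choice_space: "prob_space (choice_space m)"
  unfolding choice_space_def by (intro prob_space_PiM prob_space_measure_pmf)

lemma measurable_choice [measurable]: "(\<lambda>\<omega>. \<omega> n) \<in> choice_space m \<rightarrow>\<^sub>M count_space UNIV"
  unfolding choice_space_def
  by (rule measurable_compose[OF measurable_component_singleton]) auto

text \<open>Stated over an arbitrary space, since the independence argument applies it to the
  product over the coordinates below n. The type of trees is uncountable; measurability for the full
  power set holds because each step only splits by the countably many values of one chosen
  node.\<close>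

lemma measurable_grow_general:
  "(\<And>i. i < n \<Longrightarrow> (\<lambda>\<omega>. \<omega> i) \<in> M \<rightarrow>\<^sub>M count_space UNIV) \<Longrightarrow> grow m n \<in> M \<rightarrow>\<^sub>M count_space UNIV"
proof (induction m n "\<lambda>_::nat. root_node" rule: grow.induct)
  case (3 m n)
  have IH: "grow m (Suc n) \<in> M \<rightarrow>\<^sub>M count_space UNIV" by (rule 3(1), rule 3(2)) simp
  have "(\<lambda>\<omega>. attach m (Suc (Suc n)) (grow m (Suc n) \<omega>) (\<omega> (Suc n))) \<in> M \<rightarrow>\<^sub>M count_space UNIV"
    by (rule measurable_compose_countable[where f="\<lambda>v \<omega>. attach m (Suc (Suc n)) (grow m (Suc n) \<omega>) v"])
       (auto intro: measurable_compose[OF IH] 3(2))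
  moreover have "grow m (Suc (Suc n)) = (\<lambda>\<omega>. attach m (Suc (Suc n)) (grow m (Suc n) \<omega>) (\<omega> (Suc n)))"
    by (simp add: fun_eq_iff)
  ultimately show ?case by (simp only:)
next
  case (1 m)
  have "grow m 0 = (\<lambda>\<omega>. ({root_node}, {}))" by (simp add: fun_eq_iff)
  then show ?case by (simp only:) simp
next
  case (2 m)
  have "grow m (Suc 0) = (\<lambda>\<omega>. ({root_node}, {}))" by (simp add: fun_eq_iff)
  then show ?case by (simp only:) simp
qed

lemma measurable_grow [measurable]: "grow m n \<in> choice_space m \<rightarrow>\<^sub>M count_space UNIV"
  by (rule measurable_grow_general) measurable

text \<open>\<open>indep_var\<close> needs both variables in one type, so the node \<open>\<omega> n\<close> is turned into a tree.\<close>

lemma indep_grow_choice: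
  "prob_space.indep_var (choice_space m) (count_space UNIV) (grow m n)
     (count_space UNIV) (\<lambda>\<omega>. ({\<omega> n}, {}))"
proof -
  let ?P = "\<lambda>n. measure_pmf (pmf_of_set (nodes_upto m n))"
  interpret prob_space "choice_space m" by (rule prob_space_choice_space)
  have "indep_vars ?P (\<lambda>i \<omega>. \<omega> i) UNIV"
  proof (subst indep_vars_iff_distr_eq_PiM)
    show "random_variable (?P i) (\<lambda>\<omega>. \<omega> i)" for i
      unfolding choice_space_def by (rule measurable_component_singleton) auto
    have "distr (choice_space m) (?P i) (\<lambda>\<omega>. \<omega> i) = ?P i" for i
      unfolding choice_space_def by (rule distr_PiM_component) (auto intro: prob_space_measure_pmf)
    moreover have "distr (choice_space m) (PiM UNIV ?P) (\<lambda>x. \<lambda>i\<in>UNIV. x i) = choice_space m"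
      unfolding choice_space_def by (simp add: restrict_UNIV distr_id)
    ultimately show "distr (choice_space m) (PiM UNIV ?P) (\<lambda>x. \<lambda>i\<in>UNIV. x i)
        = PiM UNIV (\<lambda>i. distr (choice_space m) (?P i) (\<lambda>\<omega>. \<omega> i))"
      by (simp only:) (simp add: choice_space_def)
  qed simp
  then have "indep_var (PiM {..<n} ?P) (\<lambda>\<omega>. restrict (\<lambda>i. \<omega> i) {..<n}) (PiM {n} ?P) (\<lambda>\<omega>. restrict (\<lambda>i. \<omega> i) {n})"
    by (rule indep_var_restrict) auto
  then have "indep_var (count_space UNIV) (grow m n \<circ> (\<lambda>\<omega>. restrict (\<lambda>i. \<omega> i) {..<n}))
     (count_space UNIV) ((\<lambda>\<omega>. ({\<omega> n}, {})) \<circ> (\<lambda>\<omega>. restrict (\<lambda>i. \<omega> i) {n}))"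
  proof (rule indep_var_compose)
    have comp: "(\<lambda>\<omega>. \<omega> i) \<in> PiM A ?P \<rightarrow>\<^sub>M count_space UNIV" if "i \<in> A" for i A
      by (rule measurable_compose[OF measurable_component_singleton[OF that]]) auto
    show "grow m n \<in> PiM {..<n} ?P \<rightarrow>\<^sub>M count_space UNIV"
      by (intro measurable_grow_general comp) simp
    show "(\<lambda>\<omega>. ({\<omega> n}, {})) \<in> PiM {n} ?P \<rightarrow>\<^sub>M count_space UNIV"
      by (rule measurable_compose[OF comp, of n]) auto
  qed
  \<comment> \<open>The tree at time n reads only coordinates below n, hence it is independent of
    the parent chosen at time n.\<close>
  moreover have "grow m n \<circ> (\<lambda>\<omega>. restrict (\<lambda>i. \<omega> i) {..<n}) = grow m n"
    by (auto simp: fun_eq_iff intro!: grow_cong simp del: split_paired_All)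
  ultimately show ?thesis by (simp add: comp_def)
qed

lemma nodes_upto_valid: "valid_tree m n t \<Longrightarrow> nodes_upto m n = fst t"
  by (simp add: valid_tree_def nodes_upto_def)

lemma finite_nodes_upto [simp]: "finite (nodes_upto m n)"
  and nodes_upto_nonempty [simp]: "nodes_upto m n \<noteq> {}"
  by (auto simp: nodes_upto_def)

lemma card_nodes_upto: "n \<ge> 1 \<Longrightarrow> real (card (nodes_upto m n)) = tree_size m n"
  by (auto simp: nodes_upto_def root_node_def card_insert_if tree_size_def of_nat_diff)

text \<open>The tree at time n is independent of the next choice, so an event at time n + 1 splits
  by the chosen node into disjoint pieces of weight 1/N_n. This reproduces the recursion of the
  random tree.\<close>

lemma distr_grow:
  "distr (choice_space m) (count_space UNIV) (grow m n) = measure_pmf (recursive_tree m n)"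
proof -
  interpret prob_space "choice_space m" by (rule prob_space_choice_space)
  have single: "distr (choice_space m) (count_space UNIV) (\<lambda>_. t) = measure_pmf (return_pmf t)" for t :: tree
  proof (rule measure_eqI)
    fix A assume "A \<in> sets (distr (choice_space m) (count_space UNIV) (\<lambda>_. t))"
    have "(\<lambda>_. t) -` A \<inter> space (choice_space m) = (if t \<in> A then space (choice_space m) else {})" by auto
    then show "emeasure (distr (choice_space m) (count_space UNIV) (\<lambda>_. t)) A = emeasure (measure_pmf (return_pmf t)) A"
      by (simp add: emeasure_distr emeasure_space_1)
  qed simp
  have "1 \<le> n \<Longrightarrow> ?thesis"
  proof (induction n rule: nat_induct_at_least)
    case base
    have "grow m 1 = (\<lambda>_. ({root_node}, {}))" by (simp add: fun_eq_iff)
    then show ?case using single[of "({root_node}, {})"] by simp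
  next
    case (Suc n)
    then obtain n' where n': "n = Suc n'" by (cases n) auto
    let ?V = "nodes_upto m n"
    have choice: "prob ((\<lambda>\<omega>. \<omega> n) -` B \<inter> space (choice_space m)) = measure_pmf.prob (pmf_of_set ?V) B" for B
    proof -
      have "distr (choice_space m) (measure_pmf (pmf_of_set ?V)) (\<lambda>\<omega>. \<omega> n) = measure_pmf (pmf_of_set ?V)"
        unfolding choice_space_def by (rule distr_PiM_component) (auto intro: prob_space_measure_pmf)
      then have "measure_pmf.prob (pmf_of_set ?V) B = measure (distr (choice_space m) (measure_pmf (pmf_of_set ?V)) (\<lambda>\<omega>. \<omega> n)) B"
        by simp
      also have "\<dots> = prob ((\<lambda>\<omega>. \<omega> n) -` B \<inter> space (choice_space m))"
        by (subst measure_distr) (auto simp: measurable_cong_sets[OF refl sets_measure_pmf_count_space])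
      finally show ?thesis by simp
    qed
    show ?case
    proof (rule measure_eqI)
      fix A assume "A \<in> sets (distr (choice_space m) (count_space UNIV) (grow m (Suc n)))"
      let ?a = "attach m (Suc n)"
      let ?E = "\<lambda>v. (\<lambda>\<omega>. (grow m n \<omega>, ({\<omega> n}, {}) :: tree)) -` ({t. ?a t v \<in> A} \<times> {({v}, {})}) \<inter> space (choice_space m)"
      have E: "prob (?E v) = measure_pmf.prob (recursive_tree m n) {t. ?a t v \<in> A} / tree_size m n" if v: "v \<in> ?V" for v
      proof -
        have "prob (?E v) = prob (grow m n -` {t. ?a t v \<in> A} \<inter> space (choice_space m)) *
           prob ((\<lambda>\<omega>. ({\<omega> n}, {}) :: tree) -` {({v}, {})} \<inter> space (choice_space m))"
          by (rule indep_varD[OF indep_grow_choice]) auto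
        also have "(\<lambda>\<omega>. ({\<omega> n}, {})) -` {({v}, {} :: (node \<times> node) set)} = (\<lambda>\<omega>. \<omega> n) -` {v}" by auto
        also have "prob ((\<lambda>\<omega>. \<omega> n) -` {v} \<inter> space (choice_space m)) = 1 / tree_size m n"
          using v Suc.hyps by (simp add: choice measure_pmf_single card_nodes_upto)
        also have "prob (grow m n -` {t. ?a t v \<in> A} \<inter> space (choice_space m)) = measure_pmf.prob (recursive_tree m n) {t. ?a t v \<in> A}"
          unfolding Suc.IH[symmetric] by (subst measure_distr) auto
        finally show ?thesis by simp
      qed
      have meas: "?E v \<in> events" for v
      proof -
        have m2: "(\<lambda>\<omega>. ({\<omega> n}, {}) :: tree) \<in> choice_space m \<rightarrow>\<^sub>M count_space UNIV"
          by (rule measurable_compose[OF measurable_choice]) auto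
        have "grow m n -` {t. ?a t v \<in> A} \<inter> space (choice_space m) \<inter> ((\<lambda>\<omega>. ({\<omega> n}, {}) :: tree) -` {({v}, {})} \<inter> space (choice_space m)) \<in> events"
          by (rule sets.Int[OF measurable_sets[OF measurable_grow] measurable_sets[OF m2]]) auto
        also have "grow m n -` {t. ?a t v \<in> A} \<inter> space (choice_space m) \<inter> ((\<lambda>\<omega>. ({\<omega> n}, {}) :: tree) -` {({v}, {})} \<inter> space (choice_space m)) = ?E v"
          by auto
        finally show ?thesis .
      qed
      have "AE \<omega> in choice_space m. \<omega> n \<in> ?V"
      proof -
        have "AE v in measure_pmf (pmf_of_set ?V). v \<in> ?V" by (simp add: AE_measure_pmf_iff)
        then show ?thesis unfolding choice_space_def
          by (intro AE_PiM_component) (auto intro: prob_space_measure_pmf)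
      qed
      then have "prob (grow m (Suc n) -` A \<inter> space (choice_space m)) = prob (\<Union>v\<in>?V. ?E v)"
        using meas by (intro finite_measure_eq_AE) (auto simp: n' simp del: split_paired_All intro!: measurable_sets[OF measurable_grow] sets.finite_UN)
      also have "\<dots> = (\<Sum>v\<in>?V. prob (?E v))"
        using meas by (intro finite_measure_finite_Union) (auto simp: disjoint_family_on_def)
      also have "\<dots> = (\<Sum>v\<in>?V. measure_pmf.prob (recursive_tree m n) {t. ?a t v \<in> A} / tree_size m n)"
        by (intro sum.cong refl E)
      also have "\<dots> = (\<Sum>v\<in>?V. tree_expectation m n (\<lambda>t. indicator A (?a t v)) / tree_size m n)"
      proof (intro sum.cong refl arg_cong2[of _ _ _ _ "(/)"])
        fix v
        have "(\<lambda>t. indicator A (?a t v)) = (indicator {t. ?a t v \<in> A} :: tree \<Rightarrow> real)"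
          by (auto simp: indicator_def fun_eq_iff)
        then show "measure_pmf.prob (recursive_tree m n) {t. ?a t v \<in> A} = tree_expectation m n (\<lambda>t. indicator A (?a t v))"
          by simp
      qed
      also have "\<dots> = tree_expectation m n (\<lambda>t. (\<Sum>v\<in>?V. indicator A (?a t v)) / tree_size m n)"
        by (simp add: integrable_recursive_tree[OF Suc.hyps] sum_divide_distrib)
      also have "\<dots> = tree_expectation m (Suc n) (indicator A)"
        unfolding tree_expectation_Suc[OF Suc.hyps]
        by (intro tree_expectation_cong Suc.hyps) (simp add: nodes_upto_valid)
      finally have "prob (grow m (Suc n) -` A \<inter> space (choice_space m)) = measure_pmf.prob (recursive_tree m (Suc n)) A"
        by simp
      then show "emeasure (distr (choice_space m) (count_space UNIV) (grow m (Suc n))) A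
          = emeasure (measure_pmf (recursive_tree m (Suc n))) A"
        by (simp add: emeasure_distr emeasure_eq_measure measure_pmf.emeasure_eq_measure)
    qed simp
  qed
  moreover have "grow m 0 = (\<lambda>_. ({root_node}, {}))" "grow m (Suc 0) = (\<lambda>_. ({root_node}, {}))"
    by (simp_all add: fun_eq_iff)
  ultimately show ?thesis using single by (cases "n = 0") (simp_all del: split_paired_All)
qed

section \<open>Square mean limits of the martingales\<close>

lemma borel_measurable_vector_2 [measurable]:
  fixes f g :: "'a \<Rightarrow> real"
  assumes [measurable]: "f \<in> borel_measurable M" "g \<in> borel_measurable M"
  shows "(\<lambda>x. vector [f x, g x] :: real^2) \<in> borel_measurable M"
proof -
  have "(\<lambda>x. vector [f x, g x] :: real^2) = (\<lambda>x. f x *\<^sub>R axis 1 1 + g x *\<^sub>R axis 2 1)"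
    by (simp add: fun_eq_iff vec_eq_iff forall_2 axis_def)
  then show ?thesis by simp
qed

lemma norm_square_real_2: "(norm (x :: real^2))\<^sup>2 = (x $ 1)\<^sup>2 + (x $ 2)\<^sup>2"
  by (simp add: norm_vec_def L2_set_def sum_2)

text \<open>Orthogonality bounds the mean square distance between times k and n by the tail of a
  convergent series, and \<open>restr_grow\<close> identifies the earlier tree on the same
  history.\<close>

lemma tree_process_limit:
  assumes m: "m \<ge> 1"
  obtains Y Z :: "(nat \<Rightarrow> node) \<Rightarrow> real" where
    "Y \<in> borel_measurable (choice_space m)" "Z \<in> borel_measurable (choice_space m)"
    "integrable (choice_space m) (\<lambda>\<omega>. (Y \<omega>)\<^sup>2)" "integrable (choice_space m) (\<lambda>\<omega>. (Z \<omega>)\<^sup>2)"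
    "(\<lambda>n. \<integral>\<omega>. (wiener_martingale m n (grow m n \<omega>) - Y \<omega>)\<^sup>2 \<partial>choice_space m) \<longlonglongrightarrow> 0"
    "(\<lambda>n. \<integral>\<omega>. (path_martingale m n (grow m n \<omega>) - Z \<omega>)\<^sup>2 \<partial>choice_space m) \<longlonglongrightarrow> 0"
    "\<And>n. integrable (choice_space m) (\<lambda>\<omega>. (wiener_martingale m n (grow m n \<omega>))\<^sup>2)"
    "\<And>n. integrable (choice_space m) (\<lambda>\<omega>. (path_martingale m n (grow m n \<omega>))\<^sup>2)"
proof -
  interpret prob_space "choice_space m" by (rule prob_space_choice_space)
  have tail: "(\<lambda>k. \<Sum>i. increment_bound m (i + k)) \<longlonglongrightarrow> 0"
    using suminf_exist_split2[OF summable_increment_bound[OF m]] .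
  have int: "integrable (choice_space m) (\<lambda>\<omega>. h (grow m n \<omega>))" for h :: "tree \<Rightarrow> real" and n
  proof -
    have "integrable (measure_pmf (recursive_tree m n)) h"
      by (cases "n = 0") (auto intro: integrable_recursive_tree integrable_measure_pmf_finite)
    then show ?thesis
      unfolding distr_grow[symmetric] by (subst (asm) integrable_distr_eq) auto
  qed
  have exp: "(\<integral>\<omega>. h (grow m n \<omega>) \<partial>choice_space m) = tree_expectation m n h" for h n
    unfolding distr_grow[symmetric] by (subst integral_distr) auto
  have lim: "\<exists>g\<in>borel_measurable (choice_space m). integrable (choice_space m) (\<lambda>\<omega>. (g \<omega>)\<^sup>2) \<and>
    (\<forall>n\<ge>1. integrable (choice_space m) (\<lambda>\<omega>. (M n (grow m n \<omega>) - g \<omega>)\<^sup>2)) \<and>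
    (\<lambda>n. \<integral>\<omega>. (M n (grow m n \<omega>) - g \<omega>)\<^sup>2 \<partial>choice_space m) \<longlonglongrightarrow> 0"
    if M: "tree_martingale m M" and e: "\<And>i. i \<ge> 1 \<Longrightarrow>
      tree_expectation m i (\<lambda>t. (\<Sum>v\<in>fst t. (M (Suc i) (attach m (Suc i) t v) - M i t)\<^sup>2) / tree_size m i) \<le> increment_bound m i"
    for M
  proof (rule L2_complete[OF _ int _ tail])
    show "(\<lambda>\<omega>. M n (grow m n \<omega>)) \<in> borel_measurable (choice_space m)" for n
      by (rule measurable_compose[OF measurable_grow]) simp
    fix k n :: nat assume kn: "1 \<le> k" "k \<le> n"
    have "(\<integral>\<omega>. (M n (grow m n \<omega>) - M k (grow m k \<omega>))\<^sup>2 \<partial>choice_space m)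
      = (\<integral>\<omega>. (\<lambda>t. (M n t - M k (restr k t))\<^sup>2) (grow m n \<omega>) \<partial>choice_space m)"
      by (simp add: restr_grow[OF kn])
    also have "\<dots> \<le> (\<Sum>i=k..<n. increment_bound m i)"
      using tree_martingale.increment_square[OF M kn, of "increment_bound m"] e
      by (subst exp) simp
    also have "\<dots> = (\<Sum>i<n - k. increment_bound m (i + k))"
      using kn by (intro sum.reindex_bij_witness[of _ "\<lambda>i. i + k" "\<lambda>i. i - k"]) auto
    also have "\<dots> \<le> (\<Sum>i. increment_bound m (i + k))"
      using summable_increment_bound[OF m] increment_bound_nonneg
      by (intro sum_le_suminf) (auto simp: summable_iff_shift)
    finally show "(\<integral>\<omega>. (M n (grow m n \<omega>) - M k (grow m k \<omega>))\<^sup>2 \<partial>choice_space m) \<le> \<dots>" .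
  qed
  from lim[OF tree_martingale_wiener wiener_martingale_increment]
  obtain Y where Y: "Y \<in> borel_measurable (choice_space m)" "integrable (choice_space m) (\<lambda>\<omega>. (Y \<omega>)\<^sup>2)"
    "(\<lambda>n. \<integral>\<omega>. (wiener_martingale m n (grow m n \<omega>) - Y \<omega>)\<^sup>2 \<partial>choice_space m) \<longlonglongrightarrow> 0" by blast
  from lim[OF tree_martingale_path path_martingale_increment]
  obtain Z where Z: "Z \<in> borel_measurable (choice_space m)" "integrable (choice_space m) (\<lambda>\<omega>. (Z \<omega>)\<^sup>2)"
    "(\<lambda>n. \<integral>\<omega>. (path_martingale m n (grow m n \<omega>) - Z \<omega>)\<^sup>2 \<partial>choice_space m) \<longlonglongrightarrow> 0" by blast
  show ?thesis
    by (rule that[OF Y(1) Z(1) Y(2) Z(2) Y(3) Z(3)]) (rule int)+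
qed

text \<open>Deterministic factors may be exchanged in the limit: c_n U - a V = c_n (U - V) + (c_n -
  a) V.\<close>

lemma L2_scaled_limit:
  fixes U :: "nat \<Rightarrow> 'a \<Rightarrow> real"
  assumes [measurable]: "\<And>n. U n \<in> borel_measurable M" "V \<in> borel_measurable M"
    and sq: "\<And>n. integrable M (\<lambda>x. (U n x)\<^sup>2)" "integrable M (\<lambda>x. (V x)\<^sup>2)"
    and lim: "(\<lambda>n. \<integral>x. (U n x - V x)\<^sup>2 \<partial>M) \<longlonglongrightarrow> 0" and c: "c \<longlonglongrightarrow> a"
  shows "(\<lambda>n. \<integral>x. (c n * U n x - a * V x)\<^sup>2 \<partial>M) \<longlonglongrightarrow> 0"
proof (rule tendsto_sandwich[OF _ _ tendsto_const])
  have int: "integrable M (\<lambda>x. (U n x - V x)\<^sup>2)" for n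
    using sq by (intro integrable_square_diff) auto
  have "(\<integral>x. (c n * U n x - a * V x)\<^sup>2 \<partial>M) \<le> 2 * (c n)\<^sup>2 * (\<integral>x. (U n x - V x)\<^sup>2 \<partial>M) + 2 * (c n - a)\<^sup>2 * (\<integral>x. (V x)\<^sup>2 \<partial>M)" for n
  proof -
    have "(\<integral>x. (c n * U n x - a * V x)\<^sup>2 \<partial>M) \<le> (\<integral>x. 2 * (c n)\<^sup>2 * (U n x - V x)\<^sup>2 + 2 * (c n - a)\<^sup>2 * (V x)\<^sup>2 \<partial>M)"
    proof (rule integral_mono)
      show "integrable M (\<lambda>x. (c n * U n x - a * V x)\<^sup>2)"
        using sq by (intro integrable_square_diff) (auto simp: power_mult_distrib)
      show "integrable M (\<lambda>x. 2 * (c n)\<^sup>2 * (U n x - V x)\<^sup>2 + 2 * (c n - a)\<^sup>2 * (V x)\<^sup>2)"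
        using int sq by auto
      fix x
      have "(p + q)\<^sup>2 \<le> 2 * p\<^sup>2 + 2 * q\<^sup>2" for p q :: real
        using zero_le_power2[of "p - q"] by (simp add: power2_diff power2_sum)
      moreover have "c n * U n x - a * V x = c n * (U n x - V x) + (c n - a) * V x"
        by (simp add: algebra_simps)
      ultimately show "(c n * U n x - a * V x)\<^sup>2 \<le> 2 * (c n)\<^sup>2 * (U n x - V x)\<^sup>2 + 2 * (c n - a)\<^sup>2 * (V x)\<^sup>2"
        by (simp only: mult.assoc flip: power_mult_distrib)
    qed
    then show ?thesis using int sq by simp
  qed
  then show "\<forall>\<^sub>F n in sequentially. (\<integral>x. (c n * U n x - a * V x)\<^sup>2 \<partial>M)
      \<le> 2 * (c n)\<^sup>2 * (\<integral>x. (U n x - V x)\<^sup>2 \<partial>M) + 2 * (c n - a)\<^sup>2 * (\<integral>x. (V x)\<^sup>2 \<partial>M)" by simp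
  have "(\<lambda>n. 2 * (c n)\<^sup>2 * (\<integral>x. (U n x - V x)\<^sup>2 \<partial>M) + 2 * (c n - a)\<^sup>2 * (\<integral>x. (V x)\<^sup>2 \<partial>M))
    \<longlonglongrightarrow> 2 * a\<^sup>2 * 0 + 2 * (a - a)\<^sup>2 * (\<integral>x. (V x)\<^sup>2 \<partial>M)"
    by (intro tendsto_intros lim c)
  then show "(\<lambda>n. 2 * (c n)\<^sup>2 * (\<integral>x. (U n x - V x)\<^sup>2 \<partial>M) + 2 * (c n - a)\<^sup>2 * (\<integral>x. (V x)\<^sup>2 \<partial>M)) \<longlonglongrightarrow> 0"
    by simp
qed simp

section \<open>Cutting the tree at the root\<close>

abbreviation single_tree :: tree where "single_tree \<equiv> ({root_node}, {})"

text \<open>The tree is cut at the root: component \<open>r \<le> m\<close> is the subtree of the \<open>r\<close>-th child with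
  label 2, component \<open>m + 1\<close> is the remaining part, which contains the root. The state consists of
  the highest labels \<open>I r\<close> and the relabelled components \<open>s r\<close>; index \<open>k\<close> corresponds to the
  highest label \<open>k + 2\<close> of the whole tree.\<close>

fun split_tree :: "nat \<Rightarrow> nat \<Rightarrow> ((nat \<Rightarrow> nat) \<times> (nat \<Rightarrow> tree)) pmf" where
  "split_tree m 0 = return_pmf (\<lambda>_. 1, \<lambda>_. single_tree)"
| "split_tree m (Suc k) = bind_pmf (split_tree m k) (\<lambda>(I, s).
     map_pmf (\<lambda>(r, u). (I(r := Suc (I r)), s(r := attach m (Suc (I r)) (s r) u)))
       (pmf_of_set (SIGMA r:{1..m+1}. fst (s r))))"

section \<open>The urn of component sizes\<close>

text \<open>The component of a uniformly chosen node, hence a draw with weights proportional to the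
  sizes. It reads the sizes only and not the trees, which makes the sizes a Polya urn.\<close>

definition urn_pick :: "nat \<Rightarrow> (nat \<Rightarrow> nat) \<Rightarrow> nat pmf" where
  "urn_pick m I = map_pmf fst (pmf_of_set (SIGMA r:{1..m+1}. nodes_upto m (I r)))"

fun urn :: "nat \<Rightarrow> nat \<Rightarrow> (nat \<Rightarrow> nat) pmf" where
  "urn m 0 = return_pmf (\<lambda>_. 1)"
| "urn m (Suc k) = bind_pmf (urn m k) (\<lambda>I. map_pmf (\<lambda>r. I(r := Suc (I r))) (urn_pick m I))"

text \<open>Two-stage sampling: first the component, then a uniform node inside it. This separates
  the urn dynamics from the growth within a component.\<close>

lemma pmf_of_set_Sigma:
  assumes A: "finite A" "A \<noteq> {}" and B: "\<And>a. a \<in> A \<Longrightarrow> finite (B a) \<and> B a \<noteq> {}"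
  shows "pmf_of_set (Sigma A B) =
    bind_pmf (map_pmf fst (pmf_of_set (Sigma A B))) (\<lambda>a. map_pmf (Pair a) (pmf_of_set (B a)))"
proof (rule pmf_eqI)
  fix x :: "'a \<times> 'b"
  obtain a b where x: "x = (a, b)" by force
  let ?S = "Sigma A B"
  have S: "finite ?S" "?S \<noteq> {}" using A B by auto
  have pa: "pmf (map_pmf (Pair a') (pmf_of_set (B a'))) x = (if a' = a \<and> b \<in> B a then 1 / card (B a) else 0)"
    if "a' \<in> A" for a'
  proof (cases "a' = a")
    case True
    have "pmf (map_pmf (Pair a) (pmf_of_set (B a))) (Pair a b) = pmf (pmf_of_set (B a)) b"
      by (rule pmf_map_inj') (auto simp: inj_on_def)
    then show ?thesis using True B[OF that] x by (auto simp: indicator_def)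
  next
    case False
    then show ?thesis by (auto simp: x pmf_eq_0_set_pmf)
  qed
  have "pmf (bind_pmf (map_pmf fst (pmf_of_set ?S)) (\<lambda>a. map_pmf (Pair a) (pmf_of_set (B a)))) x
    = (\<Sum>p\<in>?S. pmf (map_pmf (Pair (fst p)) (pmf_of_set (B (fst p)))) x) / card ?S"
    using S by (simp add: bind_map_pmf pmf_bind_pmf_of_set)
  also have "(\<Sum>p\<in>?S. pmf (map_pmf (Pair (fst p)) (pmf_of_set (B (fst p)))) x)
     = (\<Sum>p\<in>?S. if fst p = a \<and> b \<in> B a then 1 / card (B a) else 0)"
    by (intro sum.cong refl pa) auto
  also have "\<dots> = (\<Sum>a'\<in>A. \<Sum>b'\<in>B a'. if a' = a \<and> b \<in> B a then 1 / card (B a) else 0)"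
    using A B by (subst sum.Sigma) (auto simp: case_prod_unfold)
  also have "\<dots> = (\<Sum>a'\<in>A. if a' = a then (if b \<in> B a then 1 else 0) else 0)"
    using B by (intro sum.cong refl) auto
  also have "\<dots> = (if x \<in> ?S then 1 else 0)"
    using A by (simp add: x)
  finally show "pmf (pmf_of_set ?S) x = pmf (bind_pmf (map_pmf fst (pmf_of_set ?S)) (\<lambda>a. map_pmf (Pair a) (pmf_of_set (B a)))) x"
    using S by (simp add: indicator_def)
qed

lemma urn_ge_1: "I \<in> set_pmf (urn m k) \<Longrightarrow> I r \<ge> 1"
proof (induction k arbitrary: I r)
  case (Suc k)
  then obtain J r' where J: "J \<in> set_pmf (urn m k)" "I = J(r' := Suc (J r'))" by auto
  then show ?case using Suc.IH[OF J(1), of r] by auto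
qed auto

lemma urn_le: "I \<in> set_pmf (urn m k) \<Longrightarrow> I r \<le> k + 1"
proof (induction k arbitrary: I r)
  case (Suc k)
  then obtain J r' where J: "J \<in> set_pmf (urn m k)" "I = J(r' := Suc (J r'))" by auto
  then show ?case using Suc.IH[OF J(1), of r] by auto
qed auto

lemma set_urn_pick: "set_pmf (urn_pick m I) = {1..m+1}"
proof -
  have "(1, root_node) \<in> (SIGMA r:{1..m+1}. nodes_upto m (I r))" by (simp add: nodes_upto_def)
  then have "(SIGMA r:{1..m+1}. nodes_upto m (I r)) \<noteq> {}" by (metis empty_iff)
  moreover have "finite (SIGMA r:{1..m+1}. nodes_upto m (I r))" by auto
  ultimately have "set_pmf (urn_pick m I) = fst ` (SIGMA r:{1..m+1}. nodes_upto m (I r))"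
    unfolding urn_pick_def set_map_pmf by (subst set_pmf_of_set) (assumption | rule refl)+
  moreover have "fst ` (SIGMA r:{1..m+1}. nodes_upto m (I r)) = {1..m+1}"
    by (simp only: fst_image_Sigma) auto
  ultimately show ?thesis by (simp only:)
qed

lemma urn_sum:
  assumes "I \<in> set_pmf (urn m k)"
  shows "(\<Sum>r=1..m+1. tree_size m (I r)) = tree_size m (k + 2)"
  using assms
proof (induction k arbitrary: I)
  case 0
  then show ?case by (simp add: tree_size_def algebra_simps)
next
  case (Suc k)
  then obtain J r where J: "J \<in> set_pmf (urn m k)" "r \<in> {1..m+1}" "I = J(r := Suc (J r))"
    using set_urn_pick by auto
  have "(\<Sum>r=1..m+1. tree_size m (I r)) = tree_size m (J r) + real m + (\<Sum>r\<in>{1..m+1}-{r}. tree_size m (I r))"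
    using J(2) by (subst sum.remove[of _ r]) (auto simp: J(3) tree_size_Suc)
  also have "(\<Sum>r\<in>{1..m+1}-{r}. tree_size m (I r)) = (\<Sum>r\<in>{1..m+1}-{r}. tree_size m (J r))"
    by (intro sum.cong) (auto simp: J(3))
  also have "tree_size m (J r) + real m + \<dots> = (\<Sum>r=1..m+1. tree_size m (J r)) + real m"
    using J(2) by (subst (2) sum.remove[of _ r]) auto
  finally show ?case using Suc.IH[OF J(1)] by (simp add: tree_size_Suc)
qed

lemma finite_set_urn: "finite (set_pmf (urn m k))"
  by (induction k) (auto simp: set_urn_pick)

lemma recursive_tree_Suc:
  assumes "n \<ge> 1"
  shows "recursive_tree m (Suc n) =
    bind_pmf (recursive_tree m n) (\<lambda>t. map_pmf (attach m (Suc n) t) (pmf_of_set (nodes_upto m n)))"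
proof -
  have "recursive_tree m (Suc n) =
    bind_pmf (recursive_tree m n) (\<lambda>t. map_pmf (attach m (Suc n) t) (pmf_of_set (fst t)))"
    using assms by (cases n) auto
  also have "\<dots> = bind_pmf (recursive_tree m n) (\<lambda>t. map_pmf (attach m (Suc n) t) (pmf_of_set (nodes_upto m n)))"
    by (intro bind_pmf_cong refl) (simp only: nodes_upto_valid[OF valid_recursive_tree[OF assms]])
  finally show ?thesis .
qed

abbreviation tree_family :: "nat \<Rightarrow> (nat \<Rightarrow> nat) \<Rightarrow> (nat \<Rightarrow> tree) pmf" where
  "tree_family m I \<equiv> Pi_pmf {1..m+1} single_tree (\<lambda>r. recursive_tree m (I r))"

text \<open>Coordinate r is split off from the product law. The choice of a node in it is
  independent of the other coordinates, so it can be moved next to the tree that it extends.\<close>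

lemma tree_family_step:
  assumes r: "r \<in> {1..m+1}" and I: "I r \<ge> 1"
  shows "bind_pmf (tree_family m I) (\<lambda>s. map_pmf (\<lambda>u. s(r := attach m (Suc (I r)) (s r) u)) (pmf_of_set (nodes_upto m (I r))))
    = tree_family m (I(r := Suc (I r)))"
proof -
  let ?R = "{1..m+1} - {r}" and ?V = "pmf_of_set (nodes_upto m (I r))"
  have ins: "{1..m+1} = insert r ?R" using r by auto
  have *: "tree_family m J = bind_pmf (recursive_tree m (J r)) (\<lambda>y.
     map_pmf (\<lambda>f. f(r := y)) (Pi_pmf ?R single_tree (\<lambda>r. recursive_tree m (J r))))" for J
  proof -
    have "Pi_pmf (insert r ?R) single_tree (\<lambda>r. recursive_tree m (J r)) = map_pmf (\<lambda>(y, f). f(r := y))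
        (pair_pmf (recursive_tree m (J r)) (Pi_pmf ?R single_tree (\<lambda>r. recursive_tree m (J r))))"
      by (rule Pi_pmf_insert) auto
    then show ?thesis unfolding ins[symmetric] pair_pmf_def map_bind_pmf
      by (simp only: map_pmf_def bind_return_pmf bind_assoc_pmf case_prod_conv)
  qed
  have rest: "Pi_pmf ?R single_tree (\<lambda>r'. recursive_tree m ((I(r := Suc (I r))) r')) = Pi_pmf ?R single_tree (\<lambda>r. recursive_tree m (I r))"
    by (intro Pi_pmf_cong) auto
  have "bind_pmf (tree_family m I) (\<lambda>s. map_pmf (\<lambda>u. s(r := attach m (Suc (I r)) (s r) u)) ?V)
    = bind_pmf (recursive_tree m (I r)) (\<lambda>y. bind_pmf (Pi_pmf ?R single_tree (\<lambda>r. recursive_tree m (I r)))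
        (\<lambda>f. bind_pmf ?V (\<lambda>u. return_pmf (f(r := attach m (Suc (I r)) y u)))))"
    unfolding *[of I] by (simp only: bind_assoc_pmf map_pmf_def bind_return_pmf fun_upd_same fun_upd_upd)
  also have "\<dots> = bind_pmf (recursive_tree m (I r)) (\<lambda>y. bind_pmf ?V (\<lambda>u. bind_pmf (Pi_pmf ?R single_tree (\<lambda>r. recursive_tree m (I r)))
        (\<lambda>f. return_pmf (f(r := attach m (Suc (I r)) y u)))))"
    by (subst bind_commute_pmf[of _ ?V]) (rule refl)
  also have "\<dots> = tree_family m (I(r := Suc (I r)))"
    unfolding *[of "I(r := Suc (I r))"] rest
    by (simp only: recursive_tree_Suc[OF I, of m] bind_assoc_pmf map_pmf_def bind_return_pmf fun_upd_same)
  finally show ?thesis .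
qed

lemma valid_tree_family:
  assumes "s \<in> set_pmf (tree_family m I)" "r \<in> {1..m+1}" "I r \<ge> 1"
  shows "valid_tree m (I r) (s r)"
proof -
  have "s r \<in> set_pmf (recursive_tree m (I r))"
    using assms(1,2) by (auto simp: set_Pi_pmf PiE_dflt_def simp del: split_paired_All)
  then show ?thesis using valid_recursive_tree assms(3) by blast
qed

text \<open>Conditionally on the sizes the components are independent recursive trees, because the
  urn never looks at their edges.\<close>

lemma split_tree_eq:
  "split_tree m k = bind_pmf (urn m k) (\<lambda>I. map_pmf (Pair I) (tree_family m I))"
proof (induction k)
  case 0
  show ?case by (simp add: bind_return_pmf)
next
  case (Suc k)
  let ?S = "\<lambda>I. SIGMA r:{1..m+1}. nodes_upto m (I r)"
  let ?step = "\<lambda>I s r u. (I(r := Suc (I r)), s(r := attach m (Suc (I r)) (s r) u))"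
  have "split_tree m (Suc k) = bind_pmf (urn m k) (\<lambda>I. bind_pmf (tree_family m I) (\<lambda>s.
     map_pmf (\<lambda>(r, u). ?step I s r u) (pmf_of_set (SIGMA r:{1..m+1}. fst (s r)))))"
    by (simp add: Suc bind_assoc_pmf bind_map_pmf)
  also have "\<dots> = bind_pmf (urn m k) (\<lambda>I. bind_pmf (tree_family m I) (\<lambda>s.
     map_pmf (\<lambda>(r, u). ?step I s r u) (pmf_of_set (?S I))))"
  \<comment> \<open>The node sets of the components are determined by their highest labels, so the
    sampling set can be written in terms of \<open>I\<close>.\<close>
  proof (intro bind_pmf_cong refl)
    fix I s assume "I \<in> set_pmf (urn m k)" "s \<in> set_pmf (tree_family m I)"
    then have "fst (s r) = nodes_upto m (I r)" if "r \<in> {1..m+1}" for r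
      using nodes_upto_valid[OF valid_tree_family[of s m I r]] urn_ge_1[of I] that by simp
    then have "(SIGMA r:{1..m+1}. fst (s r)) = ?S I"
      by (intro Sigma_cong refl)
    then show "map_pmf (\<lambda>(r, u). ?step I s r u) (pmf_of_set (SIGMA r:{1..m+1}. fst (s r)))
        = map_pmf (\<lambda>(r, u). ?step I s r u) (pmf_of_set (?S I))" by simp
  qed
  also have "\<dots> = bind_pmf (urn m k) (\<lambda>I. bind_pmf (tree_family m I) (\<lambda>s. bind_pmf (urn_pick m I) (\<lambda>r.
     map_pmf (\<lambda>u. ?step I s r u) (pmf_of_set (nodes_upto m (I r))))))"
    unfolding urn_pick_def
    by (subst pmf_of_set_Sigma) (auto simp: map_bind_pmf map_pmf_comp)
  \<comment> \<open>The component is chosen by the sizes alone and may therefore be drawn before the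
    trees.\<close>
  also have "\<dots> = bind_pmf (urn m k) (\<lambda>I. bind_pmf (urn_pick m I) (\<lambda>r. bind_pmf (tree_family m I) (\<lambda>s.
     map_pmf (\<lambda>u. ?step I s r u) (pmf_of_set (nodes_upto m (I r))))))"
    by (subst bind_commute_pmf) simp
  also have "\<dots> = bind_pmf (urn m k) (\<lambda>I. bind_pmf (urn_pick m I) (\<lambda>r. map_pmf (Pair (I(r := Suc (I r)))) (tree_family m (I(r := Suc (I r))))))"
  proof (intro bind_pmf_cong refl)
    fix I r assume I: "I \<in> set_pmf (urn m k)" and r: "r \<in> set_pmf (urn_pick m I)"
    have "bind_pmf (tree_family m I) (\<lambda>s. map_pmf (\<lambda>u. ?step I s r u) (pmf_of_set (nodes_upto m (I r))))
      = map_pmf (Pair (I(r := Suc (I r)))) (bind_pmf (tree_family m I) (\<lambda>s. map_pmf (\<lambda>u. s(r := attach m (Suc (I r)) (s r) u)) (pmf_of_set (nodes_upto m (I r)))))"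
      by (simp add: map_bind_pmf map_pmf_comp)
    also have "bind_pmf (tree_family m I) (\<lambda>s. map_pmf (\<lambda>u. s(r := attach m (Suc (I r)) (s r) u)) (pmf_of_set (nodes_upto m (I r))))
      = tree_family m (I(r := Suc (I r)))"
      using r urn_ge_1[OF I] set_urn_pick by (intro tree_family_step) auto
    finally show "bind_pmf (tree_family m I) (\<lambda>s. map_pmf (\<lambda>u. ?step I s r u) (pmf_of_set (nodes_upto m (I r))))
      = map_pmf (Pair (I(r := Suc (I r)))) (tree_family m (I(r := Suc (I r))))" .
  qed
  also have "\<dots> = bind_pmf (urn m (Suc k)) (\<lambda>I. map_pmf (Pair I) (tree_family m I))"
    by (simp add: bind_assoc_pmf bind_map_pmf)
  finally show ?case .
qed

text \<open>\<open>glued_dist\<close> is the distance in the whole tree expressed in the components: the roots of the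
  components \<open>r \<le> m\<close> have depth 1, and paths between different components run through the root.\<close>

definition glued_depth :: "nat \<Rightarrow> (nat \<Rightarrow> tree) \<Rightarrow> nat \<times> node \<Rightarrow> nat" where
  "glued_depth m s p = (if fst p \<le> m then 1 else 0) + edge_dist (s (fst p)) root_node (snd p)"

definition glued_dist :: "nat \<Rightarrow> (nat \<Rightarrow> tree) \<Rightarrow> nat \<times> node \<Rightarrow> nat \<times> node \<Rightarrow> nat" where
  "glued_dist m s p q = (if fst p = fst q then edge_dist (s (fst p)) (snd p) (snd q)
     else glued_depth m s p + glued_depth m s q)"

section \<open>Isometry between the tree and its glued components\<close>

text \<open>Relabelling makes the pieces different as trees from the parts of the original, so they
  are compared through a root-preserving isometry; path length and Wiener index depend on distances
  only. Validity is included so that the relation can be continued under growth.\<close>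

definition glue :: "nat \<Rightarrow> nat \<Rightarrow> tree \<Rightarrow> (nat \<Rightarrow> nat) \<times> (nat \<Rightarrow> tree) \<Rightarrow> bool" where
  "glue m n t = (\<lambda>(I, s). valid_tree m n t \<and> (\<forall>r\<in>{1..m+1}. valid_tree m (I r) (s r)) \<and>
     (\<exists>\<phi>. bij_betw \<phi> (SIGMA r:{1..m+1}. fst (s r)) (fst t) \<and> \<phi> (m + 1, root_node) = root_node \<and>
        (\<forall>p\<in>(SIGMA r:{1..m+1}. fst (s r)). \<forall>q\<in>(SIGMA r:{1..m+1}. fst (s r)).
           edge_dist t (\<phi> p) (\<phi> q) = glued_dist m s p q)))"

lemma glued_dist_sym: "glued_dist m s p q = glued_dist m s q p"
  by (simp add: glued_dist_def edge_dist_sym)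

lemma glue_start: "glue m 2 (attach m 2 single_tree root_node) (\<lambda>_. 1, \<lambda>_. single_tree)"
proof -
  let ?t = "attach m 2 single_tree root_node"
  let ?S = "SIGMA r:{1..m+1}. {root_node}"
  have v: "valid_tree m 1 single_tree" by (rule valid_tree_single)
  have s2: "Suc 1 = 2" by simp
  note d = edge_dist_attach_old[OF v, of root_node] edge_dist_attach_new_old[OF v, of root_node]
    edge_dist_attach_new_new[OF v, of root_node]
  note d = d[unfolded s2]
  \<comment> \<open>Components are numbered from 1 and node indices from 0, hence the shift by one.
    Component m + 1 keeps the root.\<close>
  define \<phi> :: "nat \<times> node \<Rightarrow> node" where "\<phi> p = (if fst p = m + 1 then root_node else (2, fst p - 1))" for p
  have \<phi>_root: "\<phi> (Suc m, root_node) = root_node" by (simp add: \<phi>_def)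
  have new: "\<phi> (r, root_node) \<in> new_nodes m 2" if "r \<in> {1..m+1}" "r \<noteq> m + 1" for r
    using that by (auto simp: \<phi>_def new_nodes_def)
  have "bij_betw \<phi> ?S (fst ?t)"
    unfolding bij_betw_def
  proof
    show "inj_on \<phi> ?S" by (auto simp: inj_on_def \<phi>_def root_node_def split: if_splits)
    show "\<phi> ` ?S = fst ?t"
    proof
      show "\<phi> ` ?S \<subseteq> fst ?t" using new by (auto simp: \<phi>_def)
      show "fst ?t \<subseteq> \<phi> ` ?S"
      proof
        fix x assume "x \<in> fst ?t"
        then consider "x = root_node" | i where "x = (2, i)" "i < m" by (auto simp: new_nodes_def)
        then show "x \<in> \<phi> ` ?S"
        proof cases
          case 1
          then have "x = \<phi> (m + 1, root_node)" by (simp add: \<phi>_def)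
          then show ?thesis by (rule image_eqI) auto
        next
          case 2
          then have "x = \<phi> (i + 1, root_node)" by (simp add: \<phi>_def)
          then show ?thesis using 2(2) by (intro image_eqI) auto
        qed
      qed
    qed
  qed
  moreover have "edge_dist ?t (\<phi> p) (\<phi> q) = glued_dist m (\<lambda>_. single_tree) p q" if pq: "p \<in> ?S" "q \<in> ?S" for p q
  proof -
    obtain r r' where p: "p = (r, root_node)" and q: "q = (r', root_node)"
      and r: "r \<in> {1..m+1}" "r' \<in> {1..m+1}" using pq by auto
    consider "r = r'" | "r \<noteq> r'" "r = m + 1" | "r \<noteq> r'" "r' = m + 1" | "r \<noteq> r'" "r \<noteq> m + 1" "r' \<noteq> m + 1"
      by blast
    then show ?thesis
    proof cases
      case 2
      then show ?thesis using d(2)[of root_node "\<phi> q"] new[OF r(2)] r unfolding p q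
        by (simp add: glued_dist_def glued_depth_def \<phi>_root edge_dist_sym[of _ root_node "\<phi> (r', root_node)"])
    next
      case 3
      then show ?thesis using d(2)[of root_node "\<phi> p"] new[OF r(1)] r unfolding p q
        by (simp add: glued_dist_def glued_depth_def \<phi>_root)
    next
      case 4
      have "\<phi> p \<noteq> \<phi> q" using 4 r by (auto simp: p q \<phi>_def)
      then have "edge_dist ?t (\<phi> p) (\<phi> q) = 2"
        using new[OF r(1) 4(2)] new[OF r(2) 4(3)] unfolding p q by (intro d(3)) auto
      then show ?thesis using 4 r by (auto simp: p q glued_dist_def glued_depth_def)
    qed (simp add: p q glued_dist_def)
  qed
  moreover have "\<phi> (m + 1, root_node) = root_node" by (simp add: \<phi>_def)
  moreover have "valid_tree m 2 ?t" using valid_tree_attach[OF v, of root_node] by (simp add: numeral_2_eq_2)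
  ultimately show ?thesis
    unfolding glue_def case_prod_conv fst_conv using valid_tree_single[of m] by blast
qed

text \<open>Attaching leaves at corresponding nodes preserves the isometry, since in both trees the
  new distances are the same function of the distances to the parent.\<close>

lemma glue_attach:
  assumes g: "valid_tree m n t" "\<forall>r\<in>{1..m+1}. valid_tree m (I r) (s r)"
    and bij: "bij_betw \<phi> (SIGMA r:{1..m+1}. fst (s r)) (fst t)" and root: "\<phi> (m + 1, root_node) = root_node"
    and dist: "\<And>p q. p \<in> (SIGMA r:{1..m+1}. fst (s r)) \<Longrightarrow> q \<in> (SIGMA r:{1..m+1}. fst (s r)) \<Longrightarrow>
        edge_dist t (\<phi> p) (\<phi> q) = glued_dist m s p q"
    and r: "r \<in> {1..m+1}" and u: "u \<in> fst (s r)"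
  shows "glue m (Suc n) (attach m (Suc n) t (\<phi> (r, u))) (I(r := Suc (I r)), s(r := attach m (Suc (I r)) (s r) u))"
proof -
  let ?S = "SIGMA r:{1..m+1}. fst (s r)" and ?s = "s(r := attach m (Suc (I r)) (s r) u)"
  let ?S' = "SIGMA r:{1..m+1}. fst (?s r)" and ?t = "attach m (Suc n) t (\<phi> (r, u))"
  let ?L = "new_nodes m (Suc (I r))"
  have vr: "valid_tree m (I r) (s r)" using g(2) r by blast
  note fresh = new_nodes_fresh[OF vr]
  have v: "\<phi> (r, u) \<in> fst t" using bij r u by (auto simp: bij_betw_def)
  \<comment> \<open>New leaves carry the label \<open>Suc (I r)\<close> in the component and
    \<open>Suc n\<close> in the whole tree; they are matched by their index among the
    siblings.\<close>
  define \<psi> where "\<psi> p = (if fst p = r \<and> snd p \<in> ?L then (Suc n, snd (snd p)) else \<phi> p)" for p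
  have S': "?S' = ?S \<union> {r} \<times> ?L" using r by (auto split: if_splits)
  have old: "\<psi> p = \<phi> p" if "p \<in> ?S" for p using that fresh by (auto simp: \<psi>_def)
  have new: "\<psi> (r, w) \<in> new_nodes m (Suc n)" if "w \<in> ?L" for w using that by (auto simp: \<psi>_def new_nodes_def)
  have old_in: "\<psi> p \<in> fst t" if "p \<in> ?S" for p using old[OF that] bij that by (auto simp: bij_betw_def)
  have "bij_betw \<psi> (?S \<union> {r} \<times> ?L) (fst t \<union> new_nodes m (Suc n))"
  proof (rule bij_betw_combine)
    show "bij_betw \<psi> ?S (fst t)" using bij old by (subst bij_betw_cong[of _ _ \<phi>]) auto
    show "bij_betw \<psi> ({r} \<times> ?L) (new_nodes m (Suc n))"
      by (rule bij_betw_byWitness[where f' = "\<lambda>x. (r, (Suc (I r), snd x))"]) (auto simp: \<psi>_def new_nodes_def)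
    show "fst t \<inter> new_nodes m (Suc n) = {}" using new_nodes_fresh[OF g(1)] by auto
  qed
  then have bij': "bij_betw \<psi> ?S' (fst ?t)" by (simp only: S' fst_attach)
  have depth_old: "glued_depth m ?s q = glued_depth m s q" if "q \<in> ?S" for q
    using that edge_dist_attach_old[OF vr u valid_tree_root[OF vr]] by (auto simp: glued_depth_def)
  have depth_new: "glued_depth m ?s (r, w) = glued_depth m s (r, u) + 1" if "w \<in> ?L" for w
    using edge_dist_attach_new_old[OF vr u valid_tree_root[OF vr] that]
    by (simp add: glued_depth_def edge_dist_sym[of _ root_node])
  have new_old: "edge_dist ?t (\<psi> (r, w)) (\<psi> q) = glued_dist m ?s (r, w) q" if w: "w \<in> ?L" and q: "q \<in> ?S" for w q
  proof -
    have "edge_dist ?t (\<psi> (r, w)) (\<psi> q) = edge_dist t (\<phi> (r, u)) (\<phi> q) + 1"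
      using edge_dist_attach_new_old[OF g(1) v old_in[OF q] new[OF w]] old[OF q] by simp
    also have "\<dots> = glued_dist m s (r, u) q + 1" using dist[OF _ q, of "(r, u)"] r u by simp
    also have "\<dots> = glued_dist m ?s (r, w) q"
    proof (cases "fst q = r")
      case True
      then have "snd q \<in> fst (s r)" using q by auto
      from edge_dist_attach_new_old[OF vr u this w] True show ?thesis by (simp add: glued_dist_def)
    next
      case False
      then show ?thesis using depth_old[OF q] depth_new[OF w] by (simp add: glued_dist_def)
    qed
    finally show ?thesis .
  qed
  have "edge_dist ?t (\<psi> p) (\<psi> q) = glued_dist m ?s p q" if pq: "p \<in> ?S'" "q \<in> ?S'" for p q
  proof -
    from pq consider "p \<in> ?S" "q \<in> ?S" | w where "p = (r, w)" "w \<in> ?L" "q \<in> ?S"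
      | w where "q = (r, w)" "w \<in> ?L" "p \<in> ?S" | w w' where "p = (r, w)" "w \<in> ?L" "q = (r, w')" "w' \<in> ?L"
      unfolding S' by blast
    then show ?thesis
    proof cases
      case 1
      have "edge_dist ?t (\<psi> p) (\<psi> q) = edge_dist t (\<psi> p) (\<psi> q)"
        by (rule edge_dist_attach_old[OF g(1) v old_in[OF 1(1)] old_in[OF 1(2)]])
      also have "\<dots> = glued_dist m s p q" using dist[OF 1] old[OF 1(1)] old[OF 1(2)] by simp
      also have "\<dots> = glued_dist m ?s p q"
      proof (cases "fst p = r \<and> fst q = r")
        case True
        then have "snd p \<in> fst (s r)" "snd q \<in> fst (s r)" using 1 by auto
        from edge_dist_attach_old[OF vr u this] True show ?thesis by (simp add: glued_dist_def)
      next
        case False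
        then show ?thesis using depth_old[OF 1(1)] depth_old[OF 1(2)] by (auto simp: glued_dist_def)
      qed
      finally show ?thesis .
    next
      case (2 w)
      then show ?thesis using new_old by simp
    next
      case (3 w)
      then show ?thesis using new_old[OF 3(2,3)] by (simp only: edge_dist_sym[of ?t "\<psi> p"] glued_dist_sym[of m ?s p])
    next
      case (4 w w')
      show ?thesis
      proof (cases "w = w'")
        case True then show ?thesis using 4 by (simp add: glued_dist_def)
      next
        case False
        have "\<psi> p \<noteq> \<psi> q"
          using inj_onD[OF bij_betw_imp_inj_on[OF bij'] _ pq] False 4(1,3) by auto
        then have "edge_dist ?t (\<psi> p) (\<psi> q) = 2"
          using edge_dist_attach_new_new[OF g(1) v] new 4 by simp
        then show ?thesis
          using edge_dist_attach_new_new[OF vr u 4(2,4) False] 4 by (simp add: glued_dist_def)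
      qed
    qed
  qed
  moreover have "\<psi> (m + 1, root_node) = root_node"
  proof -
    have "valid_tree m (I (m + 1)) (s (m + 1))" using g(2) by simp
    then have "(m + 1, root_node) \<in> ?S" using valid_tree_root by simp
    then show ?thesis using old root by simp
  qed
  moreover have "\<forall>r'\<in>{1..m+1}. valid_tree m ((I(r := Suc (I r))) r') (?s r')"
    using g(2) valid_tree_attach[OF vr u] by auto
  moreover note bij' valid_tree_attach[OF g(1) v]
  ultimately show ?thesis
    unfolding glue_def case_prod_conv by (intro conjI exI[of _ \<psi>] ballI) auto
qed

text \<open>A coupling of the two growth processes: both use the same uniform node, read in the tree
  and in the disjoint union of the components.\<close>

lemma rel_recursive_split:
  "rel_pmf (glue m (k + 2)) (recursive_tree m (k + 2)) (split_tree m k)"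
proof (induction k)
  case 0
  have "recursive_tree m 2 = return_pmf (attach m 2 single_tree root_node)"
    by (simp add: numeral_2_eq_2 bind_return_pmf pmf_of_set_singleton)
  then show ?case using glue_start by (simp add: numeral_2_eq_2)
next
  case (Suc k)
  have eq: "recursive_tree m (Suc k + 2) = bind_pmf (recursive_tree m (k + 2))
       (\<lambda>t. map_pmf (attach m (Suc (k + 2)) t) (pmf_of_set (fst t)))" by simp
  show ?case unfolding eq split_tree.simps
  proof (rule rel_pmf_bindI[OF Suc])
    fix t and Is :: "(nat \<Rightarrow> nat) \<times> (nat \<Rightarrow> tree)" assume g: "glue m (k + 2) t Is"
    obtain I s where Is: "Is = (I, s)" by force
    let ?S = "SIGMA r:{1..m+1}. fst (s r)"
    from g obtain \<phi> where v: "valid_tree m (k + 2) t" "\<forall>r\<in>{1..m+1}. valid_tree m (I r) (s r)"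
      and \<phi>: "bij_betw \<phi> ?S (fst t)" "\<phi> (m + 1, root_node) = root_node"
        "\<And>p q. p \<in> ?S \<Longrightarrow> q \<in> ?S \<Longrightarrow> edge_dist t (\<phi> p) (\<phi> q) = glued_dist m s p q"
      unfolding glue_def Is case_prod_conv by blast
    have fin: "finite ?S" using v(2) valid_tree_finite by blast
    have "valid_tree m (I 1) (s 1)" using v(2) by simp
    then have "(1, root_node) \<in> ?S" using valid_tree_root by simp
    then have ne: "?S \<noteq> {}" by (metis empty_iff)
    \<comment> \<open>A bijection carries the uniform law to the uniform law, so one draw from the
      components drives both sides.\<close>
    have "pmf_of_set (fst t) = map_pmf \<phi> (pmf_of_set ?S)"
      using \<phi>(1) fin ne by (subst map_pmf_of_set_inj) (auto simp: bij_betw_def simp del: Sigma_empty_iff)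
    moreover have "rel_pmf (glue m (Suc k + 2)) (map_pmf (attach m (Suc (k + 2)) t) (map_pmf \<phi> (pmf_of_set ?S)))
      (map_pmf (\<lambda>(r, u). (I(r := Suc (I r)), s(r := attach m (Suc (I r)) (s r) u))) (pmf_of_set ?S))"
      unfolding map_pmf_comp pmf.rel_map
    proof (rule rel_pmf_reflI)
      fix p assume "p \<in> set_pmf (pmf_of_set ?S)"
      then have "p \<in> ?S" unfolding set_pmf_of_set[OF ne fin] .
      then obtain r u where p: "p = (r, u)" "r \<in> {1..m+1}" "u \<in> fst (s r)" by blast
      show "glue m (Suc k + 2) (attach m (Suc (k + 2)) t (\<phi> p)) (case p of (r, u) \<Rightarrow> (I(r := Suc (I r)), s(r := attach m (Suc (I r)) (s r) u)))"
        using glue_attach[OF v \<phi> p(2,3)] by (simp add: p(1))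
    qed
    ultimately show "rel_pmf (glue m (Suc k + 2)) (map_pmf (attach m (Suc (k + 2)) t) (pmf_of_set (fst t)))
      (case Is of (I, s) \<Rightarrow> map_pmf (\<lambda>(r, u). (I(r := Suc (I r)), s(r := attach m (Suc (I r)) (s r) u)))
         (pmf_of_set (SIGMA r:{1..m+1}. fst (s r))))"
      unfolding Is case_prod_conv by simp
  qed
qed

text \<open>Pairs in different components are joined through the root, so their distance is a sum of
  two depths and the double sum factorises. The indicator \<open>c r\<close> adds the edge from the
  root to the components r at most m.\<close>

lemma glue_statistics:
  assumes g: "glue m n t (I, s)"
  defines "N \<equiv> \<lambda>r. tree_size m (I r)" and "c \<equiv> \<lambda>r::nat. if r \<le> m then 1 else 0 :: real"
  shows "path_length t = (\<Sum>r=1..m+1. path_length (s r) + c r * N r)"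
    and "wiener_index t = (\<Sum>r=1..m+1. wiener_index (s r)
           + (path_length (s r) + c r * N r) * (tree_size m n - N r))"
    and "(\<Sum>r=1..m+1. N r) = tree_size m n"
proof -
  let ?R = "{1..m+1}" let ?S = "SIGMA r:?R. fst (s r)"
  from g obtain \<phi> where v: "valid_tree m n t" "\<And>r. r \<in> ?R \<Longrightarrow> valid_tree m (I r) (s r)"
    and \<phi>: "bij_betw \<phi> ?S (fst t)" "\<phi> (m + 1, root_node) = root_node"
      "\<And>p q. p \<in> ?S \<Longrightarrow> q \<in> ?S \<Longrightarrow> edge_dist t (\<phi> p) (\<phi> q) = glued_dist m s p q"
    unfolding glue_def case_prod_conv by blast
  have fin: "finite (fst (s r))" if "r \<in> ?R" for r using v(2)[OF that] valid_tree_finite by blast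
  have card: "real (card (fst (s r))) = N r" if "r \<in> ?R" for r
    using card_tree_size[OF v(2)[OF that]] by (simp add: N_def)
  have sum: "(\<Sum>x\<in>fst t. h x) = (\<Sum>r\<in>?R. \<Sum>x\<in>fst (s r). h (\<phi> (r, x)))" for h :: "node \<Rightarrow> real"
  proof -
    have "(\<Sum>x\<in>fst t. h x) = (\<Sum>p\<in>?S. h (\<phi> p))"
      by (rule sum.reindex_bij_betw[OF \<phi>(1), symmetric])
    also have "\<dots> = (\<Sum>r\<in>?R. \<Sum>x\<in>fst (s r). h (\<phi> (r, x)))"
      using fin by (subst sum.Sigma) (auto simp: case_prod_unfold)
    finally show ?thesis .
  qed
  have "tree_size m n = (\<Sum>x\<in>fst t. 1)" using card_tree_size[OF v(1)] by simp
  also have "\<dots> = (\<Sum>r\<in>?R. N r)" unfolding sum using card by simp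
  finally show N: "(\<Sum>r=1..m+1. N r) = tree_size m n" by simp
  define E where "E r = path_length (s r) + c r * N r" for r
  have depth: "(\<Sum>x\<in>fst (s r). real (glued_depth m s (r, x))) = E r" if "r \<in> ?R" for r
    using card[OF that] by (simp add: glued_depth_def E_def path_length_def sum.distrib c_def)
  have "valid_tree m (I (m + 1)) (s (m + 1))" using v(2) by simp
  then have root: "(m + 1, root_node) \<in> ?S" using valid_tree_root by simp
  have "edge_dist t root_node (\<phi> p) = glued_depth m s p" if p: "p \<in> ?S" for p
    using \<phi>(3)[OF root p] unfolding \<phi>(2) by (auto simp: glued_dist_def glued_depth_def)
  then have "path_length t = (\<Sum>r\<in>?R. \<Sum>x\<in>fst (s r). real (glued_depth m s (r, x)))"
    unfolding path_length_def sum by (intro sum.cong refl) auto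
  also have "\<dots> = (\<Sum>r\<in>?R. E r)" by (intro sum.cong refl depth)
  finally show "path_length t = (\<Sum>r=1..m+1. path_length (s r) + c r * N r)" by (simp add: E_def)
  \<comment> \<open>The cross term is also granted to equal components and taken back in the
    conditional part; the double sum over components then becomes a product of two single
    sums.\<close>
  have block: "(\<Sum>x\<in>fst (s r). \<Sum>y\<in>fst (s r'). real (glued_dist m s (r, x) (r', y))) =
      (if r' = r then 2 * wiener_index (s r) - 2 * E r * N r else 0) + (E r * N r' + N r * E r')"
    if r: "r \<in> ?R" "r' \<in> ?R" for r r'
  proof (cases "r' = r")
    case True
    then show ?thesis by (simp add: glued_dist_def wiener_index_def)
  next
    case False
    then have "(\<Sum>x\<in>fst (s r). \<Sum>y\<in>fst (s r'). real (glued_dist m s (r, x) (r', y)))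
      = (\<Sum>x\<in>fst (s r). \<Sum>y\<in>fst (s r'). real (glued_depth m s (r, x)) + real (glued_depth m s (r', y)))"
      by (simp add: glued_dist_def)
    also have "\<dots> = E r * N r' + N r * E r'"
      using r by (simp add: sum.distrib depth card flip: sum_distrib_right sum_distrib_left)
    finally show ?thesis using False by simp
  qed
  have "2 * wiener_index t = (\<Sum>r\<in>?R. \<Sum>x\<in>fst (s r). \<Sum>r'\<in>?R. \<Sum>y\<in>fst (s r'). real (edge_dist t (\<phi> (r, x)) (\<phi> (r', y))))"
    unfolding wiener_index_def sum by simp
  also have "\<dots> = (\<Sum>r\<in>?R. \<Sum>x\<in>fst (s r). \<Sum>r'\<in>?R. \<Sum>y\<in>fst (s r'). real (glued_dist m s (r, x) (r', y)))"
    by (intro sum.cong refl arg_cong[of _ _ real] \<phi>(3)) auto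
  also have "\<dots> = (\<Sum>r\<in>?R. \<Sum>r'\<in>?R. \<Sum>x\<in>fst (s r). \<Sum>y\<in>fst (s r'). real (glued_dist m s (r, x) (r', y)))"
    by (intro sum.cong refl sum.swap)
  also have "\<dots> = (\<Sum>r\<in>?R. \<Sum>r'\<in>?R. (if r' = r then 2 * wiener_index (s r) - 2 * E r * N r else 0) + (E r * N r' + N r * E r'))"
    by (intro sum.cong refl block)
  also have "\<dots> = (\<Sum>r\<in>?R. 2 * wiener_index (s r) - 2 * E r * N r) + ((\<Sum>r\<in>?R. E r) * tree_size m n + tree_size m n * (\<Sum>r\<in>?R. E r))"
    unfolding sum.distrib sum_product[symmetric] N by simp
  also have "\<dots> = (\<Sum>r\<in>?R. 2 * (wiener_index (s r) + E r * (tree_size m n - N r)))"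
    by (simp only: sum.distrib[symmetric] sum_distrib_left sum_distrib_right) (intro sum.cong refl, simp add: algebra_simps)
  also have "\<dots> = 2 * (\<Sum>r\<in>?R. wiener_index (s r) + E r * (tree_size m n - N r))"
    by (simp only: sum_distrib_left)
  finally show "wiener_index t = (\<Sum>r=1..m+1. wiener_index (s r)
      + (path_length (s r) + c r * N r) * (tree_size m n - N r))"
    by (simp only: E_def mult_cancel_left) simp
qed

section \<open>The exact distributional recursion\<close>

text \<open>Normalising by the size instead of the label makes the coefficients of the recursion
  exact functions of the shares. The factors m^2 and m are the limits of N^2/n^2 and N/n, so the
  limit agrees with that of \<open>normalized_law\<close>; they also produce the factor m in the
  upper right entry of \<open>A_mat\<close>.\<close>

definition scaled_stats :: "nat \<Rightarrow> nat \<Rightarrow> tree \<Rightarrow> real^2" where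
  "scaled_stats m n t = vector
     [(real m)\<^sup>2 * ((wiener_index t - wiener_mean m n) / (tree_size m n)\<^sup>2),
      real m * ((path_length t - path_mean m n) / tree_size m n)]"

definition share :: "nat \<Rightarrow> nat \<Rightarrow> (nat \<Rightarrow> nat) \<Rightarrow> nat \<Rightarrow> real" where
  "share m n I = (\<lambda>r\<in>{1..m+1}. tree_size m (I r) / tree_size m n)"

definition mean_gap :: "nat \<Rightarrow> nat \<Rightarrow> real" where
  "mean_gap m n = harm_sum m n - ln (tree_size m n)"

text \<open>The lower-order part of the mean: \<open>wiener_mean\<close> equals N^2 (h - 1 +
  \<open>wiener_gap\<close>).\<close>

definition wiener_gap :: "nat \<Rightarrow> nat \<Rightarrow> real" where
  "wiener_gap m n = (real m * harm_sum m n + 1) / tree_size m n"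

text \<open>The difference between the exact toll, which contains \<open>harm_sum\<close> of the
  sizes, and \<open>b_vec\<close> at the shares, which contains logarithms of the shares.\<close>

definition toll_error :: "nat \<Rightarrow> nat \<Rightarrow> (nat \<Rightarrow> nat) \<Rightarrow> real^2" where
  "toll_error m n I = vector
     [(real m)\<^sup>2 * ((\<Sum>r=1..m+1. share m n I r * mean_gap m (I r)) - mean_gap m n
         + (\<Sum>r=1..m+1. (share m n I r)\<^sup>2 * wiener_gap m (I r)) - wiener_gap m n),
      real m * ((\<Sum>r=1..m+1. share m n I r * mean_gap m (I r)) - mean_gap m n)]"

definition toll_map :: "nat \<Rightarrow> (nat \<Rightarrow> real) \<Rightarrow> (nat \<Rightarrow> real^2) \<Rightarrow> real^2" where
  "toll_map m V X = (\<Sum>r=1..m+1. A_mat m V r *v X r) + b_vec m V"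

lemma A_mat_mult: "A_mat m V r *v x =
    vector [(V r)\<^sup>2 * x $ 1 + real m * V r * (1 - V r) * x $ 2, V r * x $ 2]"
  by (simp add: A_mat_def matrix_vector_mult_def vec_eq_iff forall_2 sum_2)

lemma toll_map_nth:
  "toll_map m V X $ 1 = (\<Sum>r=1..m+1. (V r)\<^sup>2 * X r $ 1 + real m * V r * (1 - V r) * X r $ 2) + b_vec m V $ 1"
  "toll_map m V X $ 2 = (\<Sum>r=1..m+1. V r * X r $ 2) + b_vec m V $ 2"
  by (simp_all only: toll_map_def A_mat_mult vector_add_component sum_component vector_2)

text \<open>An identity without error term beyond \<open>toll_error\<close>: the means of the
  components are subtracted and added in \<open>glue_statistics\<close>, and what is left over is
  the toll.\<close>

lemma scaled_stats_glue:
  assumes g: "glue m n t (I, s)"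
  shows "scaled_stats m n t = toll_map m (share m n I) (\<lambda>r. scaled_stats m (I r) (s r)) + toll_error m n I"
proof -
  let ?R = "{1..m+1}"
  define N where "N r = tree_size m (I r)" for r
  define M where "M = tree_size m n"
  define c where "c r = (if r \<le> m then 1 else 0 :: real)" for r :: nat
  define v where "v = share m n I"
  define h where "h r = harm_sum m (I r)" for r
  define H where "H = harm_sum m n"
  define P where "P r = path_length (s r)" for r
  define W where "W r = wiener_index (s r)" for r
  note stats = glue_statistics[OF g, folded N_def c_def M_def P_def W_def]
  have n: "n \<ge> 1" "\<And>r. r \<in> ?R \<Longrightarrow> I r \<ge> 1" using g by (auto simp: glue_def valid_tree_def)
  have M: "M > 0" using n tree_size_pos by (simp add: M_def)
  have N: "N r > 0" if "r \<in> ?R" for r using n that tree_size_pos by (simp add: N_def)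
  have v: "v r = N r / M" if "r \<in> ?R" for r using that by (simp add: v_def share_def N_def M_def)
  have v1: "(\<Sum>r\<in>?R. v r) = 1"
  proof -
    have "(\<Sum>r\<in>?R. v r) = (\<Sum>r\<in>?R. N r) / M" by (simp only: sum_divide_distrib) (intro sum.cong refl v)
    then show ?thesis using stats(3) M by simp
  qed
  \<comment> \<open>The logarithm of a component size is that of its share plus that of the total.
    As the shares sum to one, the logarithm of the total cancels against the mean of the whole tree
    and V ln V remains.\<close>
  have gap: "v r * h r = v r * mean_gap m (I r) + v r * ln (v r) + v r * ln M" if "r \<in> ?R" for r
    using v[OF that] N[OF that] M by (simp add: mean_gap_def N_def[symmetric] h_def ln_div algebra_simps)
  have "(\<Sum>r\<in>?R. v r * h r) = (\<Sum>r\<in>?R. v r * mean_gap m (I r)) + (\<Sum>r\<in>?R. v r * ln (v r)) + (\<Sum>r\<in>?R. v r) * ln M"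
    by (simp only: sum_distrib_right sum.distrib[symmetric]) (intro sum.cong refl gap)
  then have vh: "(\<Sum>r\<in>?R. v r * h r) - H = (\<Sum>r\<in>?R. v r * mean_gap m (I r)) - mean_gap m n + (\<Sum>r\<in>?R. v r * ln (v r))"
    by (simp only: v1) (simp add: mean_gap_def M_def H_def)
  have c_sum: "(\<Sum>r\<in>?R. c r * f r) = (\<Sum>r=1..m. f r)" for f
  proof -
    have "(\<Sum>r\<in>?R. c r * f r) = (\<Sum>r=1..m. c r * f r)" by (simp add: c_def)
    also have "\<dots> = (\<Sum>r=1..m. f r)" by (intro sum.cong) (auto simp: c_def)
    finally show ?thesis .
  qed
  have cv: "(\<Sum>r\<in>?R. c r * v r) = 1 - v (m + 1)" using v1 unfolding c_sum by simp
  have pm: "path_mean m (I r) = N r * h r" for r by (simp add: path_mean_def N_def h_def)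
  have wm: "wiener_mean m (I r) = (N r)\<^sup>2 * (h r - 1 + wiener_gap m (I r))" if "r \<in> ?R" for r
    using N[OF that] by (simp add: wiener_mean_def wiener_gap_def N_def h_def field_simps power2_eq_square)
  have wM: "wiener_mean m n = M\<^sup>2 * (H - 1 + wiener_gap m n)"
    using M by (simp add: wiener_mean_def wiener_gap_def M_def H_def field_simps power2_eq_square)
  have pM: "path_mean m n / M = H" using M by (simp add: path_mean_def M_def H_def)
  have comp2: "(path_length t - path_mean m n) / M =
      (\<Sum>r\<in>?R. v r * ((P r - path_mean m (I r)) / N r)) + ((\<Sum>r\<in>?R. v r * h r) - H) + (1 - v (m + 1))"
  proof -
    have "(\<Sum>r\<in>?R. v r * ((P r - path_mean m (I r)) / N r)) + (\<Sum>r\<in>?R. v r * h r) + (\<Sum>r\<in>?R. c r * v r)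
      = (\<Sum>r\<in>?R. (P r + c r * N r) / M)"
      unfolding sum.distrib[symmetric]
    proof (intro sum.cong refl)
      fix r assume "r \<in> ?R"
      then show "v r * ((P r - path_mean m (I r)) / N r) + v r * h r + c r * v r = (P r + c r * N r) / M"
        using N[of r] M by (simp add: v pm field_simps)
    qed
    also have "\<dots> = path_length t / M" unfolding stats(1) by (simp only: sum_divide_distrib)
    finally show ?thesis using cv pM
      unfolding diff_divide_distrib[of "path_length t" "path_mean m n"] by linarith
  qed
  \<comment> \<open>Centring the Wiener indices gives terms with -v^2 h, and centring the path
    lengths with coefficient v (1 - v) gives terms with +v^2 h; only the linear terms v h survive,
    as in the second coordinate.\<close>
  have comp1: "(wiener_index t - wiener_mean m n) / M\<^sup>2 =
      (\<Sum>r\<in>?R. (v r)\<^sup>2 * ((W r - wiener_mean m (I r)) / (N r)\<^sup>2) + v r * (1 - v r) * ((P r - path_mean m (I r)) / N r))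
      + ((\<Sum>r\<in>?R. v r * h r) - H - (\<Sum>r\<in>?R. (v r)\<^sup>2) + (\<Sum>r\<in>?R. (v r)\<^sup>2 * wiener_gap m (I r)) - wiener_gap m n + 1
         + (\<Sum>r\<in>?R. c r * (v r * (1 - v r))))"
  proof -
    have "(\<Sum>r\<in>?R. (v r)\<^sup>2 * ((W r - wiener_mean m (I r)) / (N r)\<^sup>2) + v r * (1 - v r) * ((P r - path_mean m (I r)) / N r))
      + (\<Sum>r\<in>?R. v r * h r) - (\<Sum>r\<in>?R. (v r)\<^sup>2) + (\<Sum>r\<in>?R. (v r)\<^sup>2 * wiener_gap m (I r)) + (\<Sum>r\<in>?R. c r * (v r * (1 - v r)))
      = (\<Sum>r\<in>?R. (W r + (P r + c r * N r) * (M - N r)) / M\<^sup>2)"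
      unfolding sum.distrib[symmetric] sum_subtractf[symmetric]
    proof (intro sum.cong refl)
      fix r assume r: "r \<in> ?R"
      have "(v r)\<^sup>2 * ((W r - wiener_mean m (I r)) / (N r)\<^sup>2) = W r / M\<^sup>2 - (v r)\<^sup>2 * (h r - 1 + wiener_gap m (I r))"
        using N[OF r] M unfolding v[OF r] wm[OF r] by (simp add: divide_simps)
      moreover have "v r * (1 - v r) * ((P r - path_mean m (I r)) / N r) = P r * (M - N r) / M\<^sup>2 - v r * (1 - v r) * h r"
        using N[OF r] M by (simp add: v[OF r] pm field_simps power2_eq_square)
      moreover have "c r * (v r * (1 - v r)) = c r * N r * (M - N r) / M\<^sup>2"
        using N[OF r] M by (simp add: v[OF r] field_simps power2_eq_square)
      moreover have "(v r)\<^sup>2 * (h r - 1 + wiener_gap m (I r)) = (v r)\<^sup>2 * h r - (v r)\<^sup>2 + (v r)\<^sup>2 * wiener_gap m (I r)"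
        "v r * (1 - v r) * h r = v r * h r - (v r)\<^sup>2 * h r"
        by (simp_all add: algebra_simps power2_eq_square)
      moreover have "(W r + (P r + c r * N r) * (M - N r)) / M\<^sup>2 = W r / M\<^sup>2 + P r * (M - N r) / M\<^sup>2 + c r * N r * (M - N r) / M\<^sup>2"
        by (simp only: distrib_right add_divide_distrib add.assoc)
      ultimately show "(v r)\<^sup>2 * ((W r - wiener_mean m (I r)) / (N r)\<^sup>2) + v r * (1 - v r) * ((P r - path_mean m (I r)) / N r)
         + v r * h r - (v r)\<^sup>2 + (v r)\<^sup>2 * wiener_gap m (I r) + c r * (v r * (1 - v r))
         = (W r + (P r + c r * N r) * (M - N r)) / M\<^sup>2"
        by linarith
    qed
    also have "\<dots> = wiener_index t / M\<^sup>2" unfolding stats(2) by (simp only: sum_divide_distrib)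
    finally show ?thesis using M by (simp add: wM diff_divide_distrib)
  qed
  have b1: "b_vec m v $ 1 = (real m)\<^sup>2 * ((\<Sum>r\<in>?R. v r * ln (v r)) - (\<Sum>r\<in>?R. (v r)\<^sup>2) + (\<Sum>r\<in>?R. c r * (v r * (1 - v r))) + 1)"
    unfolding c_sum by (simp add: b_vec_def right_diff_distrib sum_subtractf power2_eq_square)
  have b2: "b_vec m v $ 2 = real m * ((\<Sum>r\<in>?R. v r * ln (v r)) + 1 - v (m + 1))"
    by (simp add: b_vec_def)
  have "scaled_stats m n t $ 1 = (real m)\<^sup>2 * ((wiener_index t - wiener_mean m n) / M\<^sup>2)"
    by (simp add: scaled_stats_def M_def)
  also have "\<dots> = (\<Sum>r\<in>?R. (v r)\<^sup>2 * scaled_stats m (I r) (s r) $ 1 + real m * v r * (1 - v r) * scaled_stats m (I r) (s r) $ 2)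
      + b_vec m v $ 1 + toll_error m n I $ 1"
  proof -
    have "(\<Sum>r\<in>?R. (v r)\<^sup>2 * scaled_stats m (I r) (s r) $ 1 + real m * v r * (1 - v r) * scaled_stats m (I r) (s r) $ 2)
      = (real m)\<^sup>2 * (\<Sum>r\<in>?R. (v r)\<^sup>2 * ((W r - wiener_mean m (I r)) / (N r)\<^sup>2) + v r * (1 - v r) * ((P r - path_mean m (I r)) / N r))"
      unfolding sum_distrib_left
      by (intro sum.cong refl) (simp add: scaled_stats_def N_def W_def P_def power2_eq_square algebra_simps)
    moreover have "toll_error m n I $ 1 = (real m)\<^sup>2 * ((\<Sum>r\<in>?R. v r * mean_gap m (I r)) - mean_gap m n
         + (\<Sum>r\<in>?R. (v r)\<^sup>2 * wiener_gap m (I r)) - wiener_gap m n)"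
      by (simp only: toll_error_def vector_2 v_def)
    ultimately show ?thesis unfolding comp1 b1 vh
      by (simp only: distrib_left[symmetric]) (simp only: algebra_simps)
  qed
  finally have 1: "scaled_stats m n t $ 1 = (toll_map m v (\<lambda>r. scaled_stats m (I r) (s r)) + toll_error m n I) $ 1"
    by (simp only: toll_map_nth vector_add_component)
  have "scaled_stats m n t $ 2 = real m * ((path_length t - path_mean m n) / M)"
    by (simp add: scaled_stats_def M_def)
  also have "\<dots> = (\<Sum>r\<in>?R. v r * scaled_stats m (I r) (s r) $ 2) + b_vec m v $ 2 + toll_error m n I $ 2"
  proof -
    have "(\<Sum>r\<in>?R. v r * scaled_stats m (I r) (s r) $ 2) = real m * (\<Sum>r\<in>?R. v r * ((P r - path_mean m (I r)) / N r))"
      unfolding sum_distrib_left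
      by (intro sum.cong refl) (simp add: scaled_stats_def N_def P_def algebra_simps)
    moreover have "toll_error m n I $ 2 = real m * ((\<Sum>r\<in>?R. v r * mean_gap m (I r)) - mean_gap m n)"
      by (simp only: toll_error_def vector_2 v_def)
    ultimately show ?thesis unfolding comp2 b2 vh
      by (simp only: distrib_left[symmetric]) (simp only: algebra_simps)
  qed
  finally have 2: "scaled_stats m n t $ 2 = (toll_map m v (\<lambda>r. scaled_stats m (I r) (s r)) + toll_error m n I) $ 2"
    by (simp only: toll_map_nth vector_add_component)
  show ?thesis unfolding vec_eq_iff forall_2 using 1 2 by (simp only: v_def)
qed

lemma scaled_stats_law:
  "map_pmf (scaled_stats m (k + 2)) (recursive_tree m (k + 2)) =
    bind_pmf (urn m k) (\<lambda>I. map_pmf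
      (\<lambda>s. toll_map m (share m (k + 2) I) (\<lambda>r. scaled_stats m (I r) (s r)) + toll_error m (k + 2) I)
      (tree_family m I))"
proof -
  let ?F = "\<lambda>(I, s). toll_map m (share m (k + 2) I) (\<lambda>r. scaled_stats m (I r) (s r)) + toll_error m (k + 2) I"
  have "rel_pmf (\<lambda>x y. x = y) (map_pmf (scaled_stats m (k + 2)) (recursive_tree m (k + 2))) (map_pmf ?F (split_tree m k))"
    unfolding pmf.rel_map
    by (rule pmf.rel_mono_strong[OF rel_recursive_split]) (auto simp: scaled_stats_glue split: prod.splits)
  then have "map_pmf (scaled_stats m (k + 2)) (recursive_tree m (k + 2)) = map_pmf ?F (split_tree m k)"
    by (simp add: pmf.rel_eq)
  then show ?thesis by (simp add: split_tree_eq map_bind_pmf map_pmf_comp)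
qed

section \<open>Dirichlet moments and the Polya urn\<close>

text \<open>The beta integral on the interval (0, s), by the substitution y = s t. The general
  length s is needed when one coordinate of a simplex is integrated out.\<close>

lemma nn_integral_Beta:
  fixes a b s :: real
  assumes ab: "a > 0" "b > 0" and s: "s > 0"
  shows "(\<integral>\<^sup>+y. ennreal (if 0 < y \<and> y < s then y powr (a - 1) * (s - y) powr (b - 1) else 0) \<partial>lborel)
    = ennreal (s powr (a + b - 1) * Beta a b)"
proof -
  let ?f = "\<lambda>y. ennreal (if 0 < y \<and> y < s then y powr (a - 1) * (s - y) powr (b - 1) else 0)"
  let ?g = "\<lambda>t::real. t powr (a - 1) * (1 - t) powr (b - 1)"
  have "((\<lambda>t. ?g t) has_integral Beta a b) {0<..<1}"
    using has_integral_Beta_real[OF ab] by (simp add: has_integral_Icc_iff_Ioo)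
  then have g: "(\<integral>\<^sup>+t. ennreal (?g t) * indicator {0<..<1} t \<partial>lborel) = ennreal (Beta a b)"
    by (intro nn_integral_has_integral_lebesgue') auto
  have "(\<integral>\<^sup>+y. ?f y \<partial>lborel) = \<bar>s\<bar> * (\<integral>\<^sup>+t. ?f (0 + s * t) \<partial>lborel)"
    using s by (intro nn_integral_real_affine) auto
  also have "(\<integral>\<^sup>+t. ?f (0 + s * t) \<partial>lborel) = (\<integral>\<^sup>+t. ennreal (s powr (a + b - 2)) * (ennreal (?g t) * indicator {0<..<1} t) \<partial>lborel)"
  proof (intro nn_integral_cong)
    fix t :: real
    have "(s * t) powr (a - 1) * (s - s * t) powr (b - 1) = s powr (a + b - 2) * ?g t" if "0 < t" "t < 1"
    proof -
      have "s - s * t = s * (1 - t)" by (simp add: algebra_simps)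
      then have "(s * t) powr (a - 1) * (s - s * t) powr (b - 1) = (s powr (a - 1) * s powr (b - 1)) * ?g t"
        using s that by (simp add: powr_mult)
      also have "s powr (a - 1) * s powr (b - 1) = s powr (a + b - 2)"
        by (simp add: powr_add[symmetric])
      finally show ?thesis .
    qed
    then show "?f (0 + s * t) = ennreal (s powr (a + b - 2)) * (ennreal (?g t) * indicator {0<..<1} t)"
      using s by (auto simp: indicator_def ennreal_mult' zero_less_mult_iff)
  qed
  also have "\<dots> = ennreal (s powr (a + b - 2)) * ennreal (Beta a b)"
    by (subst nn_integral_cmult) (auto simp: g)
  also have "ennreal \<bar>s\<bar> * \<dots> = ennreal (s powr (a + b - 1) * Beta a b)"
  proof -
    have "s * s powr (a + b - 2) = s powr (1 + (a + b - 2))"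
      using s by (subst powr_add) simp
    then have "\<bar>s\<bar> * s powr (a + b - 2) = s powr (a + b - 1)" using s by simp
    then show ?thesis by (simp add: ennreal_mult'[symmetric] mult.assoc[symmetric] flip: ennreal_mult)
  qed
  finally show ?thesis .
qed

definition dirichlet_kernel :: "nat \<Rightarrow> (nat \<Rightarrow> real) \<Rightarrow> (nat \<Rightarrow> real) \<Rightarrow> real" where
  "dirichlet_kernel k \<alpha> x =
     (if (\<forall>i\<in>{1..k}. 0 < x i) \<and> (\<Sum>i=1..k. x i) < 1
      then (\<Prod>i=1..k. x i powr (\<alpha> i - 1)) * (1 - (\<Sum>i=1..k. x i)) powr (\<alpha> (k+1) - 1) else 0)"

lemma dirichlet_kernel_nonneg: "dirichlet_kernel k \<alpha> x \<ge> 0"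
  by (simp add: dirichlet_kernel_def prod_nonneg)

lemma dirichlet_kernel_measurable [measurable]:
  "dirichlet_kernel k \<alpha> \<in> borel_measurable (\<Pi>\<^sub>M i\<in>{1..k}. lborel)"
  unfolding dirichlet_kernel_def by measurable

text \<open>Induction on the dimension: the last free coordinate runs over an interval whose length
  is the remaining mass, so it contributes a beta factor and a power of that mass.\<close>

theorem dirichlet_integral:
  assumes "\<And>i. i \<in> {1..k+1} \<Longrightarrow> \<alpha> i > 0"
  shows "(\<integral>\<^sup>+x. ennreal (dirichlet_kernel k \<alpha> x) \<partial>(\<Pi>\<^sub>M i\<in>{1..k}. lborel))
    = ennreal ((\<Prod>i=1..k+1. Gamma (\<alpha> i)) / Gamma (\<Sum>i=1..k+1. \<alpha> i))"
  using assms
proof (induction k arbitrary: \<alpha>)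
  case 0
  have "Gamma (\<alpha> (Suc 0)) > 0" using 0 by (simp add: Gamma_real_pos)
  then show ?case by (simp add: PiM_empty nn_integral_count_space_finite dirichlet_kernel_def)
next
  case (Suc k)
  interpret product_sigma_finite "\<lambda>_::nat. lborel :: real measure" by standard
  define a b where "a = \<alpha> (Suc k)" and "b = \<alpha> (Suc (Suc k))"
  have ab: "a > 0" "b > 0" using Suc.prems by (auto simp: a_def b_def)
  \<comment> \<open>Integrating out one coordinate merges the last two parameters into their sum,
    the aggregation property of the Dirichlet law.\<close>
  define \<beta> where "\<beta> = \<alpha>(Suc k := a + b)"
  have \<beta>: "\<beta> i > 0" if "i \<in> {1..k+1}" for i using that Suc.prems[of i] ab by (auto simp: \<beta>_def)
  have meas_k: "(\<lambda>x. ennreal (dirichlet_kernel k \<beta> x)) \<in> borel_measurable (\<Pi>\<^sub>M i\<in>{1..k}. lborel)"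
    by measurable
  have ins: "{1..Suc k} = insert (Suc k) {1..k}" by auto
  have "(\<integral>\<^sup>+x. ennreal (dirichlet_kernel (Suc k) \<alpha> x) \<partial>(\<Pi>\<^sub>M i\<in>{1..Suc k}. lborel))
    = (\<integral>\<^sup>+x. (\<integral>\<^sup>+y. ennreal (dirichlet_kernel (Suc k) \<alpha> (x(Suc k := y))) \<partial>lborel) \<partial>(\<Pi>\<^sub>M i\<in>{1..k}. lborel))"
    unfolding ins
  proof (rule product_nn_integral_insert)
    have "dirichlet_kernel (Suc k) \<alpha> \<in> borel_measurable (\<Pi>\<^sub>M i\<in>insert (Suc k) {1..k}. lborel)"
      using dirichlet_kernel_measurable[of "Suc k" \<alpha>] by (simp only: ins)
    then show "(\<lambda>x. ennreal (dirichlet_kernel (Suc k) \<alpha> x)) \<in> borel_measurable (\<Pi>\<^sub>M i\<in>insert (Suc k) {1..k}. lborel)"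
      by (rule measurable_compose) simp
  qed auto
  also have "\<dots> = (\<integral>\<^sup>+x. ennreal (Beta a b) * ennreal (dirichlet_kernel k \<beta> x) \<partial>(\<Pi>\<^sub>M i\<in>{1..k}. lborel))"
  proof (intro nn_integral_cong)
    fix x :: "nat \<Rightarrow> real"
    define S where "S = (\<Sum>i=1..k. x i)"
    define Q where "Q = (\<Prod>i=1..k. x i powr (\<alpha> i - 1))"
    have Q: "Q \<ge> 0" by (simp add: Q_def prod_nonneg)
    have sum: "(\<Sum>i=1..Suc k. (x(Suc k := y)) i) = S + y" for y by (simp add: S_def)
    have prod: "(\<Prod>i=1..Suc k. (x(Suc k := y)) i powr (\<alpha> i - 1)) = Q * y powr (a - 1)" for y
      by (simp add: Q_def a_def)
    have pos: "(\<forall>i\<in>{1..Suc k}. 0 < (x(Suc k := y)) i) \<longleftrightarrow> (\<forall>i\<in>{1..k}. 0 < x i) \<and> 0 < y" for y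
      unfolding ins by auto
    have Qb: "(\<Prod>i=1..k. x i powr (\<beta> i - 1)) = Q"
      unfolding Q_def by (intro prod.cong) (auto simp: \<beta>_def)
    show "(\<integral>\<^sup>+y. ennreal (dirichlet_kernel (Suc k) \<alpha> (x(Suc k := y))) \<partial>lborel)
      = ennreal (Beta a b) * ennreal (dirichlet_kernel k \<beta> x)"
    proof (cases "(\<forall>i\<in>{1..k}. 0 < x i) \<and> S < 1")
      case True
      have "(\<integral>\<^sup>+y. ennreal (dirichlet_kernel (Suc k) \<alpha> (x(Suc k := y))) \<partial>lborel) =
        (\<integral>\<^sup>+y. ennreal Q * ennreal (if 0 < y \<and> y < 1 - S then y powr (a - 1) * (1 - S - y) powr (b - 1) else 0) \<partial>lborel)"
      proof (intro nn_integral_cong)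
        fix y :: real
        have "dirichlet_kernel (Suc k) \<alpha> (x(Suc k := y)) =
          Q * (if 0 < y \<and> y < 1 - S then y powr (a - 1) * (1 - S - y) powr (b - 1) else 0)"
          unfolding dirichlet_kernel_def pos sum prod using True
          by (auto simp: b_def algebra_simps)
        then show "ennreal (dirichlet_kernel (Suc k) \<alpha> (x(Suc k := y))) =
          ennreal Q * ennreal (if 0 < y \<and> y < 1 - S then y powr (a - 1) * (1 - S - y) powr (b - 1) else 0)"
          using Q by (simp add: ennreal_mult')
      qed
      also have "\<dots> = ennreal Q * ennreal ((1 - S) powr (a + b - 1) * Beta a b)"
        using True by (subst nn_integral_cmult) (auto simp: nn_integral_Beta[OF ab])
      also have "\<dots> = ennreal (Beta a b * (Q * (1 - S) powr (a + b - 1)))"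
        using Q by (simp add: ennreal_mult'[symmetric] mult_ac)
      also have "Q * (1 - S) powr (a + b - 1) = dirichlet_kernel k \<beta> x"
        using True unfolding dirichlet_kernel_def Qb S_def[symmetric] by (simp add: \<beta>_def)
      finally show ?thesis by (simp only: ennreal_mult''[OF dirichlet_kernel_nonneg])
    next
      case False
      then have "dirichlet_kernel (Suc k) \<alpha> (x(Suc k := y)) = 0" for y
        unfolding dirichlet_kernel_def pos sum by auto
      moreover have "dirichlet_kernel k \<beta> x = 0"
        using False unfolding dirichlet_kernel_def S_def by auto
      ultimately show ?thesis by simp
    qed
  qed
  also have "\<dots> = ennreal (Beta a b) * ennreal ((\<Prod>i=1..k+1. Gamma (\<beta> i)) / Gamma (\<Sum>i=1..k+1. \<beta> i))"
    by (simp only: nn_integral_cmult[OF meas_k] Suc.IH[OF \<beta>])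
  also have "\<dots> = ennreal (Beta a b * ((\<Prod>i=1..k+1. Gamma (\<beta> i)) / Gamma (\<Sum>i=1..k+1. \<beta> i)))"
  proof -
    have "Beta a b \<ge> 0"
      using ab by (auto simp: Beta_def intro!: divide_nonneg_nonneg mult_nonneg_nonneg Gamma_real_nonneg)
    then show ?thesis by (simp only: ennreal_mult')
  qed
  also have "Beta a b * ((\<Prod>i=1..k+1. Gamma (\<beta> i)) / Gamma (\<Sum>i=1..k+1. \<beta> i)) =
     (\<Prod>i=1..Suc k+1. Gamma (\<alpha> i)) / Gamma (\<Sum>i=1..Suc k+1. \<alpha> i)"
  proof -
    have "(\<Prod>i=1..k. Gamma (\<beta> i)) = (\<Prod>i=1..k. Gamma (\<alpha> i))" "(\<Sum>i=1..k. \<beta> i) = (\<Sum>i=1..k. \<alpha> i)"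
      by (auto intro!: prod.cong sum.cong simp: \<beta>_def)
    moreover have "Gamma (a + b) > 0" using ab by (simp add: Gamma_real_pos)
    ultimately show ?thesis by (simp add: Beta_def \<beta>_def a_def b_def add.assoc)
  qed
  finally show ?case .
qed

lemma dirichlet_density_measurable [measurable]:
  "dirichlet_density k \<alpha> \<in> borel_measurable (\<Pi>\<^sub>M i\<in>{1..k}. lborel)"
  unfolding dirichlet_density_def by measurable

lemma dirichlet_map_measurable:
  "(\<lambda>x. \<lambda>i\<in>{1..k+1}. if i \<le> k then x i else 1 - (\<Sum>j=1..k. x j) :: real)
     \<in> (\<Pi>\<^sub>M i\<in>{1..k}. lborel) \<rightarrow>\<^sub>M (\<Pi>\<^sub>M i\<in>{1..k+1}. borel)"
proof (rule measurable_restrict)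
  fix i assume i: "i \<in> {1..k+1}"
  show "(\<lambda>x. if i \<le> k then x i else 1 - (\<Sum>j=1..k. x j) :: real) \<in> borel_measurable (\<Pi>\<^sub>M i\<in>{1..k}. lborel)"
  proof (cases "i \<le> k")
    case True
    then have "(\<lambda>x. x i) \<in> (\<Pi>\<^sub>M i\<in>{1..k}. lborel) \<rightarrow>\<^sub>M (lborel :: real measure)"
      using i by (intro measurable_component_singleton) auto
    then show ?thesis using True by simp
  next
    case False
    then show ?thesis by simp measurable
  qed
qed

text \<open>Multiplying the Dirichlet kernel by a monomial shifts its parameters.\<close>

lemma dirichlet_moment:
  assumes \<alpha>: "\<And>i. i \<in> {1..k+1} \<Longrightarrow> \<alpha> i > 0"
  shows "(\<integral>\<^sup>+V. ennreal (\<Prod>i=1..k+1. V i ^ e i) \<partial>dirichlet k \<alpha>)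
    = ennreal ((\<Prod>i=1..k+1. pochhammer (\<alpha> i) (e i)) / pochhammer (\<Sum>i=1..k+1. \<alpha> i) (\<Sum>i=1..k+1. e i))"
proof -
  let ?A = "\<Sum>i=1..k+1. \<alpha> i" and ?E = "\<Sum>i=1..k+1. e i"
  let ?M = "\<Pi>\<^sub>M i\<in>{1..k}. lborel :: real measure"
  let ?\<phi> = "\<lambda>x. \<lambda>i\<in>{1..k+1}. if i \<le> k then x i else 1 - (\<Sum>j=1..k. x j) :: real"
  define C where "C = Gamma ?A / (\<Prod>i=1..k+1. Gamma (\<alpha> i))"
  define \<beta> where "\<beta> i = \<alpha> i + real (e i)" for i
  have A: "?A > 0" using \<alpha> by (intro sum_pos) auto
  have C: "C \<ge> 0"
    unfolding C_def using \<alpha> A by (intro divide_nonneg_nonneg prod_nonneg) (auto intro!: Gamma_real_nonneg simp: less_imp_le)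
  have dens: "dirichlet_density k \<alpha> x = C * dirichlet_kernel k \<alpha> x" for x
    by (simp add: dirichlet_density_def dirichlet_kernel_def C_def)
  have meas: "?\<phi> \<in> ?M \<rightarrow>\<^sub>M (\<Pi>\<^sub>M i\<in>{1..k+1}. borel)"
    by (rule dirichlet_map_measurable)
  have meas_prod: "(\<lambda>V. \<Prod>i=1..k+1. V i ^ e i) \<in> borel_measurable (\<Pi>\<^sub>M i\<in>{1..k+1}. borel :: real measure)"
    by measurable
  have "(\<integral>\<^sup>+V. ennreal (\<Prod>i=1..k+1. V i ^ e i) \<partial>dirichlet k \<alpha>)
    = (\<integral>\<^sup>+x. ennreal (\<Prod>i=1..k+1. ?\<phi> x i ^ e i) \<partial>density ?M (\<lambda>x. ennreal (dirichlet_density k \<alpha> x)))"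
    unfolding dirichlet_def using meas meas_prod by (subst nn_integral_distr) auto
  also have "\<dots> = (\<integral>\<^sup>+x. ennreal (dirichlet_density k \<alpha> x) * ennreal (\<Prod>i=1..k+1. ?\<phi> x i ^ e i) \<partial>?M)"
    using measurable_compose[OF meas meas_prod]
    by (intro nn_integral_density) (auto intro: measurable_compose[OF dirichlet_density_measurable] simp del: One_nat_def)
  also have "\<dots> = (\<integral>\<^sup>+x. ennreal C * ennreal (dirichlet_kernel k \<beta> x) \<partial>?M)"
  proof (intro nn_integral_cong)
    fix x :: "nat \<Rightarrow> real"
    let ?S = "\<Sum>i=1..k. x i"
    have prod: "(\<Prod>i=1..k+1. ?\<phi> x i ^ e i) = (\<Prod>i=1..k. x i ^ e i) * (1 - ?S) ^ e (k + 1)"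
      by simp
    have "dirichlet_kernel k \<alpha> x * (\<Prod>i=1..k+1. ?\<phi> x i ^ e i) = dirichlet_kernel k \<beta> x"
    proof (cases "(\<forall>i\<in>{1..k}. 0 < x i) \<and> ?S < 1")
      case True
      have pw: "y powr (\<alpha> i - 1) * y ^ e i = y powr (\<beta> i - 1)" if "y > 0" for y i
        using that by (simp add: \<beta>_def powr_realpow[symmetric] powr_add[symmetric] algebra_simps)
      have "(\<Prod>i=1..k. x i powr (\<alpha> i - 1)) * (\<Prod>i=1..k. x i ^ e i) = (\<Prod>i=1..k. x i powr (\<beta> i - 1))"
        unfolding prod.distrib[symmetric] using True by (intro prod.cong refl pw) auto
      moreover have "(1 - ?S) powr (\<alpha> (k + 1) - 1) * (1 - ?S) ^ e (k + 1) = (1 - ?S) powr (\<beta> (k + 1) - 1)"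
        using True by (intro pw) auto
      ultimately show ?thesis unfolding prod dirichlet_kernel_def using True by (simp add: mult_ac)
    next
      case False
      then show ?thesis by (simp only: dirichlet_kernel_def if_False mult_zero_left)
    qed
    then show "ennreal (dirichlet_density k \<alpha> x) * ennreal (\<Prod>i=1..k+1. ?\<phi> x i ^ e i) = ennreal C * ennreal (dirichlet_kernel k \<beta> x)"
      using C dirichlet_kernel_nonneg[of k \<alpha> x] by (simp add: dens ennreal_mult'[symmetric] mult.assoc)
  qed
  also have "\<dots> = ennreal C * ennreal ((\<Prod>i=1..k+1. Gamma (\<beta> i)) / Gamma (\<Sum>i=1..k+1. \<beta> i))"
  proof -
    have "(\<lambda>x. ennreal (dirichlet_kernel k \<beta> x)) \<in> borel_measurable ?M" by measurable
    moreover have "\<beta> i > 0" if "i \<in> {1..k+1}" for i using \<alpha>[OF that] by (simp add: \<beta>_def)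
    ultimately show ?thesis by (simp only: nn_integral_cmult dirichlet_integral)
  qed
  also have "\<dots> = ennreal (C * ((\<Prod>i=1..k+1. Gamma (\<beta> i)) / Gamma (\<Sum>i=1..k+1. \<beta> i)))"
    by (simp only: ennreal_mult'[OF C])
  also have "C * ((\<Prod>i=1..k+1. Gamma (\<beta> i)) / Gamma (\<Sum>i=1..k+1. \<beta> i))
      = (\<Prod>i=1..k+1. pochhammer (\<alpha> i) (e i)) / pochhammer ?A ?E"
  proof -
    have poch: "pochhammer x n = Gamma (x + real n) / Gamma x" if "x > 0" for x :: real and n
      using that by (intro pochhammer_Gamma) (auto elim!: nonpos_Ints_cases)
    have "(\<Prod>i=1..k+1. pochhammer (\<alpha> i) (e i)) = (\<Prod>i=1..k+1. Gamma (\<beta> i) / Gamma (\<alpha> i))"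
      using \<alpha> by (intro prod.cong refl) (simp add: poch \<beta>_def)
    also have "\<dots> = (\<Prod>i=1..k+1. Gamma (\<beta> i)) / (\<Prod>i=1..k+1. Gamma (\<alpha> i))"
      by (rule prod_dividef)
    finally have 1: "(\<Prod>i=1..k+1. pochhammer (\<alpha> i) (e i)) = \<dots>" .
    have 2: "pochhammer ?A ?E = Gamma (\<Sum>i=1..k+1. \<beta> i) / Gamma ?A"
      unfolding poch[OF A] \<beta>_def sum.distrib by simp
    have "Gamma ?A > 0" using A by (rule Gamma_real_pos)
    then show ?thesis unfolding 1 2 C_def by (simp add: field_simps)
  qed
  finally show ?thesis .
qed

lemma sets_dirichlet [measurable_cong]: "sets (dirichlet k \<alpha>) = sets (\<Pi>\<^sub>M i\<in>{1..k+1}. borel)"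
  by (simp add: dirichlet_def)

lemma prob_space_dirichlet:
  assumes "\<And>i. i \<in> {1..k+1} \<Longrightarrow> \<alpha> i > 0"
  shows "prob_space (dirichlet k \<alpha>)"
  using dirichlet_moment[of k \<alpha> "\<lambda>_. 0", OF assms] by (intro prob_spaceI) simp

lemma AE_dirichlet:
  "AE V in dirichlet k \<alpha>. (\<forall>i\<in>{1..k+1}. 0 < V i) \<and> (\<Sum>i=1..k+1. V i) = 1 \<and> (\<forall>i. i \<notin> {1..k+1} \<longrightarrow> V i = undefined)"
proof -
  let ?M = "\<Pi>\<^sub>M i\<in>{1..k}. lborel :: real measure"
  let ?\<phi> = "\<lambda>x. \<lambda>i\<in>{1..k+1}. if i \<le> k then x i else 1 - (\<Sum>j=1..k. x j) :: real"
  have meas: "?\<phi> \<in> ?M \<rightarrow>\<^sub>M (\<Pi>\<^sub>M i\<in>{1..k+1}. borel)"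
    by (rule dirichlet_map_measurable)

  have ext: "AE V in dirichlet k \<alpha>. V \<in> extensional {1..k+1}"
    unfolding dirichlet_def by (rule AE_I2) (auto simp: space_PiM PiE_def)
  have "AE V in dirichlet k \<alpha>. (\<forall>i\<in>{1..k+1}. 0 < V i) \<and> (\<Sum>i=1..k+1. V i) = 1"
    unfolding dirichlet_def
  proof (subst AE_distr_iff)
    show "?\<phi> \<in> density ?M (\<lambda>x. ennreal (dirichlet_density k \<alpha> x)) \<rightarrow>\<^sub>M (\<Pi>\<^sub>M i\<in>{1..k+1}. borel)"
      using meas by simp
    show "{V \<in> space (\<Pi>\<^sub>M i\<in>{1..k+1}. borel). (\<forall>i\<in>{1..k+1}. 0 < V i) \<and> (\<Sum>i=1..k+1. V i) = 1} \<in> sets (\<Pi>\<^sub>M i\<in>{1..k+1}. borel :: real measure)"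
      by measurable
    show "AE x in density ?M (\<lambda>x. ennreal (dirichlet_density k \<alpha> x)). (\<forall>i\<in>{1..k+1}. 0 < ?\<phi> x i) \<and> (\<Sum>i=1..k+1. ?\<phi> x i) = 1"
    proof (subst AE_density)
      have "(\<Sum>i=1..k+1. ?\<phi> x i) = 1" for x :: "nat \<Rightarrow> real" by simp
      then show "AE x in ?M. 0 < ennreal (dirichlet_density k \<alpha> x) \<longrightarrow> (\<forall>i\<in>{1..k+1}. 0 < ?\<phi> x i) \<and> (\<Sum>i=1..k+1. ?\<phi> x i) = 1"
        by (intro AE_I2 impI conjI) (simp_all add: dirichlet_density_def split: if_splits)
    qed measurable
  qed
  with ext show ?thesis
    by eventually_elim (auto simp: extensional_def)
qed

section \<open>The simplex of shares\<close>

text \<open>Fixing the value \<open>undefined\<close> outside the index range makes the simplex a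
  compact set in the product topology on all functions and places it among the points of the finite
  product space.\<close>

definition simplex_functions :: "nat \<Rightarrow> (nat \<Rightarrow> real) set" where
  "simplex_functions m = {v. (\<forall>r\<in>{1..m+1}. 0 \<le> v r) \<and> (\<Sum>r=1..m+1. v r) = 1 \<and> (\<forall>r. r \<notin> {1..m+1} \<longrightarrow> v r = undefined)}"

lemma simplex_functions_le_1: "v \<in> simplex_functions m \<Longrightarrow> r \<in> {1..m+1} \<Longrightarrow> v r \<le> 1"
  unfolding simplex_functions_def using member_le_sum[of r "{1..m+1}" v] by auto

lemma compact_simplex_functions: "compact (simplex_functions m)"
proof -
  let ?K = "PiE UNIV (\<lambda>r. if r \<in> {1..m+1} then {0..1} else {undefined :: real})"
  have "compactin (product_topology (\<lambda>_::nat. euclidean :: real topology) UNIV) ?K"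
    by (subst compactin_PiE) auto
  then have "compact ?K" by (simp only: euclidean_product_topology compactin_euclidean_iff)
  moreover have "closed {v :: nat \<Rightarrow> real. (\<Sum>r=1..m+1. v r) = 1}"
    by (intro closed_Collect_eq continuous_intros continuous_on_sum) (auto intro: continuous_on_product_coordinates)
  ultimately have "compact (?K \<inter> {v. (\<Sum>r=1..m+1. v r) = 1})" by (rule compact_Int_closed)
  also have "?K \<inter> {v. (\<Sum>r=1..m+1. v r) = 1} = simplex_functions m"
  proof
    show "simplex_functions m \<subseteq> ?K \<inter> {v. (\<Sum>r=1..m+1. v r) = 1}"
      using simplex_functions_le_1 by (auto simp: simplex_functions_def PiE_def Pi_def)
    show "?K \<inter> {v. (\<Sum>r=1..m+1. v r) = 1} \<subseteq> simplex_functions m"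
      by (auto simp: simplex_functions_def PiE_def Pi_def split: if_splits)
  qed
  finally show ?thesis .
qed

lemma share_simplex:
  assumes "I \<in> set_pmf (urn m k)"
  shows "share m (k + 2) I \<in> simplex_functions m"
proof -
  have M: "tree_size m (k + 2) > 0" by (intro tree_size_pos) simp
  have "(\<Sum>r=1..m+1. share m (k + 2) I r) = (\<Sum>r=1..m+1. tree_size m (I r)) / tree_size m (k + 2)"
    by (simp only: sum_divide_distrib) (intro sum.cong refl, simp add: share_def)
  then have "(\<Sum>r=1..m+1. share m (k + 2) I r) = 1"
    using urn_sum[OF assms] M by simp
  moreover have "0 \<le> share m (k + 2) I r" if "r \<in> {1..m+1}" for r
    using that M tree_size_pos[OF urn_ge_1[OF assms], of m r] by (simp add: share_def)
  ultimately show ?thesis by (auto simp: simplex_functions_def share_def simp del: sum.cl_ivl_Suc)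
qed

section \<open>Limits of urn moments\<close>

abbreviation urn_expectation :: "nat \<Rightarrow> nat \<Rightarrow> ((nat \<Rightarrow> nat) \<Rightarrow> real) \<Rightarrow> real" where
  "urn_expectation m k \<equiv> measure_pmf.expectation (urn m k)"

lemma integrable_urn: "integrable (measure_pmf (urn m k)) (f :: _ \<Rightarrow> real)"
  by (intro integrable_measure_pmf_finite finite_set_urn)

lemma urn_pick_expectation:
  assumes "I \<in> set_pmf (urn m k)"
  shows "measure_pmf.expectation (urn_pick m I) f = (\<Sum>r=1..m+1. tree_size m (I r) * f r) / tree_size m (k + 2)"
proof -
  let ?S = "SIGMA r:{1..m+1}. nodes_upto m (I r)"
  have fin: "finite ?S" by auto
  have "(1, root_node) \<in> ?S" by (simp add: nodes_upto_def)
  then have ne: "?S \<noteq> {}" by (metis empty_iff)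
  have card: "real (card (nodes_upto m (I r))) = tree_size m (I r)" for r
    using urn_ge_1[OF assms] by (intro card_nodes_upto)
  have sum: "(\<Sum>p\<in>?S. g (fst p)) = (\<Sum>r=1..m+1. tree_size m (I r) * g r)" for g :: "nat \<Rightarrow> real"
  proof -
    have "(\<Sum>p\<in>?S. g (fst p)) = (\<Sum>r=1..m+1. \<Sum>x\<in>nodes_upto m (I r). g r)"
      by (subst sum.Sigma) (auto simp: case_prod_unfold)
    also have "\<dots> = (\<Sum>r=1..m+1. tree_size m (I r) * g r)"
      by (intro sum.cong refl) (simp add: card)
    finally show ?thesis .
  qed
  have "real (card ?S) = (\<Sum>p\<in>?S. 1)" by (simp only: sum_constant mult_1_right)
  also have "\<dots> = tree_size m (k + 2)" using sum[of "\<lambda>_. 1"] urn_sum[OF assms] by simp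
  finally have "real (card ?S) = tree_size m (k + 2)" .
  then show ?thesis
    unfolding urn_pick_def integral_map_pmf integral_pmf_of_set[OF ne fin] sum[of f] by simp
qed

text \<open>The rising factorials of the Polya urn, normalised by that of the total, form a martingale,
  whose value is exactly the Dirichlet moment.\<close>

lemma urn_rising_moment:
  fixes e :: "nat \<Rightarrow> nat"
  assumes m: "m \<ge> 1"
  defines "a \<equiv> \<lambda>I r. tree_size m (I r) / real m" and "E \<equiv> \<Sum>r=1..m+1. e r"
  shows "urn_expectation m k (\<lambda>I. \<Prod>r=1..m+1. pochhammer (a I r) (e r)) / pochhammer (tree_size m (k + 2) / real m) E
    = (\<Prod>r=1..m+1. pochhammer (1 / real m) (e r)) / pochhammer (real (m + 1) / real m) E"
proof (induction k)
  case 0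
  have "tree_size m (0 + 2) = real (m + 1)" by (simp add: tree_size_def)
  then show ?case unfolding urn.simps by (simp add: a_def tree_size_def add.commute)
next
  case (Suc k)
  define A where "A = tree_size m (k + 2) / real m"
  let ?f = "\<lambda>I. \<Prod>r=1..m+1. pochhammer (a I r) (e r)"
  have M: "tree_size m (k + 2) > 0" by (intro tree_size_pos) simp
  have mpos: "real m > 0" using m by simp
  have A: "A > 0" using M mpos by (simp add: A_def)
  have A': "tree_size m (Suc k + 2) / real m = A + 1"
    using mpos by (simp add: A_def tree_size_Suc add_divide_distrib)
  have inner: "measure_pmf.expectation (urn_pick m I) (\<lambda>r. ?f (I(r := Suc (I r)))) = ?f I * ((A + real E) / A)"
    if I: "I \<in> set_pmf (urn m k)" for I
  proof -
    have pos: "a I r > 0" for r using tree_size_pos[OF urn_ge_1[OF I]] mpos by (simp add: a_def)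
    \<comment> \<open>With (a)_e the rising factorial, a (a + 1)_e = (a)_e (a + e): the weight of
      drawing r becomes an additive factor, and summing over r leaves A + E. The same identity for
      the total A cancels it.\<close>
    have step: "a I r * ?f (I(r := Suc (I r))) = ?f I * (a I r + real (e r))" if r: "r \<in> {1..m+1}" for r
    proof -
      let ?J = "I(r := Suc (I r))"
      have "a ?J r = a I r + 1" using mpos by (simp add: a_def tree_size_Suc add_divide_distrib)
      moreover have "a I r * pochhammer (a I r + 1) (e r) = pochhammer (a I r) (e r) * (a I r + real (e r))"
        using pochhammer_rec[of "a I r" "e r"] pochhammer_rec'[of "a I r" "e r"] by (simp add: mult.commute)
      moreover have "(\<Prod>r'\<in>{1..m+1}-{r}. pochhammer (a ?J r') (e r')) = (\<Prod>r'\<in>{1..m+1}-{r}. pochhammer (a I r') (e r'))"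
        by (intro prod.cong refl) (simp add: a_def)
      moreover have "?f ?J = pochhammer (a ?J r) (e r) * (\<Prod>r'\<in>{1..m+1}-{r}. pochhammer (a ?J r') (e r'))"
        "?f I = pochhammer (a I r) (e r) * (\<Prod>r'\<in>{1..m+1}-{r}. pochhammer (a I r') (e r'))"
        using r by (intro prod.remove, simp, simp)+
      ultimately show ?thesis by (simp only: mult.assoc[symmetric]) (simp only: mult_ac)
    qed
    have "measure_pmf.expectation (urn_pick m I) (\<lambda>r. ?f (I(r := Suc (I r))))
      = (\<Sum>r=1..m+1. tree_size m (I r) * ?f (I(r := Suc (I r)))) / tree_size m (k + 2)"
      by (rule urn_pick_expectation[OF I])
    also have "\<dots> = (\<Sum>r=1..m+1. a I r * ?f (I(r := Suc (I r)))) / A"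
    proof -
      have "(\<Sum>r=1..m+1. a I r * ?f (I(r := Suc (I r)))) = (\<Sum>r=1..m+1. tree_size m (I r) * ?f (I(r := Suc (I r)))) / real m"
        by (simp only: sum_divide_distrib a_def times_divide_eq_left)
      then show ?thesis using mpos by (simp only: A_def) simp
    qed
    also have "(\<Sum>r=1..m+1. a I r * ?f (I(r := Suc (I r)))) = (\<Sum>r=1..m+1. ?f I * (a I r + real (e r)))"
      by (intro sum.cong refl step)
    also have "\<dots> = ?f I * ((\<Sum>r=1..m+1. a I r) + real E)"
      unfolding E_def of_nat_sum by (simp only: sum_distrib_left[symmetric] sum.distrib)
    also have "(\<Sum>r=1..m+1. a I r) = A"
      using urn_sum[OF I] by (simp only: a_def A_def sum_divide_distrib[symmetric])
    finally show ?thesis by (simp only: times_divide_eq_right)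
  qed
  have "urn_expectation m (Suc k) ?f = urn_expectation m k (\<lambda>I. measure_pmf.expectation (urn_pick m I) (\<lambda>r. ?f (I(r := Suc (I r)))))"
  proof -
    have "urn_expectation m (Suc k) ?f = (\<Sum>I\<in>set_pmf (urn m k). pmf (urn m k) I *\<^sub>R
        measure_pmf.expectation (map_pmf (\<lambda>r. I(r := Suc (I r))) (urn_pick m I)) ?f)"
      unfolding urn.simps by (rule pmf_expectation_bind) (auto simp: finite_set_urn set_urn_pick)
    also have "\<dots> = urn_expectation m k (\<lambda>I. measure_pmf.expectation (urn_pick m I) (\<lambda>r. ?f (I(r := Suc (I r)))))"
      unfolding integral_map_pmf
      by (rule integral_measure_pmf[symmetric]) (auto simp: finite_set_urn set_pmf_iff)
    finally show ?thesis .
  qed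
  also have "\<dots> = urn_expectation m k (\<lambda>I. ?f I * ((A + real E) / A))"
    by (intro integral_cong_AE AE_pmfI inner) simp_all
  also have "\<dots> = urn_expectation m k ?f * ((A + real E) / A)"
    by (rule integral_mult_left_zero)
  also have "\<dots> / pochhammer (A + 1) E = urn_expectation m k ?f / pochhammer A E"
  proof -
    have "A * pochhammer (A + 1) E = pochhammer A E * (A + real E)"
      using pochhammer_rec[of A E] pochhammer_rec'[of A E] by (simp add: mult.commute)
    moreover have "pochhammer (A + 1) E > 0" "pochhammer A E > 0" "A + real E > 0"
      using A by (auto intro: pochhammer_pos)
    ultimately have "(A + real E) / (A * pochhammer (A + 1) E) = 1 / pochhammer A E"
      by simp
    then have "(A + real E) / A / pochhammer (A + 1) E = 1 / pochhammer A E" by simp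
    moreover have "x * y / z = x * (y / z)" for x y z :: real by simp
    ultimately show ?thesis by (simp only: mult_1_right times_divide_eq_right[of _ 1])
  qed
  finally show ?case using Suc.IH by (simp only: A' A_def)
qed

lemma pochhammer_ratio_limit:
  fixes A :: "nat \<Rightarrow> real"
  assumes "filterlim A at_top sequentially"
  shows "(\<lambda>k. pochhammer (A k) n / (A k + real n) ^ n) \<longlonglongrightarrow> 1"
proof -
  have "(\<lambda>k. (A k + real i) / (A k + real n)) \<longlonglongrightarrow> 1" for i
  proof -
    have "((\<lambda>x::real. (x + real i) / (x + real n)) \<longlongrightarrow> 1) at_top" by real_asymp
    from filterlim_compose[OF this assms] show ?thesis .
  qed
  then have "(\<lambda>k. \<Prod>i\<in>{0..<n}. (A k + real i) / (A k + real n)) \<longlonglongrightarrow> (\<Prod>i\<in>{0..<n}. 1)"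
    by (intro tendsto_prod)
  then show ?thesis by (simp add: pochhammer_prod prod_dividef)
qed

lemma tree_size_at_top:
  assumes "m \<ge> 1"
  shows "filterlim (\<lambda>k. tree_size m (k + 2) / real m) at_top sequentially"
proof -
  have "real m > 0" using assms by simp
  then have "filterlim (\<lambda>k. (real m * (real (k + 2) - 1) + 1) / real m) at_top sequentially" by real_asymp
  then show ?thesis by (simp add: tree_size_def)
qed

text \<open>Rising factorials of the sizes have an exactly known mean. Uniformly in the urn state
  they differ from powers of the shares by a relative error of order 1/A, so monomials in the shares
  have the same limits.\<close>

lemma urn_monomial_limit:
  fixes e :: "nat \<Rightarrow> nat"
  assumes m: "m \<ge> 1"
  shows "(\<lambda>k. urn_expectation m k (\<lambda>I. \<Prod>r=1..m+1. share m (k + 2) I r ^ e r))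
    \<longlonglongrightarrow> (\<Prod>r=1..m+1. pochhammer (1 / real m) (e r)) / pochhammer (real (m + 1) / real m) (\<Sum>r=1..m+1. e r)"
    (is "?L \<longlonglongrightarrow> ?D")
proof -
  define E where "E = (\<Sum>r=1..m+1. e r)"
  define A where "A k = tree_size m (k + 2) / real m" for k
  \<comment> \<open>One index for each linear factor; both products have E factors and can be
    compared one by one.\<close>
  let ?P = "SIGMA r:{1..m+1}. {0..<e r}"
  let ?Z = "\<lambda>k I. \<Prod>r=1..m+1. pochhammer (tree_size m (I r) / real m) (e r)"
  have mpos: "real m > 0" using m by simp
  have A: "A k > 0" for k using tree_size_pos[of "k + 2" m] mpos by (simp add: A_def)
  have fin: "finite ?P" by auto
  have cardP: "card ?P = E" by (simp add: E_def)
  \<comment> \<open>The denominator A + E instead of A keeps every factor at most one, as the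
    comparison of products requires; the ratio (A)_E / (A + E)^E tends to one.\<close>
  have close: "\<bar>?Z k I / (A k + real E) ^ E - (\<Prod>r=1..m+1. share m (k + 2) I r ^ e r)\<bar> \<le> real E * (real E / A k)"
    if I: "I \<in> set_pmf (urn m k)" for k I
  proof -
    define a where "a r = tree_size m (I r) / real m" for r
    have v: "share m (k + 2) I r = a r / A k" if "r \<in> {1..m+1}" for r
      using that mpos by (simp add: share_def a_def A_def)
    have a0: "0 \<le> a r" for r using tree_size_pos[OF urn_ge_1[OF I], of m r] mpos by (simp add: a_def)
    have aA: "a r \<le> A k" if "r \<in> {1..m+1}" for r
      using simplex_functions_le_1[OF share_simplex[OF I] that] v[OF that] A[of k] by simp
    have "(\<Prod>p\<in>?P. (a (fst p) + real (snd p)) / (A k + real E)) = (\<Prod>p\<in>?P. a (fst p) + real (snd p)) / (A k + real E) ^ E"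
      by (simp only: prod_dividef prod_constant cardP)
    also have "(\<Prod>p\<in>?P. a (fst p) + real (snd p)) = (\<Prod>r=1..m+1. \<Prod>i\<in>{0..<e r}. a r + real i)"
      by (subst prod.Sigma) (auto simp: case_prod_unfold)
    also have "\<dots> = ?Z k I" by (simp only: pochhammer_prod a_def)
    finally have 1: "(\<Prod>p\<in>?P. (a (fst p) + real (snd p)) / (A k + real E)) = ?Z k I / (A k + real E) ^ E" .
    have "(\<Prod>p\<in>?P. a (fst p) / A k) = (\<Prod>r=1..m+1. \<Prod>i\<in>{0..<e r}. a r / A k)"
      by (subst prod.Sigma) (auto simp: case_prod_unfold)
    also have "\<dots> = (\<Prod>r=1..m+1. share m (k + 2) I r ^ e r)"
      by (intro prod.cong refl) (simp only: v prod_constant card_atLeastLessThan diff_zero)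
    finally have 2: "(\<Prod>p\<in>?P. a (fst p) / A k) = (\<Prod>r=1..m+1. share m (k + 2) I r ^ e r)" .
    have i: "snd p \<le> E" if "p \<in> ?P" for p
    proof -
      have "e (fst p) \<le> E" unfolding E_def using that by (intro member_le_sum) auto
      then show ?thesis using that by auto
    qed
    have "norm ((\<Prod>p\<in>?P. (a (fst p) + real (snd p)) / (A k + real E)) - (\<Prod>p\<in>?P. a (fst p) / A k))
      \<le> (\<Sum>p\<in>?P. norm ((a (fst p) + real (snd p)) / (A k + real E) - a (fst p) / A k))"
    proof (rule norm_prod_diff)
      fix p assume p: "p \<in> ?P"
      then have r: "fst p \<in> {1..m+1}" by auto
      show "norm ((a (fst p) + real (snd p)) / (A k + real E)) \<le> 1"
        using a0[of "fst p"] aA[OF r] A[of k] i[OF p] by (simp add: abs_of_nonneg divide_le_eq_1)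
      show "norm (a (fst p) / A k) \<le> 1"
        using a0[of "fst p"] aA[OF r] A[of k] by (simp add: abs_of_nonneg divide_le_eq_1)
    qed
    also have "\<dots> \<le> (\<Sum>p\<in>?P. real E / A k)"
    proof (intro sum_mono)
      fix p assume p: "p \<in> ?P"
      then have r: "fst p \<in> {1..m+1}" by auto
      have pos: "A k + real E > 0" using A[of k] by (simp add: add_pos_nonneg)
      have "(a (fst p) + real (snd p)) / (A k + real E) - a (fst p) / A k
        = (real (snd p) - (a (fst p) / A k) * real E) / (A k + real E)"
        using A[of k] pos by (simp add: field_simps)
      moreover have "\<bar>real (snd p) - (a (fst p) / A k) * real E\<bar> \<le> real E"
      proof -
        have "0 \<le> a (fst p) / A k" "a (fst p) / A k \<le> 1" using a0[of "fst p"] aA[OF r] A[of k] by auto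
        then have "0 \<le> (a (fst p) / A k) * real E" "(a (fst p) / A k) * real E \<le> real E"
          using mult_nonneg_nonneg[of "a (fst p) / A k" "real E"]
            mult_left_le_one_le[of "real E" "a (fst p) / A k"] by (simp_all only: of_nat_0_le_iff)
        moreover have "real (snd p) \<le> real E" using i[OF p] by simp
        ultimately show ?thesis by linarith
      qed
      ultimately have "norm ((a (fst p) + real (snd p)) / (A k + real E) - a (fst p) / A k) \<le> real E / (A k + real E)"
        using pos by (simp only: real_norm_def abs_divide abs_of_pos) (simp add: divide_right_mono)
      also have "\<dots> \<le> real E / A k" using A[of k] by (intro divide_left_mono) auto
      finally show "norm ((a (fst p) + real (snd p)) / (A k + real E) - a (fst p) / A k) \<le> real E / A k" .
    qed
    also have "\<dots> = real E * (real E / A k)" by (simp only: sum_constant cardP)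
    finally show ?thesis unfolding 1 2 real_norm_def .
  qed
  have bound: "\<bar>?D * (pochhammer (A k) E / (A k + real E) ^ E) - ?L k\<bar> \<le> real E * (real E / A k)" for k
  proof -
    have "?D * pochhammer (A k) E = urn_expectation m k (?Z k)"
      using urn_rising_moment[OF m, of k e] pochhammer_pos[OF A[of k], of E] unfolding A_def E_def
      by (simp only: nonzero_divide_eq_eq[OF less_imp_neq[symmetric]])
    then have "?D * (pochhammer (A k) E / (A k + real E) ^ E) = urn_expectation m k (\<lambda>I. ?Z k I / (A k + real E) ^ E)"
      by (simp only: times_divide_eq_right integral_divide_zero)
    then have eq: "?D * (pochhammer (A k) E / (A k + real E) ^ E) - ?L k =
      urn_expectation m k (\<lambda>I. ?Z k I / (A k + real E) ^ E - (\<Prod>r=1..m+1. share m (k + 2) I r ^ e r))"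
      by (simp only: Bochner_Integration.integral_diff[OF integrable_urn integrable_urn])
    have "urn_expectation m k (\<lambda>I. \<bar>?Z k I / (A k + real E) ^ E - (\<Prod>r=1..m+1. share m (k + 2) I r ^ e r)\<bar>)
      \<le> urn_expectation m k (\<lambda>I. real E * (real E / A k))"
      by (intro integral_mono_AE integrable_urn AE_pmfI close)
    also have "\<dots> = real E * (real E / A k)" by simp
    finally show ?thesis unfolding eq by (rule order_trans[OF integral_abs_bound])
  qed
  have Atop: "filterlim A at_top sequentially" unfolding A_def by (rule tree_size_at_top[OF m])
  have "(\<lambda>k. real E * (real E / A k)) \<longlonglongrightarrow> real E * 0"
    by (intro tendsto_mult tendsto_const tendsto_divide_0[OF tendsto_const] filterlim_at_top_imp_at_infinity Atop)
  then have "(\<lambda>k. ?D * (pochhammer (A k) E / (A k + real E) ^ E) - ?L k) \<longlonglongrightarrow> 0"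
    by (intro Lim_null_comparison[OF always_eventually[OF allI[OF bound[folded real_norm_def]]]]) (simp only: mult_zero_right)
  moreover have "(\<lambda>k. ?D * (pochhammer (A k) E / (A k + real E) ^ E)) \<longlonglongrightarrow> ?D * 1"
    by (intro tendsto_mult tendsto_const pochhammer_ratio_limit Atop)
  ultimately have "(\<lambda>k. ?D * (pochhammer (A k) E / (A k + real E) ^ E) - (?D * (pochhammer (A k) E / (A k + real E) ^ E) - ?L k)) \<longlonglongrightarrow> ?D * 1 - 0"
    by (intro tendsto_diff)
  then show ?thesis by simp
qed

abbreviation limit_shares :: "nat \<Rightarrow> (nat \<Rightarrow> real) measure" where
  "limit_shares m \<equiv> dirichlet m (\<lambda>_. 1 / real m)"

lemma prob_space_limit_shares: "m \<ge> 1 \<Longrightarrow> prob_space (limit_shares m)"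
  by (rule prob_space_dirichlet) simp

lemma AE_limit_shares: "AE V in limit_shares m. V \<in> simplex_functions m \<and> (\<forall>r\<in>{1..m+1}. 0 < V r)"
  using AE_dirichlet[of m "\<lambda>_. 1 / real m"]
  by eventually_elim (auto simp: simplex_functions_def less_imp_le simp del: sum.cl_ivl_Suc)

lemma limit_shares_moment:
  fixes e :: "nat \<Rightarrow> nat"
  assumes m: "m \<ge> 1"
  shows "(\<integral>V. (\<Prod>r=1..m+1. V r ^ e r) \<partial>limit_shares m) =
    (\<Prod>r=1..m+1. pochhammer (1 / real m) (e r)) / pochhammer (real (m + 1) / real m) (\<Sum>r=1..m+1. e r)"
proof -
  have "(\<integral>\<^sup>+V. ennreal (\<Prod>r=1..m+1. V r ^ e r) \<partial>limit_shares m) =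
    ennreal ((\<Prod>r=1..m+1. pochhammer (1 / real m) (e r)) / pochhammer (\<Sum>r=1..m+1. 1 / real m) (\<Sum>r=1..m+1. e r))"
    using m by (intro dirichlet_moment) simp
  moreover have "(\<Sum>r=1..m+1. 1 / real m) = real (m + 1) / real m" by (simp add: add_divide_distrib)
  moreover have "(\<Prod>r=1..m+1. pochhammer (1 / real m) (e r)) / pochhammer (real (m + 1) / real m) (\<Sum>r=1..m+1. e r) \<ge> 0"
    using m by (intro divide_nonneg_nonneg prod_nonneg) (auto intro!: pochhammer_nonneg simp del: sum.cl_ivl_Suc)
  moreover have "AE V in limit_shares m. 0 \<le> (\<Prod>r=1..m+1. V r ^ e r)"
    using AE_limit_shares[of m] by eventually_elim (intro prod_nonneg, auto intro: less_imp_le)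
  moreover have "(\<lambda>V. \<Prod>r=1..m+1. V r ^ e r) \<in> borel_measurable (limit_shares m)" by measurable
  ultimately show ?thesis
    by (subst integral_eq_nn_integral) (auto simp del: prod.cl_ivl_Suc sum.cl_ivl_Suc)
qed

section \<open>From moments to continuous functions of the shares\<close>

inductive_set simplex_poly :: "nat \<Rightarrow> ((nat \<Rightarrow> real) \<Rightarrow> real) set" for m :: nat where
  monomial: "(\<lambda>v. c * (\<Prod>r=1..m+1. v r ^ e r)) \<in> simplex_poly m"
| add: "f \<in> simplex_poly m \<Longrightarrow> g \<in> simplex_poly m \<Longrightarrow> (\<lambda>v. f v + g v) \<in> simplex_poly m"

lemma continuous_on_coordinate: "continuous_on S (\<lambda>v :: nat \<Rightarrow> real. v r)"
  by (rule continuous_on_subset[OF continuous_on_product_coordinates]) simp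

text \<open>Coordinates separate the points of the simplex: two of its elements agree outside the
  index range, so they differ inside it.\<close>

lemma function_ring_simplex: "function_ring_on (simplex_poly m) (simplex_functions m)"
proof
  show "compact (simplex_functions m)" by (rule compact_simplex_functions)
  show "continuous_on (simplex_functions m) f" if "f \<in> simplex_poly m" for f
    using that by induction (intro continuous_intros continuous_on_coordinate)+
  show "(\<lambda>v. f v + g v) \<in> simplex_poly m" if "f \<in> simplex_poly m" "g \<in> simplex_poly m" for f g
    using that by (rule simplex_poly.add)
  show "(\<lambda>v. f v * g v) \<in> simplex_poly m" if f: "f \<in> simplex_poly m" and g: "g \<in> simplex_poly m" for f g
    using f
  proof induction
    case (monomial c e)
    from g show ?case
    proof induction
      case (monomial d e')
      have "(\<lambda>v. c * (\<Prod>r=1..m+1. v r ^ e r) * (d * (\<Prod>r=1..m+1. v r ^ e' r))) =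
        (\<lambda>v. (c * d) * (\<Prod>r=1..m+1. v r ^ (e r + e' r)))"
        by (simp only: power_add prod.distrib mult_ac)
      then show ?case by (simp only: simplex_poly.monomial)
    next
      case (add f1 f2)
      then show ?case unfolding distrib_left by (intro simplex_poly.add)
    qed
  next
    case (add f1 f2)
    then show ?case unfolding distrib_right by (intro simplex_poly.add)
  qed
  show "(\<lambda>_. c) \<in> simplex_poly m" for c
    using simplex_poly.monomial[where c=c and m=m and e="\<lambda>_. 0"] by simp
  show "\<exists>f\<in>simplex_poly m. f x \<noteq> f y" if "x \<in> simplex_functions m" "y \<in> simplex_functions m" "x \<noteq> y" for x y
  proof -
    obtain r where r: "x r \<noteq> y r" using \<open>x \<noteq> y\<close> by auto
    then have R: "r \<in> {1..m+1}" using that by (auto simp: simplex_functions_def)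
    have "(\<Prod>r'=1..m+1. v r' ^ (if r' = r then 1 else 0)) = v r" for v :: "nat \<Rightarrow> real"
    proof -
      have "(\<Prod>r'=1..m+1. v r' ^ (if r' = r then 1 else 0)) = (\<Prod>r'\<in>{1..m+1}. if r' = r then v r' else 1)"
        by (intro prod.cong) auto
      then show ?thesis using R by (simp only: prod.delta') simp
    qed
    then have "(\<lambda>v. v r) \<in> simplex_poly m"
      using simplex_poly.monomial[where c=1 and m=m and e="\<lambda>r'. if r' = r then 1 else 0"] by (simp only: mult_1)
    then show ?thesis using r by (intro bexI[of _ "\<lambda>v. v r"])
  qed
qed

lemma simplex_poly_measurable: "p \<in> simplex_poly m \<Longrightarrow> p \<in> borel_measurable (\<Pi>\<^sub>M r\<in>{1..m+1}. borel)"
  by (induction rule: simplex_poly.induct) measurable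

lemma integrable_limit_shares:
  fixes g :: "(nat \<Rightarrow> real) \<Rightarrow> real"
  assumes m: "m \<ge> 1" and g: "continuous_on (simplex_functions m) g"
    and [measurable]: "g \<in> borel_measurable (\<Pi>\<^sub>M r\<in>{1..m+1}. borel)"
  shows "integrable (limit_shares m) g"
proof -
  interpret prob_space "limit_shares m" by (rule prob_space_limit_shares[OF m])
  have "bounded (g ` simplex_functions m)"
    by (intro compact_imp_bounded compact_continuous_image g compact_simplex_functions)
  then obtain B where B: "\<And>v. v \<in> simplex_functions m \<Longrightarrow> norm (g v) \<le> B" by (auto simp: bounded_iff)
  show ?thesis
  proof (rule integrable_const_bound[where B=B])
    show "AE V in limit_shares m. norm (g V) \<le> B" using AE_limit_shares[of m] by eventually_elim (blast intro: B)
  qed measurable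
qed

text \<open>Moment convergence extends to polynomials by linearity. Both the urn shares and almost
  all points of the Dirichlet law lie in the compact simplex, so a uniform approximation there costs
  a third of epsilon on each side.\<close>

theorem urn_shares_limit:
  assumes m: "m \<ge> 1" and g: "continuous_on (simplex_functions m) g"
    and gm [measurable]: "g \<in> borel_measurable (\<Pi>\<^sub>M r\<in>{1..m+1}. borel)"
  shows "(\<lambda>k. urn_expectation m k (\<lambda>I. g (share m (k + 2) I))) \<longlonglongrightarrow> (\<integral>V. g V \<partial>limit_shares m)"
proof -
  interpret D: prob_space "limit_shares m" by (rule prob_space_limit_shares[OF m])
  interpret function_ring_on "simplex_poly m" "simplex_functions m" by (rule function_ring_simplex)
  note int = integrable_limit_shares[OF m]
  have poly: "(\<lambda>k. urn_expectation m k (\<lambda>I. p (share m (k + 2) I))) \<longlonglongrightarrow> (\<integral>V. p V \<partial>limit_shares m)"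
    if "p \<in> simplex_poly m" for p
    using that
  proof induction
    case (monomial c e)
    have "(\<lambda>k. c * urn_expectation m k (\<lambda>I. \<Prod>r=1..m+1. share m (k + 2) I r ^ e r))
      \<longlonglongrightarrow> c * (\<integral>V. (\<Prod>r=1..m+1. V r ^ e r) \<partial>limit_shares m)"
      unfolding limit_shares_moment[OF m] by (intro tendsto_mult tendsto_const urn_monomial_limit m)
    then show ?case by (simp only: integral_mult_right_zero)
  next
    case (add f1 f2)
    have "integrable (limit_shares m) f1" "integrable (limit_shares m) f2"
      using add.hyps by (auto intro!: int continuous simplex_poly_measurable)
    then show ?case using tendsto_add[OF add.IH] by (simp add: integrable_urn)
  qed
  show ?thesis
  proof (rule LIMSEQ_I)
    fix \<epsilon> :: real assume "\<epsilon> > 0"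
    then have "\<epsilon> / 3 > 0" by simp
    from Stone_Weierstrass_basic[OF g this] obtain p where p: "p \<in> simplex_poly m"
      "\<And>v. v \<in> simplex_functions m \<Longrightarrow> \<bar>g v - p v\<bar> < \<epsilon> / 3" by auto
    from LIMSEQ_D[OF poly[OF p(1)] \<open>\<epsilon> / 3 > 0\<close>] obtain K where K: "\<And>k. k \<ge> K \<Longrightarrow>
      norm (urn_expectation m k (\<lambda>I. p (share m (k + 2) I)) - (\<integral>V. p V \<partial>limit_shares m)) < \<epsilon> / 3" by auto
    have pi: "integrable (limit_shares m) p" by (intro int continuous simplex_poly_measurable p)
    have gi: "integrable (limit_shares m) g" by (intro int g gm)
    have gp: "\<bar>(\<integral>V. g V \<partial>limit_shares m) - (\<integral>V. p V \<partial>limit_shares m)\<bar> \<le> \<epsilon> / 3"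
    proof -
      have "\<bar>(\<integral>V. g V \<partial>limit_shares m) - (\<integral>V. p V \<partial>limit_shares m)\<bar> = \<bar>\<integral>V. g V - p V \<partial>limit_shares m\<bar>"
        using pi gi by simp
      also have "\<dots> \<le> (\<integral>V. \<bar>g V - p V\<bar> \<partial>limit_shares m)" by (rule integral_abs_bound)
      also have "\<dots> \<le> (\<integral>V. \<epsilon> / 3 \<partial>limit_shares m)"
      proof (rule integral_mono_AE)
        show "AE V in limit_shares m. \<bar>g V - p V\<bar> \<le> \<epsilon> / 3"
          using AE_limit_shares[of m] by eventually_elim (blast intro: less_imp_le p(2))
      qed (use pi gi in auto)
      finally show ?thesis by (simp add: D.prob_space)
    qed
    have gp': "\<bar>urn_expectation m k (\<lambda>I. g (share m (k + 2) I)) - urn_expectation m k (\<lambda>I. p (share m (k + 2) I))\<bar> \<le> \<epsilon> / 3" for k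
    proof -
      have "\<bar>urn_expectation m k (\<lambda>I. g (share m (k + 2) I)) - urn_expectation m k (\<lambda>I. p (share m (k + 2) I))\<bar>
        = \<bar>urn_expectation m k (\<lambda>I. g (share m (k + 2) I) - p (share m (k + 2) I))\<bar>"
        by (simp add: integrable_urn)
      also have "\<dots> \<le> urn_expectation m k (\<lambda>I. \<bar>g (share m (k + 2) I) - p (share m (k + 2) I)\<bar>)"
        by (rule integral_abs_bound)
      also have "\<dots> \<le> urn_expectation m k (\<lambda>I. \<epsilon> / 3)"
        using p(2)[OF share_simplex] by (intro integral_mono_AE integrable_urn) (auto simp: AE_measure_pmf_iff intro: less_imp_le)
      finally show ?thesis by simp
    qed
    have "norm (urn_expectation m k (\<lambda>I. g (share m (k + 2) I)) - (\<integral>V. g V \<partial>limit_shares m)) < \<epsilon>"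
      if "k \<ge> K" for k
    proof -
      have "\<bar>x - w\<bar> < \<epsilon>" if "\<bar>w - z\<bar> \<le> \<epsilon> / 3" "\<bar>x - y\<bar> \<le> \<epsilon> / 3" "\<bar>y - z\<bar> < \<epsilon> / 3" for w x y z :: real
        using that by linarith
      from this[OF gp gp' K[OF that, unfolded real_norm_def]] show ?thesis unfolding real_norm_def .
    qed
    then show "\<exists>no. \<forall>n\<ge>no. norm (urn_expectation m n (\<lambda>I. g (share m (n + 2) I)) - (\<integral>V. g V \<partial>limit_shares m)) < \<epsilon>"
      by blast
  qed
qed

section \<open>The limit map\<close>

text \<open>The indicator of a closed set is the pointwise limit of the Lipschitz functions max 0 (1
  - k dist(x, C)), and closed sets form a generator closed under intersection. The empty set is
  treated apart, as \<open>infdist\<close> to it is zero by default.\<close>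

lemma measure_eqI_lipschitz:
  fixes M N :: "'a::metric_space measure"
  assumes "prob_space M" "prob_space N" and sets: "sets M = sets borel" "sets N = sets borel"
    and eq: "\<And>f :: 'a \<Rightarrow> real. \<exists>L\<ge>0. \<forall>x y. \<bar>f x - f y\<bar> \<le> L * dist x y \<Longrightarrow> (\<And>x. 0 \<le> f x \<and> f x \<le> 1) \<Longrightarrow>
      integral\<^sup>L M f = integral\<^sup>L N f"
  shows "M = N"
proof -
  interpret M: prob_space M by fact
  interpret N: prob_space N by fact
  have closed_eq: "measure M C = measure N C" if C: "closed C" "C \<noteq> {}" for C
  proof -
    define f where "f k x = max 0 (1 - real k * infdist x C)" for k x
    have f01: "0 \<le> f k x \<and> f k x \<le> 1" for k x by (simp add: f_def infdist_nonneg)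
    have lip: "\<bar>f k x - f k y\<bar> \<le> real k * dist x y" for k x y
    proof -
      have "\<bar>f k x - f k y\<bar> \<le> \<bar>real k * infdist x C - real k * infdist y C\<bar>" unfolding f_def by linarith
      also have "\<dots> = real k * \<bar>infdist x C - infdist y C\<bar>" by (simp add: abs_mult flip: right_diff_distrib)
      also have "\<dots> \<le> real k * dist x y" by (intro mult_left_mono infdist_triangle_abs) simp
      finally show ?thesis .
    qed
    have cont: "continuous_on UNIV (f k)" for k unfolding f_def by (intro continuous_intros)
    have meas: "f k \<in> borel_measurable borel" for k by (rule borel_measurable_continuous_onI[OF cont])
    have lim: "(\<lambda>k. f k x) \<longlonglongrightarrow> indicator C x" for x
    proof (cases "x \<in> C")
      case True
      then show ?thesis by (simp add: f_def)
    next
      case False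
      then have d: "infdist x C > 0" using C by (metis in_closed_iff_infdist_zero infdist_nonneg less_eq_real_def)
      have "\<forall>\<^sub>F k in sequentially. f k x = 0"
      proof (rule eventually_sequentiallyI[of "nat \<lceil>1 / infdist x C\<rceil>"])
        fix k assume "nat \<lceil>1 / infdist x C\<rceil> \<le> k"
        then have "1 / infdist x C \<le> real k" by linarith
        then have "1 \<le> real k * infdist x C" using d by (simp add: field_simps)
        then show "f k x = 0" by (simp add: f_def)
      qed
      then show ?thesis using False by (simp add: tendsto_eventually)
    qed
    have conv: "(\<lambda>k. integral\<^sup>L K (f k)) \<longlonglongrightarrow> measure K C" if K: "prob_space K" "sets K = sets borel" for K
    proof -
      interpret prob_space K by (rule K)
      have [measurable]: "f k \<in> borel_measurable K" "(indicator C :: 'a \<Rightarrow> real) \<in> borel_measurable K" for k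
        using meas C(1) by (auto simp: measurable_cong_sets[OF K(2) refl] intro: borel_measurable_indicator)
      have "(\<lambda>k. integral\<^sup>L K (f k)) \<longlonglongrightarrow> integral\<^sup>L K (indicator C)"
      proof (rule integral_dominated_convergence[where w = "\<lambda>_. 1"])
        show "AE x in K. norm (f k x) \<le> 1" for k using f01[of k] by (intro AE_I2) (simp add: abs_of_nonneg)
      qed (use lim in auto)
      then show ?thesis using sets_eq_imp_space_eq[OF K(2)] by simp
    qed
    have "integral\<^sup>L M (f k) = integral\<^sup>L N (f k)" for k
      using lip[of k] f01 by (intro eq exI[of _ "real k"]) auto
    then show ?thesis using conv[OF assms(1) sets(1)] conv[OF assms(2) sets(2)] LIMSEQ_unique by simp
  qed
  show ?thesis
  proof (rule measure_eqI_generator_eq[where E = "Collect closed" and \<Omega> = UNIV and A = "\<lambda>_. UNIV"])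
    show "sets M = sigma_sets UNIV (Collect closed)" "sets N = sigma_sets UNIV (Collect closed)"
      unfolding sets by (simp_all add: borel_eq_closed)
    show "emeasure M X = emeasure N X" if "X \<in> Collect closed" for X
      using closed_eq[of X] that by (cases "X = {}") (auto simp: M.emeasure_eq_measure N.emeasure_eq_measure)
  qed (auto simp: Int_stable_def M.emeasure_eq_measure)
qed

section \<open>Continuity and growth of the toll map\<close>

text \<open>At 0 the product is 0 whatever the default value of the logarithm, in agreement with the
  convention 0 ln 0 = 0; hence the toll is continuous up to the boundary of the simplex.\<close>

lemma continuous_on_x_ln_x: "continuous_on {0..} (\<lambda>x :: real. x * ln x)"
  unfolding continuous_on_def
proof
  fix x :: real assume x: "x \<in> {0..}"
  show "((\<lambda>x. x * ln x) \<longlongrightarrow> x * ln x) (at x within {0..})"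
  proof (cases "x = 0")
    case True
    have "((\<lambda>x::real. x * ln x) \<longlongrightarrow> 0) (at_right 0)" by real_asymp
    moreover have "at (0::real) within {0..} = at_right 0"
    proof -
      have "{0..} - {0} = {0<..} - {0::real}" by auto
      then show ?thesis unfolding at_within_def by (simp only:)
    qed
    ultimately show ?thesis using True by simp
  next
    case False
    then have "isCont (\<lambda>x. x * ln x) x" using x by (intro continuous_intros) auto
    then show ?thesis by (simp add: isCont_def tendsto_within_subset[of _ _ _ UNIV])
  qed
qed

lemma b_vec_nth:
  "b_vec m V $ 1 = (real m)\<^sup>2 * ((\<Sum>r=1..m+1. V r * ln (V r) - (V r)\<^sup>2) + (\<Sum>r=1..m. V r * (1 - V r)) + 1)"
  "b_vec m V $ 2 = real m * ((\<Sum>r=1..m+1. V r * ln (V r)) + 1 - V (m+1))"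
  by (simp_all add: b_vec_def right_diff_distrib power2_eq_square)

lemma continuous_on_b_vec: "continuous_on (simplex_functions m) (\<lambda>V. b_vec m V $ i)"
proof -
  have c: "continuous_on (simplex_functions m) (\<lambda>V. V r * ln (V r))" if "r \<in> {1..m+1}" for r
  proof (rule continuous_on_compose2[OF continuous_on_x_ln_x])
    show "continuous_on (simplex_functions m) (\<lambda>V. V r)" by (rule continuous_on_coordinate)
    show "(\<lambda>V. V r) ` simplex_functions m \<subseteq> {0..}" using that by (auto simp: simplex_functions_def)
  qed
  have "continuous_on (simplex_functions m) (\<lambda>V. b_vec m V $ 1)" "continuous_on (simplex_functions m) (\<lambda>V. b_vec m V $ 2)"
    unfolding b_vec_nth by (intro continuous_intros continuous_on_coordinate c; simp)+
  then show ?thesis using exhaust_2[of i] by metis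
qed

lemma b_vec_bounded: "\<exists>B\<ge>0. \<forall>V\<in>simplex_functions m. norm (b_vec m V) \<le> B"
proof -
  have "\<exists>B. \<forall>V\<in>simplex_functions m. \<bar>b_vec m V $ i\<bar> \<le> B" for i
  proof -
    have "bounded ((\<lambda>V. b_vec m V $ i) ` simplex_functions m)"
      by (intro compact_imp_bounded compact_continuous_image continuous_on_b_vec compact_simplex_functions)
    then show ?thesis by (auto simp: bounded_iff)
  qed
  then obtain B where B: "\<And>i V. V \<in> simplex_functions m \<Longrightarrow> \<bar>b_vec m V $ i\<bar> \<le> B i" by metis
  have "norm (b_vec m V) \<le> max 0 (B 1 + B 2)" if V: "V \<in> simplex_functions m" for V
    using norm_le_l1_cart[of "b_vec m V"] B[OF V, of 1] B[OF V, of 2] by (simp add: sum_2)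
  then show ?thesis by (intro exI[of _ "max 0 (B 1 + B 2)"]) auto
qed

text \<open>The bound retains one factor \<open>V r\<close>. It is what makes the error of a small
  component negligible.\<close>

lemma A_mat_norm:
  assumes "0 \<le> V r" "V r \<le> 1"
  shows "norm (A_mat m V r *v x) \<le> (real m + 2) * (V r * norm x)"
proof -
  have x: "\<bar>x $ i\<bar> \<le> norm x" for i by (rule component_le_norm_cart)
  have "(V r)\<^sup>2 \<le> V r" using assms by (simp add: power2_eq_square mult_left_le)
  then have "\<bar>(V r)\<^sup>2 * x $ 1\<bar> \<le> V r * norm x"
    unfolding abs_mult using x[of 1] assms by (intro mult_mono) auto
  moreover have "\<bar>real m * V r * (1 - V r) * x $ 2\<bar> \<le> real m * (V r * norm x)"
  proof -
    have "\<bar>real m * V r * (1 - V r) * x $ 2\<bar> = (real m * V r) * ((1 - V r) * \<bar>x $ 2\<bar>)"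
      using assms by (simp add: abs_mult)
    also have "\<dots> \<le> (real m * V r) * (1 * norm x)"
      using assms x[of 2] by (intro mult_left_mono mult_mono) auto
    finally show ?thesis by (simp add: mult_ac)
  qed
  moreover have "\<bar>V r * x $ 2\<bar> \<le> V r * norm x"
    unfolding abs_mult using x[of 2] assms by (intro mult_mono) auto
  moreover have "norm (A_mat m V r *v x) \<le> \<bar>(V r)\<^sup>2 * x $ 1 + real m * V r * (1 - V r) * x $ 2\<bar> + \<bar>V r * x $ 2\<bar>"
    using norm_le_l1_cart[of "A_mat m V r *v x"] by (simp add: sum_2 A_mat_mult)
  ultimately show ?thesis by (simp add: algebra_simps)
qed

lemma toll_map_cong: "(\<And>r. r \<in> {1..m+1} \<Longrightarrow> X r = Y r) \<Longrightarrow> toll_map m V X = toll_map m V Y"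
  unfolding toll_map_def by (intro arg_cong2[of _ _ _ _ "(+)"] sum.cong refl) simp

lemma toll_map_norm:
  assumes "V \<in> simplex_functions m"
  shows "norm (toll_map m V X) \<le> (real m + 2) * (\<Sum>r=1..m+1. V r * norm (X r)) + norm (b_vec m V)"
proof -
  have "norm (\<Sum>r=1..m+1. A_mat m V r *v X r) \<le> (\<Sum>r=1..m+1. (real m + 2) * (V r * norm (X r)))"
    using assms simplex_functions_le_1[OF assms]
    by (intro sum_norm_le A_mat_norm) (auto simp: simplex_functions_def)
  then show ?thesis unfolding toll_map_def sum_distrib_left by (rule norm_triangle_mono) simp
qed

lemma toll_map_diff:
  assumes "V \<in> simplex_functions m"
  shows "norm (toll_map m V X - toll_map m V Y) \<le> (real m + 2) * (\<Sum>r=1..m+1. V r * norm (X r - Y r))"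
proof -
  have "toll_map m V X - toll_map m V Y = (\<Sum>r=1..m+1. A_mat m V r *v (X r - Y r))"
    by (simp only: toll_map_def matrix_vector_mult_diff_distrib sum_subtractf) simp
  also have "norm \<dots> \<le> (\<Sum>r=1..m+1. (real m + 2) * (V r * norm (X r - Y r)))"
    using assms simplex_functions_le_1[OF assms]
    by (intro sum_norm_le A_mat_norm) (auto simp: simplex_functions_def)
  finally show ?thesis by (simp only: sum_distrib_left)
qed

lemma borel_measurable_nth_2:
  fixes f :: "'a \<Rightarrow> real^2"
  shows "f \<in> borel_measurable M \<Longrightarrow> (\<lambda>x. f x $ i) \<in> borel_measurable M"
  by (rule measurable_compose[where g="\<lambda>x. x $ i"]) (auto intro!: borel_measurable_continuous_onI continuous_intros)

lemma toll_map_measurable [measurable]: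
  "(\<lambda>p. toll_map m (snd p) (fst p)) \<in> borel_measurable ((\<Pi>\<^sub>M r\<in>{1..m+1}. borel) \<Otimes>\<^sub>M (\<Pi>\<^sub>M r\<in>{1..m+1}. borel))"
proof -
  have c: "(\<lambda>p. snd p r) \<in> borel_measurable ((\<Pi>\<^sub>M r\<in>{1..m+1}. borel :: (real^2) measure) \<Otimes>\<^sub>M (\<Pi>\<^sub>M r\<in>{1..m+1}. borel :: real measure))"
    "(\<lambda>p. fst p r) \<in> borel_measurable ((\<Pi>\<^sub>M r\<in>{1..m+1}. borel :: (real^2) measure) \<Otimes>\<^sub>M (\<Pi>\<^sub>M r\<in>{1..m+1}. borel :: real measure))"
    if "r \<in> {1..m+1}" for r
    using that by (auto intro: measurable_compose[OF measurable_snd measurable_component_singleton]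
        measurable_compose[OF measurable_fst measurable_component_singleton])
  have "(\<lambda>p :: (nat \<Rightarrow> real^2) \<times> (nat \<Rightarrow> real). toll_map m (snd p) (fst p)) = (\<lambda>p. vector [toll_map m (snd p) (fst p) $ 1, toll_map m (snd p) (fst p) $ 2])"
    by (simp add: fun_eq_iff vec_eq_iff forall_2)
  moreover have "\<dots> \<in> borel_measurable ((\<Pi>\<^sub>M r\<in>{1..m+1}. borel) \<Otimes>\<^sub>M (\<Pi>\<^sub>M r\<in>{1..m+1}. borel))"
    unfolding toll_map_nth b_vec_nth
    by (intro borel_measurable_vector_2 borel_measurable_add borel_measurable_sum borel_measurable_times
          borel_measurable_diff borel_measurable_power borel_measurable_const borel_measurable_ln
          borel_measurable_nth_2 c; simp)
  ultimately show ?thesis by simp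
qed

lemma T_map_eq: "T_map m \<nu> = distr ((\<Pi>\<^sub>M r\<in>{1..m+1}. \<nu>) \<Otimes>\<^sub>M limit_shares m) borel (\<lambda>p. toll_map m (snd p) (fst p))"
  unfolding T_map_def toll_map_def by (simp add: case_prod_unfold)

text \<open>The factors may be realised on an arbitrary probability space \<open>\<pi>\<close>: this covers a law itself, a
  coupling of two laws, and the path space.\<close>

lemma T_map_distr:
  assumes m: "m \<ge> 1" and \<pi>: "prob_space \<pi>" and f [measurable]: "f \<in> borel_measurable \<pi>"
  shows "T_map m (distr \<pi> borel f) = distr ((\<Pi>\<^sub>M r\<in>{1..m+1}. \<pi>) \<Otimes>\<^sub>M limit_shares m) borel (\<lambda>p. toll_map m (snd p) (\<lambda>r. f (fst p r)))"
proof -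
  let ?R = "{1..m+1}" and ?\<nu> = "distr \<pi> borel f" and ?D = "limit_shares m"
  interpret \<pi>: prob_space \<pi> by (rule \<pi>)
  interpret D: prob_space ?D by (rule prob_space_limit_shares[OF m])
  have \<nu>: "prob_space ?\<nu>" by (rule \<pi>.prob_space_distr) measurable
  have "distr (PiM ?R (\<lambda>_. \<pi>)) (PiM ?R (\<lambda>_. ?\<nu>)) (compose ?R f) = PiM ?R (\<lambda>_. distr \<pi> ?\<nu> f)"
    using \<nu> \<pi> by (intro distr_PiM_finite_prob_space') auto
  also have "distr \<pi> ?\<nu> f = ?\<nu>" by (rule distr_cong) auto
  finally have 1: "PiM ?R (\<lambda>_. ?\<nu>) = distr (PiM ?R (\<lambda>_. \<pi>)) (PiM ?R (\<lambda>_. ?\<nu>)) (compose ?R f)" by simp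
  have cm: "compose ?R f \<in> PiM ?R (\<lambda>_. \<pi>) \<rightarrow>\<^sub>M PiM ?R (\<lambda>_. ?\<nu>)"
    unfolding compose_def by (rule measurable_restrict) (auto intro: measurable_compose[OF measurable_component_singleton])
  have "PiM ?R (\<lambda>_. ?\<nu>) \<Otimes>\<^sub>M ?D = distr (PiM ?R (\<lambda>_. \<pi>)) (PiM ?R (\<lambda>_. ?\<nu>)) (compose ?R f) \<Otimes>\<^sub>M distr ?D ?D (\<lambda>x. x)"
    using 1 by (simp add: distr_id)
  also have "\<dots> = distr (PiM ?R (\<lambda>_. \<pi>) \<Otimes>\<^sub>M ?D) (PiM ?R (\<lambda>_. ?\<nu>) \<Otimes>\<^sub>M ?D) (\<lambda>(x, y). (compose ?R f x, y))"
    using cm by (intro pair_measure_distr) (auto simp: distr_id intro: D.sigma_finite_measure_axioms)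
  finally have pair: "PiM ?R (\<lambda>_. ?\<nu>) \<Otimes>\<^sub>M ?D = \<dots>" .
  have tm: "(\<lambda>p. toll_map m (snd p) (fst p)) \<in> borel_measurable (PiM ?R (\<lambda>_. ?\<nu>) \<Otimes>\<^sub>M ?D)"
    using toll_map_measurable[of m]
    by (subst measurable_cong_sets[OF sets_pair_measure_cong[OF sets_PiM_cong[OF refl] sets_dirichlet] refl]) auto
  have "T_map m ?\<nu> = distr (PiM ?R (\<lambda>_. \<pi>) \<Otimes>\<^sub>M ?D) borel ((\<lambda>p. toll_map m (snd p) (fst p)) \<circ> (\<lambda>(x, y). (compose ?R f x, y)))"
  proof (subst T_map_eq, subst pair, rule distr_distr)
    show "(\<lambda>p. toll_map m (snd p) (fst p)) \<in> borel_measurable (PiM ?R (\<lambda>_. ?\<nu>) \<Otimes>\<^sub>M ?D)" by (rule tm)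
    show "(\<lambda>(x, y). (compose ?R f x, y)) \<in> PiM ?R (\<lambda>_. \<pi>) \<Otimes>\<^sub>M ?D \<rightarrow>\<^sub>M PiM ?R (\<lambda>_. ?\<nu>) \<Otimes>\<^sub>M ?D"
      unfolding case_prod_unfold by (intro measurable_Pair measurable_compose[OF measurable_fst cm] measurable_snd)
  qed
  also have "(\<lambda>p. toll_map m (snd p) (fst p)) \<circ> (\<lambda>(x, y). (compose ?R f x, y)) = (\<lambda>p. toll_map m (snd p) (\<lambda>r. f (fst p r)))"
    by (auto simp: fun_eq_iff compose_def intro!: toll_map_cong)
  finally show ?thesis .
qed

lemma le_one_plus_square: "x \<le> 1 + x\<^sup>2" for x :: real
  using zero_le_power2[of "2 * x - 1"] by (simp add: power2_diff power_mult_distrib)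

lemma M02_D:
  assumes "\<nu> \<in> M02"
  shows "prob_space \<nu>" "sets \<nu> = sets borel" "integrable \<nu> (\<lambda>x. (norm x)\<^sup>2)"
    "integrable \<nu> (\<lambda>x. x)" "integrable \<nu> (\<lambda>x. x $ i)" "(\<integral>x. x $ i \<partial>\<nu>) = 0"
    "integrable \<nu> (\<lambda>x. (x $ i)\<^sup>2)"
proof -
  show \<nu>: "prob_space \<nu>" "sets \<nu> = sets borel" "integrable \<nu> (\<lambda>x. (norm x)\<^sup>2)"
    using assms by (auto simp: M02_def)
  interpret prob_space \<nu> by (rule \<nu>)
  have id: "(\<lambda>x. x) \<in> borel_measurable \<nu>" by (simp add: measurable_cong_sets[OF \<nu>(2) refl])
  show int: "integrable \<nu> (\<lambda>x. x)"
  proof (rule Bochner_Integration.integrable_bound[of _ "\<lambda>x. 1 + (norm x)\<^sup>2"])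
    show "AE x in \<nu>. norm x \<le> norm (1 + (norm x)\<^sup>2)" by (intro AE_I2) (simp add: le_one_plus_square)
  qed (use \<nu> id in auto)
  show "integrable \<nu> (\<lambda>x. x $ i)" by (rule integrable_bounded_linear[OF bounded_linear_vec_nth int])
  have "(\<integral>x. x $ i \<partial>\<nu>) = (\<integral>x. x \<partial>\<nu>) $ i" by (rule integral_bounded_linear[OF bounded_linear_vec_nth int])
  then show "(\<integral>x. x $ i \<partial>\<nu>) = 0" using assms by (simp add: M02_def)
  show "integrable \<nu> (\<lambda>x. (x $ i)\<^sup>2)"
  proof (rule Bochner_Integration.integrable_bound[OF \<nu>(3)])
    show "AE x in \<nu>. norm ((x $ i)\<^sup>2) \<le> norm ((norm x)\<^sup>2)"
      by (intro AE_I2) (simp, metis abs_ge_zero component_le_norm_cart power2_abs power_mono)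
  qed (use borel_measurable_nth_2[OF id] in auto)
qed

text \<open>Square integrability on a probability space yields integrability, so the vector mean may
  be computed coordinate by coordinate.\<close>

lemma M02_I:
  fixes X :: "'a \<Rightarrow> real^2"
  assumes "prob_space M" and X: "X \<in> borel_measurable M" "integrable M (\<lambda>x. (norm (X x))\<^sup>2)"
    and mean: "\<And>i. (\<integral>x. X x $ i \<partial>M) = 0"
  shows "distr M borel X \<in> M02"
proof -
  interpret prob_space M by fact
  have int: "integrable M X"
  proof (rule Bochner_Integration.integrable_bound[of _ "\<lambda>x. 1 + (norm (X x))\<^sup>2"])
    show "AE x in M. norm (X x) \<le> norm (1 + (norm (X x))\<^sup>2)" by (intro AE_I2) (simp add: le_one_plus_square)
  qed (use X in auto)
  have "(\<integral>x. X x \<partial>M) $ i = 0" for i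
    using integral_bounded_linear[OF bounded_linear_vec_nth[of i] int] mean by simp
  then have "(\<integral>x. X x \<partial>M) = 0" by (simp add: vec_eq_iff)
  then show ?thesis
    using X prob_space_distr[OF X(1)] by (simp add: M02_def integrable_distr_eq integral_distr)
qed

section \<open>Independent copies\<close>

lemma (in prob_space) PiM_component_integral:
  fixes g :: "'a \<Rightarrow> real"
  assumes I: "finite I" "r \<in> I" and [measurable]: "g \<in> borel_measurable M"
  shows "(\<integral>X. g (X r) \<partial>PiM I (\<lambda>_. M)) = integral\<^sup>L M g"
    and "integrable M g \<Longrightarrow> integrable (PiM I (\<lambda>_. M)) (\<lambda>X. g (X r))"
proof -
  have d: "distr (PiM I (\<lambda>_. M)) M (\<lambda>X. X r) = M"
    using I prob_space_axioms by (intro distr_PiM_component)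
  have c: "(\<lambda>X. X r) \<in> PiM I (\<lambda>_. M) \<rightarrow>\<^sub>M M" using I by (intro measurable_component_singleton)
  show "(\<integral>X. g (X r) \<partial>PiM I (\<lambda>_. M)) = integral\<^sup>L M g"
    by (subst (2) d[symmetric], subst integral_distr[OF c]) auto
  show "integrable (PiM I (\<lambda>_. M)) (\<lambda>X. g (X r))" if "integrable M g"
    using that integrable_distr_eq[OF c, of g] d by simp
qed

text \<open>Additivity of variance: the factors are independent and centred, so mixed products
  integrate to zero.\<close>

lemma (in prob_space) PiM_sum_square:
  fixes g :: "'i \<Rightarrow> 'a \<Rightarrow> real"
  assumes I: "finite I" and g: "\<And>r. r \<in> I \<Longrightarrow> g r \<in> borel_measurable M"
    and sq: "\<And>r. r \<in> I \<Longrightarrow> integrable M (\<lambda>x. (g r x)\<^sup>2)"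
    and int: "\<And>r. r \<in> I \<Longrightarrow> integrable M (g r)" and mean: "\<And>r. r \<in> I \<Longrightarrow> integral\<^sup>L M (g r) = 0"
  shows "integrable (PiM I (\<lambda>_. M)) (\<lambda>X. (\<Sum>r\<in>I. g r (X r))\<^sup>2)"
    and "(\<integral>X. (\<Sum>r\<in>I. g r (X r))\<^sup>2 \<partial>PiM I (\<lambda>_. M)) = (\<Sum>r\<in>I. \<integral>x. (g r x)\<^sup>2 \<partial>M)"
proof -
  interpret P: product_sigma_finite "\<lambda>_::'i. M" by standard
  let ?P = "PiM I (\<lambda>_. M)"
  have exp: "(\<lambda>X. (\<Sum>r\<in>I. g r (X r))\<^sup>2) = (\<lambda>X. \<Sum>r\<in>I. \<Sum>s\<in>I. g r (X r) * g s (X s))"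
    by (simp add: power2_eq_square sum_product)
  have pair: "integrable ?P (\<lambda>X. g r (X r) * g s (X s)) \<and>
      (\<integral>X. g r (X r) * g s (X s) \<partial>?P) = (if s = r then \<integral>x. (g r x)\<^sup>2 \<partial>M else 0)"
    if r: "r \<in> I" "s \<in> I" for r s
  proof (cases "s = r")
    case True
    then show ?thesis
      using PiM_component_integral[OF I r(1), of "\<lambda>x. (g r x)\<^sup>2"] sq[OF r(1)] g[OF r(1)] by (simp add: power2_eq_square)
  next
    case False
    \<comment> \<open>All other coordinates carry the constant 1, which turns a product of two
      factors into a product over the whole index set.\<close>
    define h where "h i = (if i = r then g r else if i = s then g s else (\<lambda>_. 1))" for i
    have hi: "integrable M (h i)" for i using int r by (simp add: h_def)
    have split: "(\<Prod>i\<in>I. k i) = k r * (k s * (\<Prod>i\<in>I - {r} - {s}. k i))" for k :: "'i \<Rightarrow> real"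
      using I r False by (subst prod.remove[of _ r], simp_all) (subst prod.remove[of _ s], simp_all)
    have h: "(\<Prod>i\<in>I. h i (X i)) = g r (X r) * g s (X s)" for X
      unfolding split using False by (auto simp: h_def intro!: prod.neutral)
    have "integral\<^sup>L M (h r) = 0" using r by (simp add: h_def mean)
    then have "(\<integral>X. (\<Prod>i\<in>I. h i (X i)) \<partial>?P) = 0"
      using I r by (subst P.product_integral_prod[OF I hi]) (auto intro!: prod_zero)
    moreover have "integrable ?P (\<lambda>X. \<Prod>i\<in>I. h i (X i))" by (rule P.product_integrable_prod[OF I hi])
    ultimately show ?thesis using False by (simp add: h)
  qed
  show "integrable ?P (\<lambda>X. (\<Sum>r\<in>I. g r (X r))\<^sup>2)" unfolding exp using pair by auto
  have "(\<integral>X. (\<Sum>r\<in>I. g r (X r))\<^sup>2 \<partial>?P) = (\<Sum>r\<in>I. \<Sum>s\<in>I. if s = r then \<integral>x. (g r x)\<^sup>2 \<partial>M else 0)"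
    unfolding exp using pair by (simp add: Bochner_Integration.integral_sum)
  then show "(\<integral>X. (\<Sum>r\<in>I. g r (X r))\<^sup>2 \<partial>?P) = (\<Sum>r\<in>I. \<integral>x. (g r x)\<^sup>2 \<partial>M)"
    using I by simp
qed

lemma (in prob_space) distr_pair_snd:
  assumes "sigma_finite_measure N"
  shows "distr (M \<Otimes>\<^sub>M N) N snd = N"
proof (intro measure_eqI)
  interpret N: sigma_finite_measure N by fact
  fix A assume A: "A \<in> sets (distr (M \<Otimes>\<^sub>M N) N snd)"
  then have "snd -` A \<inter> space (M \<Otimes>\<^sub>M N) = space M \<times> A"
    by (auto simp: space_pair_measure dest: sets.sets_into_space)
  with A show "emeasure (distr (M \<Otimes>\<^sub>M N) N snd) A = emeasure N A"
    by (simp add: emeasure_distr N.emeasure_pair_measure_Times emeasure_space_1)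
qed simp

abbreviation copies :: "nat \<Rightarrow> 'a measure \<Rightarrow> (nat \<Rightarrow> 'a) measure" where
  "copies m \<pi> \<equiv> (\<Pi>\<^sub>M r\<in>{1..m+1}. \<pi>)"

lemma toll_map_copies_measurable:
  assumes f: "f \<in> borel_measurable \<pi>"
  shows "(\<lambda>p. toll_map m (snd p) (\<lambda>r. f (fst p r))) \<in> borel_measurable (copies m \<pi> \<Otimes>\<^sub>M limit_shares m)"
proof -
  have "(\<lambda>X. \<lambda>r\<in>{1..m+1}. f (X r)) \<in> copies m \<pi> \<rightarrow>\<^sub>M (\<Pi>\<^sub>M r\<in>{1..m+1}. borel)"
  proof (rule measurable_restrict)
    fix r assume "r \<in> {1..m+1}"
    from measurable_compose[OF measurable_component_singleton[OF this, of "\<lambda>_. \<pi>"] f]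
    show "(\<lambda>X. f (X r)) \<in> borel_measurable (copies m \<pi>)" .
  qed
  note meas = measurable_compose[OF measurable_fst this]
  have "(\<lambda>p. snd p) \<in> copies m \<pi> \<Otimes>\<^sub>M limit_shares m \<rightarrow>\<^sub>M (\<Pi>\<^sub>M r\<in>{1..m+1}. borel)"
    by (subst measurable_cong_sets[OF refl sets_dirichlet[symmetric]]) (rule measurable_snd)
  with meas have "(\<lambda>p. (\<lambda>r\<in>{1..m+1}. f (fst p r), snd p)) \<in> copies m \<pi> \<Otimes>\<^sub>M limit_shares m \<rightarrow>\<^sub>M (\<Pi>\<^sub>M r\<in>{1..m+1}. borel) \<Otimes>\<^sub>M (\<Pi>\<^sub>M r\<in>{1..m+1}. borel)"
    by (rule measurable_Pair)
  from measurable_compose[OF this toll_map_measurable]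
  have "(\<lambda>p. toll_map m (snd p) (\<lambda>r\<in>{1..m+1}. f (fst p r))) \<in> borel_measurable (copies m \<pi> \<Otimes>\<^sub>M limit_shares m)"
    by (simp only: fst_conv snd_conv)
  moreover have "toll_map m V (\<lambda>r\<in>{1..m+1}. X r) = toll_map m V X" for V X
    by (rule toll_map_cong) simp
  ultimately show ?thesis by simp
qed

lemma prob_space_copies: "prob_space \<pi> \<Longrightarrow> prob_space (copies m \<pi>)"
  by (intro prob_space_PiM)

text \<open>On the simplex the matrices and the toll are bounded, so the square is dominated by a
  multiple of the sum of the squared norms plus a constant.\<close>

lemma toll_map_square_integrable:
  fixes \<pi> :: "'a measure"
  assumes m: "m \<ge> 1" and \<pi>: "prob_space \<pi>" and f: "f \<in> borel_measurable \<pi>" "integrable \<pi> (\<lambda>x. (norm (f x))\<^sup>2)"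
  shows "integrable (copies m \<pi> \<Otimes>\<^sub>M limit_shares m) (\<lambda>p. (norm (toll_map m (snd p) (\<lambda>r. f (fst p r))))\<^sup>2)"
proof -
  let ?P = "copies m \<pi>" and ?D = "limit_shares m"
  interpret \<pi>: prob_space \<pi> by (rule \<pi>)
  interpret D: prob_space ?D by (rule prob_space_limit_shares[OF m])
  interpret P: prob_space ?P by (rule prob_space_copies[OF \<pi>])
  interpret PD: pair_prob_space ?P ?D ..
  obtain B where B: "B \<ge> 0" "\<And>V. V \<in> simplex_functions m \<Longrightarrow> norm (b_vec m V) \<le> B" using b_vec_bounded by blast
  let ?C = "2 * (real m + 2)\<^sup>2 * real (m + 1)"
  have sum: "integrable (?P \<Otimes>\<^sub>M ?D) (\<lambda>p. (norm (f (fst p r)))\<^sup>2)" if r: "r \<in> {1..m+1}" for r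
  proof -
    have "integrable ?P (\<lambda>X. (norm (f (X r)))\<^sup>2)"
      using \<pi>.PiM_component_integral(2)[OF _ r, of "\<lambda>x. (norm (f x))\<^sup>2"] f by simp
    moreover have "distr (?P \<Otimes>\<^sub>M ?D) ?P fst = ?P" by (rule D.distr_pair_fst)
    ultimately show ?thesis
      using integrable_distr_eq[of fst "?P \<Otimes>\<^sub>M ?D" ?P "\<lambda>X. (norm (f (X r)))\<^sup>2"] by (metis borel_measurable_integrable measurable_fst)
  qed
  show ?thesis
  proof (rule Bochner_Integration.integrable_bound)
    show "integrable (?P \<Otimes>\<^sub>M ?D) (\<lambda>p. ?C * (\<Sum>r=1..m+1. (norm (f (fst p r)))\<^sup>2) + 2 * B\<^sup>2)"
      by (intro Bochner_Integration.integrable_add integrable_mult_right Bochner_Integration.integrable_sum sum PD.P.integrable_const)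
    have "AE p in ?P \<Otimes>\<^sub>M ?D. snd p \<in> simplex_functions m"
    proof -
      have "AE V in distr (?P \<Otimes>\<^sub>M ?D) ?D snd. V \<in> simplex_functions m"
        unfolding P.distr_pair_snd[OF D.sigma_finite_measure_axioms]
        using AE_limit_shares[of m] by eventually_elim blast
      then show ?thesis by (rule AE_distrD[OF measurable_snd])
    qed
    then show "AE p in ?P \<Otimes>\<^sub>M ?D. norm ((norm (toll_map m (snd p) (\<lambda>r. f (fst p r))))\<^sup>2)
       \<le> norm (?C * (\<Sum>r=1..m+1. (norm (f (fst p r)))\<^sup>2) + 2 * B\<^sup>2)"
    proof eventually_elim
      fix p :: "(nat \<Rightarrow> 'a) \<times> (nat \<Rightarrow> real)" assume V: "snd p \<in> simplex_functions m"
      let ?S = "\<Sum>r=1..m+1. norm (f (fst p r))" and ?Q = "\<Sum>r=1..m+1. (norm (f (fst p r)))\<^sup>2"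
      have "norm (toll_map m (snd p) (\<lambda>r. f (fst p r))) \<le> (real m + 2) * (\<Sum>r=1..m+1. snd p r * norm (f (fst p r))) + norm (b_vec m (snd p))"
        by (rule toll_map_norm[OF V])
      also have "\<dots> \<le> (real m + 2) * ?S + B"
        using simplex_functions_le_1[OF V] V
        by (intro add_mono mult_left_mono sum_mono B mult_left_le_one_le) (auto simp: simplex_functions_def)
      finally have "(norm (toll_map m (snd p) (\<lambda>r. f (fst p r))))\<^sup>2 \<le> ((real m + 2) * ?S + B)\<^sup>2"
        by (intro power_mono) auto
      also have "\<dots> \<le> 2 * ((real m + 2) * ?S)\<^sup>2 + 2 * B\<^sup>2"
        using sum_squares_bound[of "(real m + 2) * ?S" B] by (simp only: power2_sum)
      also have "\<dots> \<le> 2 * ((real m + 2)\<^sup>2 * (real (m + 1) * ?Q)) + 2 * B\<^sup>2"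
      proof -
        have "?S\<^sup>2 \<le> real (m + 1) * ?Q"
          using sum_squared_le_sum_of_squares[of "\<lambda>r. norm (f (fst p r))" "{1..m+1}"]
          by (simp only: card_atLeastAtMost mult.commute) simp
        then show ?thesis unfolding power_mult_distrib by (intro add_right_mono mult_left_mono) auto
      qed
      also have "\<dots> = ?C * ?Q + 2 * B\<^sup>2" by (simp only: mult.assoc)
      finally show "norm ((norm (toll_map m (snd p) (\<lambda>r. f (fst p r))))\<^sup>2) \<le> norm (?C * ?Q + 2 * B\<^sup>2)"
        unfolding real_norm_def abs_power2 by (rule order_trans[OF _ abs_ge_self])
    qed
  qed (use toll_map_copies_measurable[OF f(1)] in auto)
qed

section \<open>Mean square contraction\<close>

text \<open>Young's inequality with a free parameter: a small \<eta> keeps the coefficient of the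
  first coordinate near one, and the large coefficient of the second is later absorbed by its
  weight.\<close>

lemma sq_add_le:
  fixes a b \<eta> :: real
  assumes "\<eta> > 0"
  shows "(a + b)\<^sup>2 \<le> (1 + \<eta>) * a\<^sup>2 + (1 + 1 / \<eta>) * b\<^sup>2"
proof -
  have "0 \<le> (\<eta> * a - b)\<^sup>2 / \<eta>" using assms by simp
  also have "\<dots> = \<eta> * a\<^sup>2 - 2 * a * b + b\<^sup>2 / \<eta>"
    using assms by (simp add: field_simps power2_eq_square)
  finally show ?thesis by (simp add: power2_sum algebra_simps)
qed

definition contraction_factor :: "nat \<Rightarrow> real" where
  "contraction_factor m = (\<integral>V. (\<Sum>r=1..m+1. (V r)\<^sup>2) \<partial>limit_shares m)"

lemma integrable_square_shares:
  "m \<ge> 1 \<Longrightarrow> integrable (limit_shares m) (\<lambda>V. \<Sum>r=1..m+1. (V r)\<^sup>2)"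
  by (rule integrable_limit_shares)
     (assumption, intro continuous_intros continuous_on_coordinate,
      intro borel_measurable_sum borel_measurable_power measurable_component_singleton)

text \<open>For m at least 1 there are at least two strictly positive shares, so each is below one
  and the squares sum to less than one almost surely.\<close>

lemma contraction_factor_less_1:
  assumes m: "m \<ge> 1"
  shows "0 \<le> contraction_factor m" "contraction_factor m < 1"
proof -
  interpret D: prob_space "limit_shares m" by (rule prob_space_limit_shares[OF m])
  show "0 \<le> contraction_factor m"
    unfolding contraction_factor_def by (intro Bochner_Integration.integral_nonneg sum_nonneg) simp
  have "(\<integral>V. (\<Sum>r=1..m+1. (V r)\<^sup>2) \<partial>limit_shares m) < (\<integral>V. 1 \<partial>limit_shares m)"
  proof (rule D.integral_less_AE_space[OF integrable_square_shares[OF m]])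
    show "AE V in limit_shares m. (\<Sum>r=1..m+1. (V r)\<^sup>2) < 1"
      using AE_limit_shares[of m]
    proof eventually_elim
      fix V assume V: "V \<in> simplex_functions m \<and> (\<forall>r\<in>{1..m+1}. 0 < V r)"
      have sum: "(\<Sum>r=1..m+1. V r) = 1" using V by (simp add: simplex_functions_def)
      have less: "V r < 1" if r: "r \<in> {1..m+1}" for r
      proof -
        \<comment> \<open>Any second index different from \<open>r\<close>; its positive share keeps
          \<open>V r\<close> away from one.\<close>
        define s where "s = (if r = 1 then 2 else 1 :: nat)"
        have s: "s \<in> {1..m+1}" "s \<noteq> r" using m by (auto simp: s_def)
        have "V r + V s = (\<Sum>i\<in>{r, s}. V i)" using s by simp
        also have "\<dots> \<le> (\<Sum>r=1..m+1. V r)"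
          using r s V by (intro sum_mono2) (auto intro: less_imp_le)
        finally show ?thesis using sum V s by force
      qed
      have "(\<Sum>r=1..m+1. (V r)\<^sup>2) < (\<Sum>r=1..m+1. V r)"
      proof (rule sum_strict_mono)
        fix r assume r: "r \<in> {1..m+1}"
        then have "0 < V r" using V by blast
        then show "(V r)\<^sup>2 < V r" using less[OF r] by (simp add: power2_eq_square)
      qed auto
      then show "(\<Sum>r=1..m+1. (V r)\<^sup>2) < 1" using sum by simp
    qed
  qed (simp_all add: D.emeasure_space_1)
  then show "contraction_factor m < 1" by (simp add: contraction_factor_def D.prob_space)
qed

text \<open>The map is a strict contraction only after the second coordinate is given a large weight \<open>L\<close>:
  the matrices \<open>A_mat\<close> are upper triangular with a possibly large off-diagonal entry.\<close>

lemma toll_map_contraction: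
  assumes m: "m \<ge> 1" and \<pi>: "prob_space \<pi>" and d: "d \<in> borel_measurable \<pi>"
    and sq: "\<And>i. integrable \<pi> (\<lambda>x. (d x $ i)\<^sup>2)" and int: "\<And>i. integrable \<pi> (\<lambda>x. d x $ i)"
    and mean: "\<And>i. (\<integral>x. d x $ i \<partial>\<pi>) = 0" and \<eta>: "\<eta> > 0" and L: "L \<ge> 0"
  defines "\<kappa> \<equiv> contraction_factor m"
    and "\<Delta> \<equiv> \<lambda>p. \<Sum>r=1..m+1. A_mat m (snd p) r *v d (fst p r)"
  shows "(\<integral>\<^sup>+p. ennreal ((\<Delta> p $ 1)\<^sup>2 + L * (\<Delta> p $ 2)\<^sup>2) \<partial>(copies m \<pi> \<Otimes>\<^sub>M limit_shares m))
    \<le> ennreal ((1 + \<eta>) * \<kappa> * (\<integral>x. (d x $ 1)\<^sup>2 \<partial>\<pi>) + ((1 + 1 / \<eta>) * (real m)\<^sup>2 + L) * \<kappa> * (\<integral>x. (d x $ 2)\<^sup>2 \<partial>\<pi>))"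
proof -
  let ?P = "copies m \<pi>" and ?D = "limit_shares m" and ?R = "{1..m+1}"
  interpret \<pi>: prob_space \<pi> by (rule \<pi>)
  interpret D: prob_space ?D by (rule prob_space_limit_shares[OF m])
  interpret P: prob_space ?P by (rule prob_space_copies[OF \<pi>])
  interpret PD: pair_prob_space ?P ?D ..
  define c1 where "c1 = (\<integral>x. (d x $ 1)\<^sup>2 \<partial>\<pi>)"
  define c2 where "c2 = (\<integral>x. (d x $ 2)\<^sup>2 \<partial>\<pi>)"
  define K where "K = (1 + 1 / \<eta>) * (real m)\<^sup>2"
  define C where "C = (1 + \<eta>) * c1 + (K + L) * c2"
  have c: "c1 \<ge> 0" "c2 \<ge> 0" by (simp_all add: c1_def c2_def)
  have K: "K \<ge> 0" using \<eta> by (simp add: K_def)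
  have C: "C \<ge> 0" using c K L \<eta> by (simp add: C_def)
  note dm [measurable] = borel_measurable_nth_2[OF d]
  have \<Delta>: "\<Delta> p $ 1 = (\<Sum>r\<in>?R. (snd p r)\<^sup>2 * d (fst p r) $ 1 + real m * snd p r * (1 - snd p r) * d (fst p r) $ 2)"
    "\<Delta> p $ 2 = (\<Sum>r\<in>?R. snd p r * d (fst p r) $ 2)" for p
    by (simp_all only: \<Delta>_def A_mat_mult sum_component vector_2)
  have comp: "(\<lambda>p. snd p r) \<in> borel_measurable (?P \<Otimes>\<^sub>M ?D)" "(\<lambda>p. d (fst p r) $ i) \<in> borel_measurable (?P \<Otimes>\<^sub>M ?D)" if r: "r \<in> ?R" for r i
  proof -
    have "(\<lambda>V. V r) \<in> borel_measurable ?D"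
      by (subst measurable_cong_sets[OF sets_dirichlet refl]) (rule measurable_component_singleton[OF r])
    from measurable_compose[OF measurable_snd this] show "(\<lambda>p. snd p r) \<in> borel_measurable (?P \<Otimes>\<^sub>M ?D)" .
    show "(\<lambda>p. d (fst p r) $ i) \<in> borel_measurable (?P \<Otimes>\<^sub>M ?D)"
      using measurable_compose[OF measurable_fst measurable_compose[OF measurable_component_singleton[OF r, of "\<lambda>_. \<pi>"] dm[of i]]] by simp
  qed
  have meas: "(\<lambda>p. ennreal ((\<Delta> p $ 1)\<^sup>2 + L * (\<Delta> p $ 2)\<^sup>2)) \<in> borel_measurable (?P \<Otimes>\<^sub>M ?D)"
    unfolding \<Delta> by (intro measurable_compose[OF _ measurable_ennreal] borel_measurable_add borel_measurable_sum borel_measurable_times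
          borel_measurable_diff borel_measurable_power borel_measurable_const comp)
  \<comment> \<open>For fixed shares the difference is a sum of independent centred vectors, so only
    the sum of the component variances remains.\<close>
  have inner: "(\<integral>\<^sup>+X. ennreal ((\<Delta> (X, V) $ 1)\<^sup>2 + L * (\<Delta> (X, V) $ 2)\<^sup>2) \<partial>?P) \<le> ennreal (C * (\<Sum>r\<in>?R. (V r)\<^sup>2))"
    if V: "V \<in> simplex_functions m" for V
  proof -
    define g1 where "g1 r x = (V r)\<^sup>2 * d x $ 1 + real m * V r * (1 - V r) * d x $ 2" for r x
    define g2 where "g2 r x = V r * d x $ 2" for r x
    have gm: "g1 r \<in> borel_measurable \<pi>" "g2 r \<in> borel_measurable \<pi>" for r
      unfolding g1_def g2_def by measurable
    \<comment> \<open>One factor \<open>V r\<close> is pulled out and the remaining factors are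
      bounded by one, so both coordinates scale with the square of the share.\<close>
    have bound1: "(g1 r x)\<^sup>2 \<le> (V r)\<^sup>2 * ((1 + \<eta>) * (d x $ 1)\<^sup>2 + K * (d x $ 2)\<^sup>2)" if r: "r \<in> ?R" for r x
    proof -
      have v: "0 \<le> V r" "V r \<le> 1" using V r simplex_functions_le_1[OF V] by (auto simp: simplex_functions_def)
      have v2: "(V r)\<^sup>2 \<le> 1" "(1 - V r)\<^sup>2 \<le> 1" using v by (auto intro: power_le_one)
      have "(V r * d x $ 1 + real m * (1 - V r) * d x $ 2)\<^sup>2
        \<le> (1 + \<eta>) * (V r * d x $ 1)\<^sup>2 + (1 + 1 / \<eta>) * (real m * (1 - V r) * d x $ 2)\<^sup>2" by (rule sq_add_le[OF \<eta>])
      also have "\<dots> = (V r)\<^sup>2 * ((1 + \<eta>) * (d x $ 1)\<^sup>2) + (1 - V r)\<^sup>2 * (K * (d x $ 2)\<^sup>2)"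
        by (simp add: K_def power_mult_distrib mult_ac)
      also have "\<dots> \<le> 1 * ((1 + \<eta>) * (d x $ 1)\<^sup>2) + 1 * (K * (d x $ 2)\<^sup>2)"
        using \<eta> K v2 by (intro add_mono mult_right_mono) auto
      finally have "(V r * d x $ 1 + real m * (1 - V r) * d x $ 2)\<^sup>2 \<le> (1 + \<eta>) * (d x $ 1)\<^sup>2 + K * (d x $ 2)\<^sup>2" by simp
      from mult_left_mono[OF this zero_le_power2[of "V r"]] show ?thesis
        unfolding g1_def power_mult_distrib[symmetric] by (simp add: power2_eq_square algebra_simps)
    qed
    have g1_0: "integrable \<pi> (g1 r)" "integral\<^sup>L \<pi> (g1 r) = 0" and g2_0: "integrable \<pi> (g2 r)" "integral\<^sup>L \<pi> (g2 r) = 0" for r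
      unfolding g1_def g2_def using int mean by auto
    have dom: "integrable \<pi> (\<lambda>x. (V r)\<^sup>2 * ((1 + \<eta>) * (d x $ 1)\<^sup>2 + K * (d x $ 2)\<^sup>2))" for r
      using sq by auto
    have g1sq: "integrable \<pi> (\<lambda>x. (g1 r x)\<^sup>2)" if r: "r \<in> ?R" for r
    proof (rule Bochner_Integration.integrable_bound[OF dom[of r]])
      show "AE x in \<pi>. norm ((g1 r x)\<^sup>2) \<le> norm ((V r)\<^sup>2 * ((1 + \<eta>) * (d x $ 1)\<^sup>2 + K * (d x $ 2)\<^sup>2))"
        using bound1[OF r] by (intro AE_I2) (simp only: real_norm_def abs_power2, meson abs_ge_self order_trans)
    qed (use gm in measurable)
    have g2sq: "integrable \<pi> (\<lambda>x. (g2 r x)\<^sup>2)" for r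
      unfolding g2_def power_mult_distrib using sq by auto
    note S1 = \<pi>.PiM_sum_square[of ?R g1, OF _ gm(1) g1sq g1_0]
    note S2 = \<pi>.PiM_sum_square[of ?R g2, OF _ gm(2) g2sq g2_0]
    have le1: "(\<integral>x. (g1 r x)\<^sup>2 \<partial>\<pi>) \<le> (V r)\<^sup>2 * ((1 + \<eta>) * c1 + K * c2)" if r: "r \<in> ?R" for r
    proof -
      have "(\<integral>x. (g1 r x)\<^sup>2 \<partial>\<pi>) \<le> (\<integral>x. (V r)\<^sup>2 * ((1 + \<eta>) * (d x $ 1)\<^sup>2 + K * (d x $ 2)\<^sup>2) \<partial>\<pi>)"
        by (rule integral_mono[OF g1sq[OF r] dom bound1[OF r]])
      then show ?thesis using sq by (simp add: c1_def c2_def)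
    qed
    have eq2: "(\<integral>x. (g2 r x)\<^sup>2 \<partial>\<pi>) = (V r)\<^sup>2 * c2" for r
      by (simp add: g2_def power_mult_distrib c2_def)
    have \<Delta>g: "\<Delta> (X, V) $ 1 = (\<Sum>r\<in>?R. g1 r (X r))" "\<Delta> (X, V) $ 2 = (\<Sum>r\<in>?R. g2 r (X r))" for X
      by (simp_all only: \<Delta> fst_conv snd_conv g1_def g2_def)
    have "(\<integral>\<^sup>+X. ennreal ((\<Delta> (X, V) $ 1)\<^sup>2 + L * (\<Delta> (X, V) $ 2)\<^sup>2) \<partial>?P)
      = ennreal (\<integral>X. (\<Sum>r\<in>?R. g1 r (X r))\<^sup>2 + L * (\<Sum>r\<in>?R. g2 r (X r))\<^sup>2 \<partial>?P)"
      unfolding \<Delta>g using S1(1) S2(1) L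
      by (intro nn_integral_eq_integral Bochner_Integration.integrable_add integrable_mult_right AE_I2) auto
    also have "(\<integral>X. (\<Sum>r\<in>?R. g1 r (X r))\<^sup>2 + L * (\<Sum>r\<in>?R. g2 r (X r))\<^sup>2 \<partial>?P)
      = (\<Sum>r\<in>?R. \<integral>x. (g1 r x)\<^sup>2 \<partial>\<pi>) + L * (\<Sum>r\<in>?R. \<integral>x. (g2 r x)\<^sup>2 \<partial>\<pi>)"
      using S1 S2 by (subst Bochner_Integration.integral_add) auto
    also have "\<dots> \<le> (\<Sum>r\<in>?R. (V r)\<^sup>2 * ((1 + \<eta>) * c1 + K * c2)) + L * (\<Sum>r\<in>?R. (V r)\<^sup>2 * c2)"
      unfolding eq2 by (intro add_right_mono sum_mono le1)
    also have "\<dots> = C * (\<Sum>r\<in>?R. (V r)\<^sup>2)"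
      unfolding C_def sum_distrib_right[symmetric] by (simp only: algebra_simps)
    finally show ?thesis using ennreal_leI by blast
  qed
  have "(\<integral>\<^sup>+p. ennreal ((\<Delta> p $ 1)\<^sup>2 + L * (\<Delta> p $ 2)\<^sup>2) \<partial>(?P \<Otimes>\<^sub>M ?D))
    = (\<integral>\<^sup>+V. (\<integral>\<^sup>+X. ennreal ((\<Delta> (X, V) $ 1)\<^sup>2 + L * (\<Delta> (X, V) $ 2)\<^sup>2) \<partial>?P) \<partial>?D)"
    by (rule PD.nn_integral_snd[symmetric, OF meas[unfolded case_prod_beta]])
  also have "\<dots> \<le> (\<integral>\<^sup>+V. ennreal (C * (\<Sum>r\<in>?R. (V r)\<^sup>2)) \<partial>?D)"
    using AE_limit_shares[of m] by (intro nn_integral_mono_AE, eventually_elim) (blast intro: inner)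
  also have "\<dots> = ennreal (C * \<kappa>)"
    unfolding \<kappa>_def contraction_factor_def
    using integrable_square_shares[OF m] C
    by (subst nn_integral_eq_integral) (auto intro!: AE_I2 mult_nonneg_nonneg sum_nonneg simp del: sum.cl_ivl_Suc)
  also have "C * \<kappa> = (1 + \<eta>) * \<kappa> * c1 + (K + L) * \<kappa> * c2" by (simp add: C_def algebra_simps)
  finally show ?thesis unfolding c1_def c2_def K_def .
qed

text \<open>Linear growth of the test function is allowed, because coordinates, which are unbounded,
  will be used to compute the mean of the toll.\<close>

lemma toll_map_expectation:
  fixes \<pi> :: "'a measure"
  assumes m: "m \<ge> 1" and \<pi>: "prob_space \<pi>" and f: "f \<in> borel_measurable \<pi>" "integrable \<pi> (\<lambda>x. (norm (f x))\<^sup>2)"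
    and h: "h \<in> borel_measurable borel" "L \<ge> 0" "\<And>x. \<bar>h x\<bar> \<le> C + L * norm x"
  shows "integrable (copies m \<pi> \<Otimes>\<^sub>M limit_shares m) (\<lambda>p. h (toll_map m (snd p) (\<lambda>r. f (fst p r))))"
    and "(\<integral>x. h x \<partial>T_map m (distr \<pi> borel f)) = (\<integral>V. (\<integral>X. h (toll_map m V (\<lambda>r. f (X r))) \<partial>copies m \<pi>) \<partial>limit_shares m)"
proof -
  let ?P = "copies m \<pi>" and ?D = "limit_shares m"
  interpret \<pi>: prob_space \<pi> by (rule \<pi>)
  interpret D: prob_space ?D by (rule prob_space_limit_shares[OF m])
  interpret P: prob_space ?P by (rule prob_space_copies[OF \<pi>])
  interpret PD: pair_prob_space ?P ?D ..
  note tm = toll_map_copies_measurable[OF f(1), of m]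
  show int: "integrable (?P \<Otimes>\<^sub>M ?D) (\<lambda>p. h (toll_map m (snd p) (\<lambda>r. f (fst p r))))"
  proof (rule Bochner_Integration.integrable_bound)
    show "integrable (?P \<Otimes>\<^sub>M ?D) (\<lambda>p. (C + L) + L * (norm (toll_map m (snd p) (\<lambda>r. f (fst p r))))\<^sup>2)"
      by (intro Bochner_Integration.integrable_add integrable_mult_right PD.P.integrable_const toll_map_square_integrable[OF m \<pi> f])
    show "AE p in ?P \<Otimes>\<^sub>M ?D. norm (h (toll_map m (snd p) (\<lambda>r. f (fst p r))))
       \<le> norm ((C + L) + L * (norm (toll_map m (snd p) (\<lambda>r. f (fst p r))))\<^sup>2)"
    proof (rule AE_I2)
      fix p :: "(nat \<Rightarrow> 'a) \<times> (nat \<Rightarrow> real)"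
      let ?x = "toll_map m (snd p) (\<lambda>r. f (fst p r))"
      have "norm ?x \<le> 1 + (norm ?x)\<^sup>2"
        by (rule le_one_plus_square)
      then have "C + L * norm ?x \<le> C + L * (1 + (norm ?x)\<^sup>2)" using h(2) by (intro add_left_mono mult_left_mono)
      then show "norm (h ?x) \<le> norm ((C + L) + L * (norm ?x)\<^sup>2)"
        using h(3)[of ?x] by (simp add: algebra_simps)
    qed
  qed (use measurable_compose[OF tm h(1)] in auto)
  have "(\<integral>x. h x \<partial>T_map m (distr \<pi> borel f)) = (\<integral>p. h (toll_map m (snd p) (\<lambda>r. f (fst p r))) \<partial>(?P \<Otimes>\<^sub>M ?D))"
    unfolding T_map_distr[OF m \<pi> f(1)] by (rule integral_distr[OF tm h(1)])
  also have "\<dots> = (\<integral>V. (\<integral>X. h (toll_map m V (\<lambda>r. f (X r))) \<partial>?P) \<partial>?D)"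
    using PD.integral_snd[of "\<lambda>X V. h (toll_map m V (\<lambda>r. f (X r)))"] int by (simp add: case_prod_unfold)
  finally show "(\<integral>x. h x \<partial>T_map m (distr \<pi> borel f)) = (\<integral>V. (\<integral>X. h (toll_map m V (\<lambda>r. f (X r))) \<partial>?P) \<partial>?D)" .
qed

lemma toll_map_conditional_mean:
  assumes \<pi>: "prob_space \<pi>" and f: "\<And>i. integrable \<pi> (\<lambda>x. f x $ i)" and mean: "\<And>i. (\<integral>x. f x $ i \<partial>\<pi>) = 0"
  shows "(\<integral>X. toll_map m V (\<lambda>r. f (X r)) $ i \<partial>copies m \<pi>) = b_vec m V $ i"
proof -
  interpret \<pi>: prob_space \<pi> by (rule \<pi>)
  interpret P: prob_space "copies m \<pi>" by (rule prob_space_copies[OF \<pi>])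
  have c: "has_bochner_integral (copies m \<pi>) (\<lambda>X. f (X r) $ i) 0" if "r \<in> {1..m+1}" for r i
  proof -
    have "(\<lambda>x. f x $ i) \<in> borel_measurable \<pi>" using f by (rule borel_measurable_integrable)
    note comp = \<pi>.PiM_component_integral[OF finite_atLeastAtMost that this]
    show ?thesis unfolding has_bochner_integral_iff using comp(2)[OF f] comp(1) mean by (simp only:)
  qed
  have k: "has_bochner_integral (copies m \<pi>) (\<lambda>X. k) k" for k :: real
    using P.integrable_const[of k] P.prob_space by (simp add: has_bochner_integral_iff)
  have lin: "(\<integral>X. (\<Sum>r=1..m+1. a r * f (X r) $ i + c' r * f (X r) $ j) + k \<partial>copies m \<pi>) = k" for a c' i j k
  proof -
    have "has_bochner_integral (copies m \<pi>) (\<lambda>X. (\<Sum>r=1..m+1. a r * f (X r) $ i + c' r * f (X r) $ j) + k)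
      ((\<Sum>r=1..m+1. a r * 0 + c' r * 0) + k)"
      by (intro has_bochner_integral_add has_bochner_integral_sum has_bochner_integral_mult_right c k)
    then show ?thesis by (simp add: has_bochner_integral_iff)
  qed
  have "(\<integral>X. toll_map m V (\<lambda>r. f (X r)) $ 1 \<partial>copies m \<pi>) = b_vec m V $ 1"
    unfolding toll_map_nth by (rule lin)
  moreover have "(\<integral>X. toll_map m V (\<lambda>r. f (X r)) $ 2 \<partial>copies m \<pi>) = b_vec m V $ 2"
    unfolding toll_map_nth using lin[of V 2 "\<lambda>_. 0" 2] by simp
  ultimately show ?thesis using exhaust_2[of i] by metis
qed

lemma distr_self_M02: "\<nu> \<in> M02 \<Longrightarrow> distr \<nu> borel (\<lambda>x. x) = \<nu>"
  using distr_id2[of borel \<nu>] M02_D(2) by auto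

text \<open>That the toll is centred is a hypothesis here; it is discharged by
  \<open>b_vec_mean\<close>, from the tree model, without evaluating Dirichlet integrals of V ln
  V.\<close>

lemma T_map_M02:
  assumes m: "m \<ge> 1" and b: "\<And>i. (\<integral>V. b_vec m V $ i \<partial>limit_shares m) = 0" and \<nu>: "\<nu> \<in> M02"
  shows "T_map m \<nu> \<in> M02"
proof -
  note D = M02_D[OF \<nu>]
  have id: "(\<lambda>x. x) \<in> borel_measurable \<nu>" by (simp add: measurable_cong_sets[OF D(2) refl])
  interpret Dr: prob_space "limit_shares m" by (rule prob_space_limit_shares[OF m])
  interpret P: prob_space "copies m \<nu>" by (rule prob_space_copies[OF D(1)])
  interpret PD: pair_prob_space "copies m \<nu>" "limit_shares m" ..
  have T: "T_map m \<nu> = distr (copies m \<nu> \<Otimes>\<^sub>M limit_shares m) borel (\<lambda>p. toll_map m (snd p) (fst p))"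
    by (rule T_map_eq)
  show ?thesis unfolding T
  proof (rule M02_I[OF PD.P.prob_space_axioms])
    show "(\<lambda>p. toll_map m (snd p) (fst p)) \<in> borel_measurable (copies m \<nu> \<Otimes>\<^sub>M limit_shares m)"
      using toll_map_copies_measurable[OF id, of m] by simp
    then have meas: "(\<lambda>p. toll_map m (snd p) (fst p)) \<in> copies m \<nu> \<Otimes>\<^sub>M limit_shares m \<rightarrow>\<^sub>M borel" .
    show "integrable (copies m \<nu> \<Otimes>\<^sub>M limit_shares m) (\<lambda>p. (norm (toll_map m (snd p) (fst p)))\<^sup>2)"
      using toll_map_square_integrable[OF m D(1) id D(3)] by simp
    fix i
    have h: "(\<lambda>x :: real^2. x $ i) \<in> borel_measurable borel" by (rule borel_measurable_nth_2) simp
    have "(\<integral>p. toll_map m (snd p) (fst p) $ i \<partial>(copies m \<nu> \<Otimes>\<^sub>M limit_shares m)) = (\<integral>x. x $ i \<partial>T_map m (distr \<nu> borel (\<lambda>x. x)))"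
      unfolding distr_self_M02[OF \<nu>] T by (rule integral_distr[OF meas h, symmetric])
    also have "\<dots> = (\<integral>V. (\<integral>X. toll_map m V (\<lambda>r. X r) $ i \<partial>copies m \<nu>) \<partial>limit_shares m)"
      by (rule toll_map_expectation(2)[OF m D(1) id D(3) h, where C=0 and L=1]) (use component_le_norm_cart in auto)
    also have "\<dots> = (\<integral>V. b_vec m V $ i \<partial>limit_shares m)"
      by (subst toll_map_conditional_mean[OF D(1) D(5,6)]) simp
    finally show "(\<integral>p. toll_map m (snd p) (fst p) $ i \<partial>(copies m \<nu> \<Otimes>\<^sub>M limit_shares m)) = 0" by (simp add: b)
  qed
qed

section \<open>Couplings and uniqueness of the fixed point\<close>

lemma couplings_D:
  assumes "\<pi> \<in> couplings \<mu> \<nu>"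
  shows "prob_space \<pi>" "fst \<in> borel_measurable \<pi>" "snd \<in> borel_measurable \<pi>"
    "distr \<pi> borel fst = \<mu>" "distr \<pi> borel snd = \<nu>"
  using assms by (auto simp: couplings_def measurable_cong_sets[of \<pi> "borel \<Otimes>\<^sub>M borel" borel borel])

lemma couplings_I:
  assumes "prob_space M" and X: "X \<in> borel_measurable M" and Y: "Y \<in> borel_measurable M"
  shows "distr M (borel \<Otimes>\<^sub>M borel) (\<lambda>x. (X x, Y x)) \<in> couplings (distr M borel X) (distr M borel Y)"
proof -
  interpret prob_space M by fact
  have p: "(\<lambda>x. (X x, Y x)) \<in> M \<rightarrow>\<^sub>M borel \<Otimes>\<^sub>M borel" using X Y by (rule measurable_Pair)
  show ?thesis unfolding couplings_def using prob_space_distr[OF p]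
    by (auto simp: distr_distr[OF measurable_fst p] distr_distr[OF measurable_snd p] comp_def)
qed

definition coupling_cost :: "real \<Rightarrow> ((real^2) \<times> (real^2)) measure \<Rightarrow> real" where
  "coupling_cost L \<pi> = (\<integral>p. ((fst p - snd p) $ 1)\<^sup>2 \<partial>\<pi>) + L * (\<integral>p. ((fst p - snd p) $ 2)\<^sup>2 \<partial>\<pi>)"

lemma coupling_difference:
  assumes \<mu>: "\<mu> \<in> M02" and \<nu>: "\<nu> \<in> M02" and \<pi>: "\<pi> \<in> couplings \<mu> \<nu>"
  shows "(\<lambda>p. fst p - snd p) \<in> borel_measurable \<pi>"
    and "integrable \<pi> (\<lambda>p. ((fst p - snd p) $ i)\<^sup>2)"
    and "integrable \<pi> (\<lambda>p. (fst p - snd p) $ i)" and "(\<integral>p. (fst p - snd p) $ i \<partial>\<pi>) = 0"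
proof -
  note C = couplings_D[OF \<pi>] and M = M02_D[OF \<mu>, unfolded C(4)[symmetric]] and N = M02_D[OF \<nu>, unfolded C(5)[symmetric]]
  have nth: "(\<lambda>x :: real^2. x $ i) \<in> borel_measurable borel" by (rule borel_measurable_nth_2) simp
  then have nth2: "(\<lambda>x :: real^2. (x $ i)\<^sup>2) \<in> borel_measurable borel" by simp
  show "(\<lambda>p. fst p - snd p) \<in> borel_measurable \<pi>" using C by (intro borel_measurable_diff)
  have "integrable \<pi> (\<lambda>p. (fst p $ i)\<^sup>2)" "integrable \<pi> (\<lambda>p. (snd p $ i)\<^sup>2)"
    using M(7)[of i] N(7)[of i] by (simp_all add: integrable_distr_eq[OF C(2) nth2] integrable_distr_eq[OF C(3) nth2])
  then show "integrable \<pi> (\<lambda>p. ((fst p - snd p) $ i)\<^sup>2)"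
    using C borel_measurable_nth_2 unfolding vector_minus_component by (intro integrable_square_diff) auto
  have i: "integrable \<pi> (\<lambda>p. fst p $ i)" "integrable \<pi> (\<lambda>p. snd p $ i)"
    using M(5)[of i] N(5)[of i] by (simp_all add: integrable_distr_eq[OF C(2) nth] integrable_distr_eq[OF C(3) nth])
  then show "integrable \<pi> (\<lambda>p. (fst p - snd p) $ i)" by simp
  show "(\<integral>p. (fst p - snd p) $ i \<partial>\<pi>) = 0"
    using i M(6)[of i] N(6)[of i] by (simp add: integral_distr[OF C(2) nth] integral_distr[OF C(3) nth])
qed

text \<open>The map acts on couplings: independent copies of the coupled pair are inserted with
  common shares. The toll cancels in the difference, and the marginals are again the two fixed
  points. The two inequalities for \<rho> compare the contraction estimate with the cost coordinate
  by coordinate.\<close>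

lemma coupling_step:
  assumes m: "m \<ge> 1" and \<mu>: "\<mu> \<in> M02" and \<nu>: "\<nu> \<in> M02" and fp: "T_map m \<mu> = \<mu>" "T_map m \<nu> = \<nu>"
    and \<pi>: "\<pi> \<in> couplings \<mu> \<nu>" and \<eta>: "\<eta> > 0" and L: "L \<ge> 0" and \<rho>: "(1 + \<eta>) * contraction_factor m \<le> \<rho>"
      "((1 + 1 / \<eta>) * (real m)\<^sup>2 + L) * contraction_factor m \<le> \<rho> * L"
  shows "\<exists>\<pi>'\<in>couplings \<mu> \<nu>. coupling_cost L \<pi>' \<le> \<rho> * coupling_cost L \<pi>"
proof -
  note C = couplings_D[OF \<pi>] and d = coupling_difference[OF \<mu> \<nu> \<pi>]
  let ?Q = "copies m \<pi> \<Otimes>\<^sub>M limit_shares m"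
  let ?X = "\<lambda>p. toll_map m (snd p) (\<lambda>r. fst (fst p r))" and ?Y = "\<lambda>p. toll_map m (snd p) (\<lambda>r. snd (fst p r))"
  let ?\<Delta> = "\<lambda>p. \<Sum>r=1..m+1. A_mat m (snd p) r *v (fst (fst p r) - snd (fst p r))"
  interpret D: prob_space "limit_shares m" by (rule prob_space_limit_shares[OF m])
  interpret P: prob_space "copies m \<pi>" by (rule prob_space_copies[OF C(1)])
  interpret PD: pair_prob_space "copies m \<pi>" "limit_shares m" ..
  note X = toll_map_copies_measurable[OF C(2), of m] and Y = toll_map_copies_measurable[OF C(3), of m]
  define \<pi>' where "\<pi>' = distr ?Q (borel \<Otimes>\<^sub>M borel) (\<lambda>p. (?X p, ?Y p))"
  have "\<pi>' \<in> couplings (distr ?Q borel ?X) (distr ?Q borel ?Y)"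
    unfolding \<pi>'_def by (rule couplings_I[OF PD.P.prob_space_axioms X Y])
  moreover have "distr ?Q borel ?X = \<mu>" "distr ?Q borel ?Y = \<nu>"
    using T_map_distr[OF m C(1,2)] T_map_distr[OF m C(1,3)] C(4,5) fp by simp_all
  ultimately have \<pi>': "\<pi>' \<in> couplings \<mu> \<nu>" by simp
  note d' = coupling_difference[OF \<mu> \<nu> \<pi>']
  have diff: "?X p - ?Y p = ?\<Delta> p" for p
    by (simp only: toll_map_def matrix_vector_mult_diff_distrib sum_subtractf) simp
  have pm: "(\<lambda>p. (?X p, ?Y p)) \<in> ?Q \<rightarrow>\<^sub>M borel \<Otimes>\<^sub>M borel" using X Y by (rule measurable_Pair)
  have bm: "(\<lambda>p. ((fst p - snd p) $ i)\<^sup>2) \<in> borel_measurable (borel \<Otimes>\<^sub>M borel :: ((real^2) \<times> (real^2)) measure)" for i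
    by (intro borel_measurable_power borel_measurable_nth_2 borel_measurable_diff measurable_fst measurable_snd)
  have F: "(\<lambda>p. ennreal (((fst p - snd p) $ 1)\<^sup>2 + L * ((fst p - snd p) $ 2)\<^sup>2))
      \<in> borel_measurable (borel \<Otimes>\<^sub>M borel :: ((real^2) \<times> (real^2)) measure)"
    by (intro measurable_compose[OF _ measurable_ennreal] borel_measurable_add borel_measurable_times borel_measurable_const bm)
  have "ennreal (coupling_cost L \<pi>') = (\<integral>\<^sup>+p. ennreal (((fst p - snd p) $ 1)\<^sup>2 + L * ((fst p - snd p) $ 2)\<^sup>2) \<partial>\<pi>')"
    unfolding coupling_cost_def using d'(2) L
    by (subst nn_integral_eq_integral) (auto simp del: vector_minus_component)
  also have "\<dots> = (\<integral>\<^sup>+p. ennreal ((?\<Delta> p $ 1)\<^sup>2 + L * (?\<Delta> p $ 2)\<^sup>2) \<partial>?Q)"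
    unfolding \<pi>'_def
    using F by (subst nn_integral_distr[OF pm]) (simp_all only: measurable_distr_eq1 fst_conv snd_conv diff)
  also have "\<dots> \<le> ennreal ((1 + \<eta>) * contraction_factor m * (\<integral>p. ((fst p - snd p) $ 1)\<^sup>2 \<partial>\<pi>)
      + ((1 + 1 / \<eta>) * (real m)\<^sup>2 + L) * contraction_factor m * (\<integral>p. ((fst p - snd p) $ 2)\<^sup>2 \<partial>\<pi>))"
    by (rule toll_map_contraction[OF m C(1) d \<eta> L])
  also have "\<dots> \<le> ennreal (\<rho> * (\<integral>p. ((fst p - snd p) $ 1)\<^sup>2 \<partial>\<pi>) + \<rho> * L * (\<integral>p. ((fst p - snd p) $ 2)\<^sup>2 \<partial>\<pi>))"
    using \<rho> by (intro ennreal_leI add_mono mult_right_mono) auto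
  also have "\<rho> * (\<integral>p. ((fst p - snd p) $ 1)\<^sup>2 \<partial>\<pi>) + \<rho> * L * (\<integral>p. ((fst p - snd p) $ 2)\<^sup>2 \<partial>\<pi>) = \<rho> * coupling_cost L \<pi>"
    by (simp add: coupling_cost_def algebra_simps)
  finally have *: "ennreal (coupling_cost L \<pi>') \<le> ennreal (\<rho> * coupling_cost L \<pi>)" .
  have "\<rho> \<ge> 0"
    using \<rho>(1) contraction_factor_less_1(1)[OF m] \<eta> by (meson add_nonneg_nonneg less_imp_le mult_nonneg_nonneg order_trans zero_le_one)
  then have "\<rho> * coupling_cost L \<pi> \<ge> 0"
    unfolding coupling_cost_def using L by (intro mult_nonneg_nonneg add_nonneg_nonneg Bochner_Integration.integral_nonneg) auto
  with * have "coupling_cost L \<pi>' \<le> \<rho> * coupling_cost L \<pi>" by (simp add: ennreal_le_iff)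
  with \<pi>' show ?thesis by blast
qed

text \<open>Iterating \<open>coupling_step\<close> from the independent coupling yields couplings of
  arbitrarily small cost. These force equal integrals of Lipschitz functions, so neither optimal
  couplings nor metric properties of \<open>wasserstein2\<close> enter.\<close>

theorem T_map_fixed_point_unique:
  assumes m: "m \<ge> 1" and \<mu>: "\<mu> \<in> M02" and \<nu>: "\<nu> \<in> M02" and fp: "T_map m \<mu> = \<mu>" "T_map m \<nu> = \<nu>"
  shows "\<mu> = \<nu>"
proof -
  note M = M02_D[OF \<mu>] and N = M02_D[OF \<nu>]
  interpret M: prob_space \<mu> by (rule M)
  interpret N: prob_space \<nu> by (rule N)
  interpret MN: pair_prob_space \<mu> \<nu> ..
  define \<kappa> where "\<kappa> = contraction_factor m"
  have \<kappa>: "0 \<le> \<kappa>" "\<kappa> < 1" using contraction_factor_less_1[OF m] by (auto simp: \<kappa>_def)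
  \<comment> \<open>A rate strictly between the contraction factor and one, leaving room for the
    loss in Young's inequality.\<close>
  define \<rho> where "\<rho> = (1 + \<kappa>) / 2"
  have \<rho>: "\<kappa> < \<rho>" "0 < \<rho>" "\<rho> < 1" using \<kappa> by (auto simp: \<rho>_def)
  \<comment> \<open>With this value \<rho> exceeds (1 + \<eta>) \<kappa> by (1 - \<kappa>)^2 /
    2.\<close>
  define \<eta> where "\<eta> = (1 - \<kappa>) / 2"
  have \<eta>: "\<eta> > 0" using \<kappa> by (simp add: \<eta>_def)
  have \<eta>\<kappa>: "(1 + \<eta>) * \<kappa> \<le> \<rho>"
  proof -
    have "\<rho> - (1 + \<eta>) * \<kappa> = (1 - \<kappa>)\<^sup>2 / 2" by (simp add: \<rho>_def \<eta>_def power2_eq_square field_simps)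
    then show ?thesis by (smt (verit) zero_le_power2 divide_nonneg_nonneg)
  qed
  define K where "K = (1 + 1 / \<eta>) * (real m)\<^sup>2"
  have K: "K \<ge> 0" using \<eta> by (simp add: K_def)
  \<comment> \<open>The quotient is the weight at which (K + L) \<kappa> equals \<rho> L; adding 1
    preserves the inequality and gives L at least 1, so that the cost dominates the squared
    norm.\<close>
  define L where "L = K * \<kappa> / (\<rho> - \<kappa>) + 1"
  have L: "L \<ge> 1" using K \<kappa> \<rho> by (simp add: L_def)
  have "K * \<kappa> \<le> L * (\<rho> - \<kappa>)" using \<rho> by (simp add: L_def distrib_right)
  then have L\<rho>: "(K + L) * \<kappa> \<le> \<rho> * L" by (simp add: algebra_simps)
  have "\<exists>\<pi>. \<pi> \<in> couplings \<mu> \<nu>"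
  proof -
    have "fst \<in> borel_measurable (\<mu> \<Otimes>\<^sub>M \<nu>)" "snd \<in> borel_measurable (\<mu> \<Otimes>\<^sub>M \<nu>)"
      using measurable_fst[of \<mu> \<nu>] measurable_snd[of \<mu> \<nu>] M(2) N(2) by (simp_all add: measurable_cong_sets[OF refl M(2)] measurable_cong_sets[OF refl N(2)])
    from couplings_I[OF MN.P.prob_space_axioms this]
    have "distr (\<mu> \<Otimes>\<^sub>M \<nu>) (borel \<Otimes>\<^sub>M borel) (\<lambda>x. (fst x, snd x)) \<in> couplings (distr (\<mu> \<Otimes>\<^sub>M \<nu>) borel fst) (distr (\<mu> \<Otimes>\<^sub>M \<nu>) borel snd)" .
    moreover have "distr (\<mu> \<Otimes>\<^sub>M \<nu>) borel fst = \<mu>"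
      using N.distr_pair_fst[of \<mu>] M(2) distr_cong[of "\<mu> \<Otimes>\<^sub>M \<nu>" "\<mu> \<Otimes>\<^sub>M \<nu>" borel \<mu> fst fst] by simp
    moreover have "distr (\<mu> \<Otimes>\<^sub>M \<nu>) borel snd = \<nu>"
      using M.distr_pair_snd[OF N.sigma_finite_measure_axioms] N(2) distr_cong[of "\<mu> \<Otimes>\<^sub>M \<nu>" "\<mu> \<Otimes>\<^sub>M \<nu>" borel \<nu> snd snd] by simp
    ultimately show ?thesis by auto
  qed
  then obtain \<pi>0 where \<pi>0: "\<pi>0 \<in> couplings \<mu> \<nu>" by blast
  have iterate: "\<exists>\<pi>\<in>couplings \<mu> \<nu>. coupling_cost L \<pi> \<le> \<rho> ^ n * coupling_cost L \<pi>0" for n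
  proof (induction n)
    case 0
    then show ?case using \<pi>0 by auto
  next
    case (Suc n)
    then obtain \<pi> where \<pi>: "\<pi> \<in> couplings \<mu> \<nu>" "coupling_cost L \<pi> \<le> \<rho> ^ n * coupling_cost L \<pi>0" by blast
    have "\<exists>\<pi>'\<in>couplings \<mu> \<nu>. coupling_cost L \<pi>' \<le> \<rho> * coupling_cost L \<pi>"
      using L \<eta>\<kappa> L\<rho> unfolding \<kappa>_def K_def by (intro coupling_step[OF m \<mu> \<nu> fp \<pi>(1) \<eta>]) auto
    then obtain \<pi>' where "\<pi>' \<in> couplings \<mu> \<nu>" "coupling_cost L \<pi>' \<le> \<rho> * coupling_cost L \<pi>" by blast
    moreover have "\<rho> * coupling_cost L \<pi> \<le> \<rho> * (\<rho> ^ n * coupling_cost L \<pi>0)" using \<pi>(2) \<rho> by (intro mult_left_mono) auto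
    ultimately show ?case by (intro bexI[of _ \<pi>']) (auto simp: mult.assoc)
  qed
  show ?thesis
  proof (rule measure_eqI_lipschitz[OF M(1) N(1) M(2) N(2)])
    fix f :: "real^2 \<Rightarrow> real" assume "\<exists>L\<ge>0. \<forall>x y. \<bar>f x - f y\<bar> \<le> L * dist x y" and f01: "\<And>x. 0 \<le> f x \<and> f x \<le> 1"
    then obtain l where l: "l \<ge> 0" "\<And>x y. \<bar>f x - f y\<bar> \<le> l * norm (x - y)" by (auto simp: dist_norm)
    have fm: "f \<in> borel_measurable borel"
    proof (intro borel_measurable_continuous_onI lipschitz_on_continuous_on)
      show "l-lipschitz_on UNIV f" using l by (intro lipschitz_onI) (auto simp: dist_norm)
    qed
    \<comment> \<open>Cauchy-Schwarz is replaced by d at most \<epsilon> + d^2 / \<epsilon>; the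
      cost is sent to zero before \<epsilon>.\<close>
    have bound: "\<bar>integral\<^sup>L \<mu> f - integral\<^sup>L \<nu> f\<bar> \<le> l * (\<epsilon> + coupling_cost L \<pi> / \<epsilon>)" if \<pi>: "\<pi> \<in> couplings \<mu> \<nu>" and \<epsilon>: "\<epsilon> > 0" for \<pi> \<epsilon>
    proof -
      note C = couplings_D[OF \<pi>] and d = coupling_difference[OF \<mu> \<nu> \<pi>]
      interpret \<pi>: prob_space \<pi> by (rule C)
      have i: "integrable \<pi> (\<lambda>p. f (fst p))" "integrable \<pi> (\<lambda>p. f (snd p))"
        using f01 measurable_compose[OF C(2) fm] measurable_compose[OF C(3) fm]
        by (auto intro!: \<pi>.integrable_const_bound[where B=1])
      have eq: "integral\<^sup>L \<mu> f - integral\<^sup>L \<nu> f = (\<integral>p. f (fst p) - f (snd p) \<partial>\<pi>)"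
        using i by (simp add: C(4,5)[symmetric] integral_distr[OF C(2) fm] integral_distr[OF C(3) fm])
      have bi: "integrable \<pi> (\<lambda>p. l * (\<epsilon> + (((fst p - snd p) $ 1)\<^sup>2 + L * ((fst p - snd p) $ 2)\<^sup>2) / \<epsilon>))"
        using d(2) by (auto simp del: vector_minus_component)
      have "\<bar>\<integral>p. f (fst p) - f (snd p) \<partial>\<pi>\<bar> \<le> (\<integral>p. \<bar>f (fst p) - f (snd p)\<bar> \<partial>\<pi>)" by (rule integral_abs_bound)
      also have "\<dots> \<le> (\<integral>p. l * (\<epsilon> + (((fst p - snd p) $ 1)\<^sup>2 + L * ((fst p - snd p) $ 2)\<^sup>2) / \<epsilon>) \<partial>\<pi>)"
      proof (rule integral_mono[OF _ bi])
        show "integrable \<pi> (\<lambda>p. \<bar>f (fst p) - f (snd p)\<bar>)" using i by auto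
        fix p :: "(real^2) \<times> (real^2)"
        let ?d = "fst p - snd p"
        have "norm ?d \<le> \<epsilon> + (norm ?d)\<^sup>2 / \<epsilon>"
        proof -
          have "norm ?d * \<epsilon> \<le> \<epsilon>\<^sup>2 + (norm ?d)\<^sup>2"
            using sum_squares_bound[of "norm ?d" \<epsilon>] \<epsilon> norm_ge_zero[of ?d] mult_nonneg_nonneg[of "norm ?d" \<epsilon>] by linarith
          then show ?thesis using \<epsilon> by (simp add: field_simps power2_eq_square)
        qed
        also have "(norm ?d)\<^sup>2 / \<epsilon> \<le> ((?d $ 1)\<^sup>2 + L * (?d $ 2)\<^sup>2) / \<epsilon>"
          using \<epsilon> mult_right_mono[OF L zero_le_power2[of "?d $ 2"]] unfolding norm_square_real_2
          by (intro divide_right_mono) auto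
        finally have "norm ?d \<le> \<epsilon> + ((?d $ 1)\<^sup>2 + L * (?d $ 2)\<^sup>2) / \<epsilon>" by simp
        then show "\<bar>f (fst p) - f (snd p)\<bar> \<le> l * (\<epsilon> + ((?d $ 1)\<^sup>2 + L * (?d $ 2)\<^sup>2) / \<epsilon>)"
          using l by (meson mult_left_mono order_trans)
      qed
      also have "\<dots> = l * (\<epsilon> + coupling_cost L \<pi> / \<epsilon>)"
        using d(2) by (simp add: coupling_cost_def \<pi>.prob_space del: vector_minus_component)
      finally show ?thesis unfolding eq .
    qed
    have "\<bar>integral\<^sup>L \<mu> f - integral\<^sup>L \<nu> f\<bar> \<le> l * \<epsilon>" if \<epsilon>: "\<epsilon> > 0" for \<epsilon>
    proof (rule LIMSEQ_le_const)
      show "(\<lambda>n. l * (\<epsilon> + \<rho> ^ n * coupling_cost L \<pi>0 / \<epsilon>)) \<longlonglongrightarrow> l * \<epsilon>"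
      proof -
        have "(\<lambda>n. \<rho> ^ n) \<longlonglongrightarrow> 0" using \<rho> by (intro LIMSEQ_realpow_zero) auto
        then have "(\<lambda>n. l * (\<epsilon> + \<rho> ^ n * coupling_cost L \<pi>0 / \<epsilon>)) \<longlonglongrightarrow> l * (\<epsilon> + 0 * coupling_cost L \<pi>0 / \<epsilon>)"
          using \<epsilon> by (intro tendsto_mult tendsto_add tendsto_divide tendsto_const) auto
        then show ?thesis by simp
      qed
      show "\<exists>N. \<forall>n\<ge>N. \<bar>integral\<^sup>L \<mu> f - integral\<^sup>L \<nu> f\<bar> \<le> l * (\<epsilon> + \<rho> ^ n * coupling_cost L \<pi>0 / \<epsilon>)"
      proof (intro exI allI impI)
        fix n
        obtain \<pi> where \<pi>: "\<pi> \<in> couplings \<mu> \<nu>" "coupling_cost L \<pi> \<le> \<rho> ^ n * coupling_cost L \<pi>0" using iterate by blast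
        have "l * (\<epsilon> + coupling_cost L \<pi> / \<epsilon>) \<le> l * (\<epsilon> + \<rho> ^ n * coupling_cost L \<pi>0 / \<epsilon>)"
          using \<pi>(2) \<epsilon> l(1) by (intro mult_left_mono add_left_mono divide_right_mono) auto
        with bound[OF \<pi>(1) \<epsilon>] show "\<bar>integral\<^sup>L \<mu> f - integral\<^sup>L \<nu> f\<bar> \<le> l * (\<epsilon> + \<rho> ^ n * coupling_cost L \<pi>0 / \<epsilon>)" by simp
      qed
    qed
    note le = this
    have "\<bar>integral\<^sup>L \<mu> f - integral\<^sup>L \<nu> f\<bar> \<le> \<epsilon>" if "\<epsilon> > 0" for \<epsilon>
    proof -
      \<comment> \<open>The denominator l + 1 also covers a Lipschitz constant of zero.\<close>
      have "\<bar>integral\<^sup>L \<mu> f - integral\<^sup>L \<nu> f\<bar> \<le> l * (\<epsilon> / (l + 1))" using that l(1) by (intro le) simp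
      also have "\<dots> \<le> \<epsilon>" using that l(1) by (simp add: field_simps)
      finally show ?thesis .
    qed
    then show "integral\<^sup>L \<mu> f = integral\<^sup>L \<nu> f"
      by (metis abs_le_zero_iff eq_iff_diff_eq_0 field_le_epsilon add_0)
  qed
qed

section \<open>Identification of the limit\<close>

text \<open>Nonnegativity of the variance of the absolute value.\<close>

lemma (in prob_space) L1_le_L2:
  fixes f :: "'a \<Rightarrow> real"
  assumes f [measurable]: "f \<in> borel_measurable M" and sq: "integrable M (\<lambda>x. (f x)\<^sup>2)"
  shows "integrable M f" "(\<integral>x. \<bar>f x\<bar> \<partial>M) \<le> sqrt (\<integral>x. (f x)\<^sup>2 \<partial>M)"
proof -
  show int: "integrable M f"
  proof (rule Bochner_Integration.integrable_bound[of _ "\<lambda>x. 1 + (f x)\<^sup>2"])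
    show "AE x in M. norm (f x) \<le> norm (1 + (f x)\<^sup>2)"
      using le_one_plus_square[of "\<bar>f _\<bar>"] by (intro AE_I2) simp
  qed (use sq in auto)
  define a where "a = (\<integral>x. \<bar>f x\<bar> \<partial>M)"
  have "0 \<le> (\<integral>x. (\<bar>f x\<bar> - a)\<^sup>2 \<partial>M)" by (intro Bochner_Integration.integral_nonneg) simp
  also have "\<dots> = (\<integral>x. (f x)\<^sup>2 - 2 * a * \<bar>f x\<bar> + a\<^sup>2 \<partial>M)"
    by (intro Bochner_Integration.integral_cong refl) (simp add: power2_diff algebra_simps)
  also have "\<dots> = (\<integral>x. (f x)\<^sup>2 \<partial>M) - a\<^sup>2"
    using sq int by (simp add: prob_space a_def[symmetric] power2_eq_square)
  finally show "a \<le> sqrt (\<integral>x. (f x)\<^sup>2 \<partial>M)" by (intro real_le_rsqrt) simp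
qed

text \<open>The proof goes through indicators because a family of trees lives in an uncountable type, on
  which the full power set is not generated by the product \<open>\<sigma>\<close>-algebra.\<close>

lemma Pi_pmf_expectation_copies:
  fixes M :: "'a measure" and p :: "'i \<Rightarrow> 'b pmf" and F :: "('i \<Rightarrow> 'b) \<Rightarrow> real"
  assumes R: "finite R" and M: "prob_space M"
    and t: "\<And>r. r \<in> R \<Longrightarrow> t r \<in> M \<rightarrow>\<^sub>M count_space UNIV"
    and law: "\<And>r. r \<in> R \<Longrightarrow> distr M (count_space UNIV) (t r) = measure_pmf (p r)"
    and fin: "\<And>r. r \<in> R \<Longrightarrow> finite (set_pmf (p r))"
    and F: "(\<lambda>\<omega>. F (\<lambda>r. if r \<in> R then t r (\<omega> r) else dflt)) \<in> borel_measurable (PiM R (\<lambda>_. M))"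
  shows "measure_pmf.expectation (Pi_pmf R dflt p) F = (\<integral>\<omega>. F (\<lambda>r. if r \<in> R then t r (\<omega> r) else dflt) \<partial>PiM R (\<lambda>_. M))"
proof -
  interpret M: prob_space M by (rule M)
  interpret P: product_sigma_finite "\<lambda>_::'i. M" by standard
  let ?S = "PiE_dflt R dflt (\<lambda>r. set_pmf (p r))"
  \<comment> \<open>Indicator that coordinate r equals \<open>s r\<close>. The product over r
    detects one whole family, and only finitely many families have positive probability.\<close>
  define u where "u s r x = (indicator {s r} (t r x) :: real)" for s :: "'i \<Rightarrow> 'b" and r x
  have finS: "finite ?S" using R fin by (intro finite_PiE_dflt) auto
  have um: "u s r \<in> borel_measurable M" if "r \<in> R" for s r
    unfolding u_def by (rule measurable_compose[OF t[OF that]]) simp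
  have umP: "(\<lambda>\<omega>. u s r (\<omega> r)) \<in> borel_measurable (PiM R (\<lambda>_. M))" if "r \<in> R" for s r
    using measurable_compose[OF measurable_component_singleton[OF that, of "\<lambda>_. M"] um[OF that]] .
  have ui: "integrable M (u s r)" "integral\<^sup>L M (u s r) = pmf (p r) (s r)" if r: "r \<in> R" for s r
  proof -
    show "integrable M (u s r)"
      by (rule M.integrable_const_bound[where B=1]) (auto simp: u_def indicator_def intro: um[OF r])
    have "integral\<^sup>L M (u s r) = integral\<^sup>L (distr M (count_space UNIV) (t r)) (indicator {s r})"
      unfolding u_def by (rule integral_distr[OF t[OF r], symmetric]) simp
    then show "integral\<^sup>L M (u s r) = pmf (p r) (s r)" unfolding law[OF r] by (simp add: measure_pmf_single)
  qed
  have supp: "AE \<omega> in PiM R (\<lambda>_. M). \<forall>r\<in>R. t r (\<omega> r) \<in> set_pmf (p r)"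
  proof (intro AE_finite_allI[OF R])
    fix r assume r: "r \<in> R"
    have "AE y in distr M (count_space UNIV) (t r). y \<in> set_pmf (p r)"
      unfolding law[OF r] by (simp add: AE_measure_pmf_iff)
    then have "AE x in M. t r x \<in> set_pmf (p r)" by (rule AE_distrD[OF t[OF r]])
    then show "AE \<omega> in PiM R (\<lambda>_. M). t r (\<omega> r) \<in> set_pmf (p r)"
      using r M by (intro AE_PiM_component) auto
  qed
  have "(\<integral>\<omega>. F (\<lambda>r. if r \<in> R then t r (\<omega> r) else dflt) \<partial>PiM R (\<lambda>_. M))
    = (\<integral>\<omega>. (\<Sum>s\<in>?S. F s * (\<Prod>r\<in>R. u s r (\<omega> r))) \<partial>PiM R (\<lambda>_. M))"
  proof (rule integral_cong_AE[OF F])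
    show "(\<lambda>\<omega>. \<Sum>s\<in>?S. F s * (\<Prod>r\<in>R. u s r (\<omega> r))) \<in> borel_measurable (PiM R (\<lambda>_. M))"
      by (intro borel_measurable_sum borel_measurable_times borel_measurable_const borel_measurable_prod umP)
    show "AE \<omega> in PiM R (\<lambda>_. M). F (\<lambda>r. if r \<in> R then t r (\<omega> r) else dflt) = (\<Sum>s\<in>?S. F s * (\<Prod>r\<in>R. u s r (\<omega> r)))"
      using supp
    proof eventually_elim
      fix \<omega> assume \<omega>: "\<forall>r\<in>R. t r (\<omega> r) \<in> set_pmf (p r)"
      define s0 where "s0 r = (if r \<in> R then t r (\<omega> r) else dflt)" for r
      have s0: "s0 \<in> ?S" using \<omega> by (auto simp: s0_def PiE_dflt_def)
      have "(\<Prod>r\<in>R. u s r (\<omega> r)) = (if s = s0 then 1 else 0)" if s: "s \<in> ?S" for s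
      proof (cases "s = s0")
        case True
        then show ?thesis by (simp add: u_def s0_def)
      next
        case False
        then obtain r where r: "s r \<noteq> s0 r" by auto
        have "s r = dflt" if "r \<notin> R" using s that by (simp add: PiE_dflt_def)
        with r have "r \<in> R" by (cases "r \<in> R") (simp_all add: s0_def)
        then show ?thesis using False r R by (auto simp: u_def s0_def intro!: prod_zero bexI[of _ r])
      qed
      then have "(\<Sum>s\<in>?S. F s * (\<Prod>r\<in>R. u s r (\<omega> r))) = (\<Sum>s\<in>?S. if s = s0 then F s else 0)"
        by (intro sum.cong) auto
      also have "\<dots> = F s0" using s0 finS by simp
      finally show "F (\<lambda>r. if r \<in> R then t r (\<omega> r) else dflt) = (\<Sum>s\<in>?S. F s * (\<Prod>r\<in>R. u s r (\<omega> r)))"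
        by (simp add: s0_def[abs_def])
    qed
  qed
  also have "\<dots> = (\<Sum>s\<in>?S. F s * (\<Prod>r\<in>R. pmf (p r) (s r)))"
  proof -
    have "integrable (PiM R (\<lambda>_. M)) (\<lambda>\<omega>. \<Prod>r\<in>R. u s r (\<omega> r))"
      "(\<integral>\<omega>. (\<Prod>r\<in>R. u s r (\<omega> r)) \<partial>PiM R (\<lambda>_. M)) = (\<Prod>r\<in>R. pmf (p r) (s r))" for s
      using P.product_integrable_prod[OF R ui(1)] P.product_integral_prod[OF R ui(1)] ui(2) by simp_all
    then show ?thesis by simp
  qed
  also have "\<dots> = (\<Sum>s\<in>?S. pmf (Pi_pmf R dflt p) s *\<^sub>R F s)"
    using R by (intro sum.cong refl) (auto simp: pmf_Pi PiE_dflt_def)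
  also have "\<dots> = measure_pmf.expectation (Pi_pmf R dflt p) F"
    by (rule integral_measure_pmf[OF finS, symmetric]) (use set_Pi_pmf_subset'[OF R, of dflt p] in \<open>auto simp: set_pmf_iff comp_def\<close>)
  finally show ?thesis by simp
qed

section \<open>Uniform smallness of weighted errors\<close>

text \<open>For large j the error itself is small. For the finitely many small j it is merely
  bounded, but then the weight is at most of order 1/n.\<close>

lemma share_weighted_small:
  assumes m: "m \<ge> 1" and \<eta>: "\<eta> \<longlonglongrightarrow> (0::real)" and \<epsilon>: "\<epsilon> > 0"
  shows "\<exists>K. \<forall>n\<ge>K. \<forall>j\<in>{1..n}. tree_size m j / tree_size m n * \<bar>\<eta> j\<bar> \<le> \<epsilon>"
proof -
  obtain J where J: "\<And>j. j \<ge> J \<Longrightarrow> \<bar>\<eta> j\<bar> \<le> \<epsilon>" using LIMSEQ_D[OF \<eta> \<epsilon>] by (auto intro: less_imp_le)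
  obtain B where B: "\<And>j. \<bar>\<eta> j\<bar> \<le> B"
    using convergent_imp_Bseq[OF convergentI[OF \<eta>]] by (auto simp: Bseq_def)
  have B0: "B \<ge> 0" using B[of 0] by linarith
  have mono: "tree_size m i \<le> tree_size m j" if "i \<le> j" for i j
    using that by (simp add: tree_size_def mult_left_mono)
  \<comment> \<open>Chosen so that N_J B is at most \<epsilon> (n - 1), and thus at most \<epsilon>
    N_n.\<close>
  define K where "K = max 1 (nat \<lceil>tree_size m J * B / \<epsilon>\<rceil> + 1)"
  have "tree_size m j / tree_size m n * \<bar>\<eta> j\<bar> \<le> \<epsilon>" if n: "n \<ge> K" and j: "j \<in> {1..n}" for n j
  proof -
    have N: "tree_size m j > 0" "tree_size m n > 0" using j by (auto intro: tree_size_pos)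
    show ?thesis
    proof (cases "j \<ge> J")
      case True
      have "tree_size m j / tree_size m n * \<bar>\<eta> j\<bar> \<le> 1 * \<epsilon>"
        using J[OF True] mono[of j n] j N \<epsilon> by (intro mult_mono) auto
      then show ?thesis by simp
    next
      case False
      have "tree_size m J * B / \<epsilon> \<le> real n - 1" using n unfolding K_def by linarith
      also have "\<dots> \<le> real m * (real n - 1)"
        using m j by (simp add: mult_le_cancel_right1)
      also have "\<dots> \<le> tree_size m n" by (simp add: tree_size_def)
      finally have *: "tree_size m J * B \<le> \<epsilon> * tree_size m n" using \<epsilon> by (simp add: field_simps)
      have "tree_size m j * \<bar>\<eta> j\<bar> \<le> tree_size m J * B"
        using B[of j] mono[of j J] False N B0 by (intro mult_mono) auto
      with * have "tree_size m j * \<bar>\<eta> j\<bar> \<le> \<epsilon> * tree_size m n" by linarith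
      then show ?thesis using N by (simp add: field_simps)
    qed
  qed
  then show ?thesis by blast
qed

lemma tree_size_ratio_limit:
  assumes "m \<ge> 1"
  shows "(\<lambda>n. tree_size m (Suc n) / tree_size m n) \<longlonglongrightarrow> 1"
    and "(\<lambda>n. tree_size m n * tree_size m (Suc n) / (real n)\<^sup>2) \<longlonglongrightarrow> (real m)\<^sup>2"
    and "(\<lambda>n. tree_size m n / real n) \<longlonglongrightarrow> real m"
    and "(\<lambda>n. 1 / tree_size m n) \<longlonglongrightarrow> 0" and "(\<lambda>n. ln (tree_size m n) / tree_size m n) \<longlonglongrightarrow> 0"
proof -
  have m: "real m > 0" using assms by simp
  show "(\<lambda>n. tree_size m (Suc n) / tree_size m n) \<longlonglongrightarrow> 1"
    "(\<lambda>n. tree_size m n * tree_size m (Suc n) / (real n)\<^sup>2) \<longlonglongrightarrow> (real m)\<^sup>2"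
    "(\<lambda>n. tree_size m n / real n) \<longlonglongrightarrow> real m"
    "(\<lambda>n. 1 / tree_size m n) \<longlonglongrightarrow> 0" "(\<lambda>n. ln (tree_size m n) / tree_size m n) \<longlonglongrightarrow> 0"
    unfolding tree_size_def using m by (real_asymp simp: power2_eq_square)+
qed

lemma wiener_gap_limit:
  assumes m: "m \<ge> 1"
  shows "wiener_gap m \<longlonglongrightarrow> 0"
proof -
  obtain \<gamma> where \<gamma>: "mean_gap m \<longlonglongrightarrow> \<gamma>"
    using harm_sum_ln_convergent[OF m] unfolding convergent_def mean_gap_def[abs_def] by blast
  have "(\<lambda>n. real m * (ln (tree_size m n) / tree_size m n) + (real m * mean_gap m n + 1) * (1 / tree_size m n)) \<longlonglongrightarrow> real m * 0 + (real m * \<gamma> + 1) * 0"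
    by (intro tendsto_add tendsto_mult tendsto_const \<gamma> tree_size_ratio_limit[OF m])
  moreover have "wiener_gap m = (\<lambda>n. real m * (ln (tree_size m n) / tree_size m n) + (real m * mean_gap m n + 1) * (1 / tree_size m n))"
    by (rule ext) (simp add: wiener_gap_def mean_gap_def add_divide_distrib[symmetric] algebra_simps)
  ultimately show ?thesis by (simp only: mult_zero_right add_0)
qed

text \<open>The limit \<gamma> of \<open>mean_gap\<close> cancels because the shares sum to one.
  What remains are the errors \<open>mean_gap\<close> - \<gamma> and \<open>wiener_gap\<close>,
  which tend to zero and enter weighted by shares.\<close>

lemma toll_error_small:
  assumes m: "m \<ge> 1" and \<epsilon>: "\<epsilon> > 0"
  shows "\<exists>K. \<forall>k\<ge>K. \<forall>I\<in>set_pmf (urn m k). norm (toll_error m (k + 2) I) \<le> \<epsilon>"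
proof -
  obtain \<gamma> where \<gamma>: "mean_gap m \<longlonglongrightarrow> \<gamma>"
    using harm_sum_ln_convergent[OF m] unfolding convergent_def mean_gap_def[abs_def] by blast
  \<comment> \<open>Each of the sums a and b below is at most (m + 2) \<delta>, from m + 1
    components and the whole tree; a enters both coordinates with factors m^2 and m, b the first one
    with m^2.\<close>
  define C where "C = ((real m)\<^sup>2 + real m + (real m)\<^sup>2) * (real m + 2)"
  have C: "C > 0" using m unfolding C_def by (intro mult_pos_pos add_pos_nonneg) auto
  define \<delta> where "\<delta> = \<epsilon> / C"
  have \<delta>: "\<delta> > 0" using \<epsilon> C by (simp add: \<delta>_def)
  have "(\<lambda>n. mean_gap m n - \<gamma>) \<longlonglongrightarrow> 0" using \<gamma> by (simp add: LIM_zero)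
  from share_weighted_small[OF m this \<delta>] obtain K1 where
    K1: "\<And>n j. n \<ge> K1 \<Longrightarrow> j \<in> {1..n} \<Longrightarrow> tree_size m j / tree_size m n * \<bar>mean_gap m j - \<gamma>\<bar> \<le> \<delta>" by blast
  from share_weighted_small[OF m wiener_gap_limit[OF m] \<delta>] obtain K2 where
    K2: "\<And>n j. n \<ge> K2 \<Longrightarrow> j \<in> {1..n} \<Longrightarrow> tree_size m j / tree_size m n * \<bar>wiener_gap m j\<bar> \<le> \<delta>" by blast
  have "norm (toll_error m (k + 2) I) \<le> \<epsilon>" if k: "k \<ge> max K1 K2" and I: "I \<in> set_pmf (urn m k)" for k I
  proof -
    let ?n = "k + 2" and ?v = "share m (k + 2) I"
    note S = share_simplex[OF I]
    have v1: "(\<Sum>r=1..m+1. ?v r) = 1" using S by (simp add: simplex_functions_def)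
    have v: "0 \<le> ?v r" "?v r \<le> 1" if "r \<in> {1..m+1}" for r
      using S simplex_functions_le_1[OF S that] that by (auto simp: simplex_functions_def)
    have Ir: "I r \<in> {1..?n}" for r using urn_ge_1[OF I, of r] urn_le[OF I, of r] by simp
    have nn: "?n \<in> {1..?n}" "tree_size m ?n / tree_size m ?n = 1" using tree_size_pos[of ?n m] by auto
    have gn: "\<bar>mean_gap m ?n - \<gamma>\<bar> \<le> \<delta>" "\<bar>wiener_gap m ?n\<bar> \<le> \<delta>"
      using K1[OF _ nn(1)] K2[OF _ nn(1)] k nn(2) by auto
    have g1: "\<bar>?v r * (mean_gap m (I r) - \<gamma>)\<bar> \<le> \<delta>" if "r \<in> {1..m+1}" for r
    proof -
      have "\<bar>?v r * (mean_gap m (I r) - \<gamma>)\<bar> = ?v r * \<bar>mean_gap m (I r) - \<gamma>\<bar>"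
        using v[OF that] by (simp only: abs_mult abs_of_nonneg)
      also have "\<dots> \<le> \<delta>" using K1[OF _ Ir[of r]] k that by (simp add: share_def)
      finally show ?thesis .
    qed
    have g2: "\<bar>(?v r)\<^sup>2 * wiener_gap m (I r)\<bar> \<le> \<delta>" if r: "r \<in> {1..m+1}" for r
    proof -
      have "\<bar>(?v r)\<^sup>2 * wiener_gap m (I r)\<bar> \<le> ?v r * \<bar>wiener_gap m (I r)\<bar>"
        unfolding abs_mult using v[OF r] by (intro mult_right_mono) (auto simp: power2_eq_square mult_left_le)
      also have "\<dots> \<le> \<delta>" using K2[OF _ Ir[of r]] k r by (simp add: share_def)
      finally show ?thesis .
    qed
    define a where "a = (\<Sum>r=1..m+1. ?v r * mean_gap m (I r)) - mean_gap m ?n"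
    define b where "b = (\<Sum>r=1..m+1. (?v r)\<^sup>2 * wiener_gap m (I r)) - wiener_gap m ?n"
    have "(\<Sum>r=1..m+1. ?v r * (mean_gap m (I r) - \<gamma>)) = (\<Sum>r=1..m+1. ?v r * mean_gap m (I r)) - (\<Sum>r=1..m+1. ?v r) * \<gamma>"
      by (simp only: right_diff_distrib sum_subtractf sum_distrib_right)
    then have "a = (\<Sum>r=1..m+1. ?v r * (mean_gap m (I r) - \<gamma>)) - (mean_gap m ?n - \<gamma>)"
      unfolding a_def v1 by simp
    moreover have "\<bar>\<Sum>r=1..m+1. ?v r * (mean_gap m (I r) - \<gamma>)\<bar> \<le> (\<Sum>r=1..m+1. \<delta>)"
      by (rule order_trans[OF sum_abs sum_mono[OF g1]])
    ultimately have a: "\<bar>a\<bar> \<le> (real m + 2) * \<delta>" using gn by (simp add: algebra_simps)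
    have "\<bar>\<Sum>r=1..m+1. (?v r)\<^sup>2 * wiener_gap m (I r)\<bar> \<le> (\<Sum>r=1..m+1. \<delta>)"
      by (rule order_trans[OF sum_abs sum_mono[OF g2]])
    then have b: "\<bar>b\<bar> \<le> (real m + 2) * \<delta>" unfolding b_def using gn by (simp add: algebra_simps)
    have "toll_error m ?n I $ 1 = (real m)\<^sup>2 * (a + b)" "toll_error m ?n I $ 2 = real m * a"
      unfolding toll_error_def vector_2 a_def b_def by (simp_all only: algebra_simps)
    then have "norm (toll_error m ?n I) \<le> \<bar>(real m)\<^sup>2 * (a + b)\<bar> + \<bar>real m * a\<bar>"
      using norm_le_l1_cart[of "toll_error m ?n I"] by (simp add: sum_2)
    also have "\<dots> \<le> (real m)\<^sup>2 * (\<bar>a\<bar> + \<bar>b\<bar>) + real m * \<bar>a\<bar>"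
      by (simp add: abs_mult mult_left_mono)
    also have "\<dots> \<le> (real m)\<^sup>2 * ((real m + 2) * \<delta> + (real m + 2) * \<delta>) + real m * ((real m + 2) * \<delta>)"
      using a b by (intro add_mono mult_left_mono) auto
    also have "\<dots> = C * \<delta>" by (simp add: C_def algebra_simps)
    also have "\<dots> = \<epsilon>" using C by (simp add: \<delta>_def)
    finally show ?thesis .
  qed
  then show ?thesis by blast
qed

section \<open>The limit vector on the space of histories\<close>

locale tree_limit =
  fixes m :: nat and Y Z :: "(nat \<Rightarrow> node) \<Rightarrow> real"
  assumes m: "m \<ge> 1"
    and Y [measurable]: "Y \<in> borel_measurable (choice_space m)" and Z [measurable]: "Z \<in> borel_measurable (choice_space m)"
    and Y2: "integrable (choice_space m) (\<lambda>\<omega>. (Y \<omega>)\<^sup>2)" and Z2: "integrable (choice_space m) (\<lambda>\<omega>. (Z \<omega>)\<^sup>2)"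
    and lim_Y: "(\<lambda>n. \<integral>\<omega>. (wiener_martingale m n (grow m n \<omega>) - Y \<omega>)\<^sup>2 \<partial>choice_space m) \<longlonglongrightarrow> 0"
    and lim_Z: "(\<lambda>n. \<integral>\<omega>. (path_martingale m n (grow m n \<omega>) - Z \<omega>)\<^sup>2 \<partial>choice_space m) \<longlonglongrightarrow> 0"
    and W2: "\<And>n. integrable (choice_space m) (\<lambda>\<omega>. (wiener_martingale m n (grow m n \<omega>))\<^sup>2)"
    and P2: "\<And>n. integrable (choice_space m) (\<lambda>\<omega>. (path_martingale m n (grow m n \<omega>))\<^sup>2)"
begin

sublocale prob_space "choice_space m" by (rule prob_space_choice_space)

abbreviation "\<Omega> \<equiv> choice_space m"

definition X :: "(nat \<Rightarrow> node) \<Rightarrow> real^2" where "X \<omega> = vector [(real m)\<^sup>2 * Y \<omega>, real m * Z \<omega>]"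

definition limit_law :: "(real^2) measure" where "limit_law = distr \<Omega> borel X"

lemma X_measurable [measurable]: "X \<in> borel_measurable \<Omega>"
  unfolding X_def by measurable

lemma grow_measurable: "(\<lambda>\<omega>. h (grow m n \<omega>)) \<in> borel_measurable \<Omega>"
  by (rule measurable_compose[OF measurable_grow]) simp

lemma X_nth: "X \<omega> $ 1 = (real m)\<^sup>2 * Y \<omega>" "X \<omega> $ 2 = real m * Z \<omega>"
  by (simp_all add: X_def)

lemma X_square: "integrable \<Omega> (\<lambda>\<omega>. (norm (X \<omega>))\<^sup>2)"
  unfolding norm_square_real_2 X_nth power_mult_distrib using Y2 Z2 by auto

text \<open>Any deterministic normalisation with the right asymptotics has the same limit vector. It
  serves both \<open>scaled_stats\<close>, in which the recursion is exact, and
  \<open>normalized_law\<close>, which the theorem is about.\<close>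

lemma scaled_martingales_limit:
  assumes c: "c \<longlonglongrightarrow> (real m)\<^sup>2" and c': "c' \<longlonglongrightarrow> real m"
  shows "\<And>n. integrable \<Omega> (\<lambda>\<omega>. (norm (vector [c n * wiener_martingale m n (grow m n \<omega>), c' n * path_martingale m n (grow m n \<omega>)] - X \<omega>))\<^sup>2)"
    and "(\<lambda>n. \<integral>\<omega>. (norm (vector [c n * wiener_martingale m n (grow m n \<omega>), c' n * path_martingale m n (grow m n \<omega>)] - X \<omega>))\<^sup>2 \<partial>\<Omega>) \<longlonglongrightarrow> 0"
proof -
  let ?U = "\<lambda>n \<omega>. c n * wiener_martingale m n (grow m n \<omega>)" and ?V = "\<lambda>n \<omega>. c' n * path_martingale m n (grow m n \<omega>)"
  have sq: "(norm (vector [?U n \<omega>, ?V n \<omega>] - X \<omega>))\<^sup>2 = (?U n \<omega> - (real m)\<^sup>2 * Y \<omega>)\<^sup>2 + (?V n \<omega> - real m * Z \<omega>)\<^sup>2" for n \<omega>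
    by (simp add: norm_square_real_2 X_nth)
  have U: "integrable \<Omega> (\<lambda>\<omega>. (?U n \<omega> - (real m)\<^sup>2 * Y \<omega>)\<^sup>2)" for n
    using W2 Y2 grow_measurable by (intro integrable_square_diff) (auto simp: power_mult_distrib)
  have V: "integrable \<Omega> (\<lambda>\<omega>. (?V n \<omega> - real m * Z \<omega>)\<^sup>2)" for n
    using P2 Z2 grow_measurable by (intro integrable_square_diff) (auto simp: power_mult_distrib)
  show "\<And>n. integrable \<Omega> (\<lambda>\<omega>. (norm (vector [?U n \<omega>, ?V n \<omega>] - X \<omega>))\<^sup>2)"
    unfolding sq using U V by auto
  have "(\<lambda>n. (\<integral>\<omega>. (?U n \<omega> - (real m)\<^sup>2 * Y \<omega>)\<^sup>2 \<partial>\<Omega>) + (\<integral>\<omega>. (?V n \<omega> - real m * Z \<omega>)\<^sup>2 \<partial>\<Omega>)) \<longlonglongrightarrow> 0 + 0"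
    by (intro tendsto_add L2_scaled_limit grow_measurable Y Z W2 P2 Y2 Z2 lim_Y lim_Z c c')
  then show "(\<lambda>n. \<integral>\<omega>. (norm (vector [?U n \<omega>, ?V n \<omega>] - X \<omega>))\<^sup>2 \<partial>\<Omega>) \<longlonglongrightarrow> 0"
    unfolding sq using U V by simp
qed

lemma scaled_stats_martingales:
  assumes "n \<ge> 1"
  shows "scaled_stats m n t = vector [(real m)\<^sup>2 * (tree_size m (Suc n) / tree_size m n) * wiener_martingale m n t, real m * path_martingale m n t]"
  using tree_size_pos[OF assms, of m] tree_size_pos[of "Suc n" m]
  by (simp add: scaled_stats_def wiener_martingale_def path_martingale_def power2_eq_square ac_simps)

text \<open>A first moment is enough, since the recursion is tested with Lipschitz functions
  only.\<close>

definition gap :: "nat \<Rightarrow> real" where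
  "gap n = (\<integral>\<omega>. norm (scaled_stats m n (grow m n \<omega>) - X \<omega>) \<partial>\<Omega>)"

lemma gap_limit:
  shows "\<And>n. n \<ge> 1 \<Longrightarrow> integrable \<Omega> (\<lambda>\<omega>. norm (scaled_stats m n (grow m n \<omega>) - X \<omega>))"
    and "gap \<longlonglongrightarrow> 0"
proof -
  let ?D = "\<lambda>n \<omega>. norm (vector [(real m)\<^sup>2 * (tree_size m (Suc n) / tree_size m n) * wiener_martingale m n (grow m n \<omega>),
     real m * path_martingale m n (grow m n \<omega>)] - X \<omega>)"
  have c: "(\<lambda>n. (real m)\<^sup>2 * (tree_size m (Suc n) / tree_size m n)) \<longlonglongrightarrow> (real m)\<^sup>2"
    using tendsto_mult[OF tendsto_const tree_size_ratio_limit(1)[OF m], of "(real m)\<^sup>2"] by simp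
  note lim = scaled_martingales_limit[OF c tendsto_const]
  have meas: "?D n \<in> borel_measurable \<Omega>" for n
    using grow_measurable by measurable
  note L1 = L1_le_L2[OF meas lim(1)]
  show 1: "integrable \<Omega> (\<lambda>\<omega>. norm (scaled_stats m n (grow m n \<omega>) - X \<omega>))" if "n \<ge> 1" for n
    unfolding scaled_stats_martingales[OF that] by (rule L1(1))
  have "(\<lambda>n. \<integral>\<omega>. ?D n \<omega> \<partial>\<Omega>) \<longlonglongrightarrow> 0"
  proof (rule tendsto_sandwich[OF _ _ tendsto_const])
    show "\<forall>\<^sub>F n in sequentially. (\<integral>\<omega>. ?D n \<omega> \<partial>\<Omega>) \<le> sqrt (\<integral>\<omega>. (?D n \<omega>)\<^sup>2 \<partial>\<Omega>)"
      by (intro always_eventually allI L1(2)[unfolded abs_norm_cancel])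
    show "(\<lambda>n. sqrt (\<integral>\<omega>. (?D n \<omega>)\<^sup>2 \<partial>\<Omega>)) \<longlonglongrightarrow> 0"
      using tendsto_real_sqrt[OF lim(2)] by (simp only: real_sqrt_zero)
    show "\<forall>\<^sub>F n in sequentially. 0 \<le> (\<integral>\<omega>. ?D n \<omega> \<partial>\<Omega>)"
      by (intro always_eventually allI Bochner_Integration.integral_nonneg norm_ge_zero)
  qed
  moreover have "\<forall>\<^sub>F n in sequentially. (\<integral>\<omega>. ?D n \<omega> \<partial>\<Omega>) = gap n"
    using eventually_ge_at_top[of 1] by eventually_elim (simp only: gap_def scaled_stats_martingales)
  ultimately show "gap \<longlonglongrightarrow> 0" by (rule Lim_transform_eventually)
qed

lemma X_integrable: "integrable \<Omega> (\<lambda>\<omega>. norm (X \<omega>))" "integrable \<Omega> (\<lambda>\<omega>. X \<omega> $ i)"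
proof -
  have "integrable \<Omega> (\<lambda>\<omega>. norm (X \<omega>))" by (rule L1_le_L2(1)[OF measurable_compose[OF X_measurable borel_measurable_norm] X_square])
  then show "integrable \<Omega> (\<lambda>\<omega>. norm (X \<omega>))" .
  then have "integrable \<Omega> X" by (simp add: integrable_norm_iff)
  then show "integrable \<Omega> (\<lambda>\<omega>. X \<omega> $ i)" by (rule integrable_bounded_linear[OF bounded_linear_vec_nth])
qed

lemma tree_expectation_grow:
  fixes h :: "tree \<Rightarrow> real"
  shows "(\<integral>\<omega>. h (grow m n \<omega>) \<partial>\<Omega>) = tree_expectation m n h" "n \<ge> 1 \<Longrightarrow> integrable \<Omega> (\<lambda>\<omega>. h (grow m n \<omega>))"
proof -
  show "(\<integral>\<omega>. h (grow m n \<omega>) \<partial>\<Omega>) = tree_expectation m n h"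
    unfolding distr_grow[symmetric] by (subst integral_distr) auto
  show "integrable \<Omega> (\<lambda>\<omega>. h (grow m n \<omega>))" if "n \<ge> 1"
    using integrable_recursive_tree[OF that, of m h] unfolding distr_grow[symmetric]
    by (subst (asm) integrable_distr_eq) auto
qed

lemma lipschitz_stats_limit:
  fixes h :: "real^2 \<Rightarrow> real"
  assumes L: "L \<ge> 0" "\<And>x y. \<bar>h x - h y\<bar> \<le> L * norm (x - y)" and hX: "integrable \<Omega> (\<lambda>\<omega>. h (X \<omega>))"
  shows "(\<lambda>n. tree_expectation m n (\<lambda>t. h (scaled_stats m n t))) \<longlonglongrightarrow> (\<integral>\<omega>. h (X \<omega>) \<partial>\<Omega>)"
proof -
  have le: "\<bar>tree_expectation m n (\<lambda>t. h (scaled_stats m n t)) - (\<integral>\<omega>. h (X \<omega>) \<partial>\<Omega>)\<bar> \<le> L * gap n" if n: "n \<ge> 1" for n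
  proof -
    note i = tree_expectation_grow[where h="\<lambda>t. h (scaled_stats m n t)" and n=n]
    have "tree_expectation m n (\<lambda>t. h (scaled_stats m n t)) - (\<integral>\<omega>. h (X \<omega>) \<partial>\<Omega>)
      = (\<integral>\<omega>. h (scaled_stats m n (grow m n \<omega>)) - h (X \<omega>) \<partial>\<Omega>)"
      using i(2)[OF n] hX by (simp add: i(1))
    also have "\<bar>\<dots>\<bar> \<le> (\<integral>\<omega>. \<bar>h (scaled_stats m n (grow m n \<omega>)) - h (X \<omega>)\<bar> \<partial>\<Omega>)" by (rule integral_abs_bound)
    also have "\<dots> \<le> (\<integral>\<omega>. L * norm (scaled_stats m n (grow m n \<omega>) - X \<omega>) \<partial>\<Omega>)"
      using i(2)[OF n] hX gap_limit(1)[OF n] L by (intro integral_mono) auto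
    finally show ?thesis by (simp add: gap_def)
  qed
  have "\<forall>\<^sub>F n in sequentially. norm (tree_expectation m n (\<lambda>t. h (scaled_stats m n t)) - (\<integral>\<omega>. h (X \<omega>) \<partial>\<Omega>)) \<le> L * gap n"
    unfolding real_norm_def using eventually_ge_at_top[of 1] by eventually_elim (rule le)
  moreover have "(\<lambda>n. L * gap n) \<longlonglongrightarrow> 0" using tendsto_mult[OF tendsto_const[of L] gap_limit(2)] by (simp only: mult_zero_right)
  ultimately show ?thesis by (rule LIM_zero_cancel[OF Lim_null_comparison])
qed

text \<open>The martingales have mean zero at every time, and convergence in mean preserves
  this.\<close>

lemma X_mean: "(\<integral>\<omega>. X \<omega> $ i \<partial>\<Omega>) = 0"
proof -
  have "\<bar>(x - y) $ i\<bar> \<le> 1 * norm (x - y)" for x y :: "real^2" using component_le_norm_cart[of "x - y" i] by simp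
  then have "(\<lambda>n. tree_expectation m n (\<lambda>t. scaled_stats m n t $ i)) \<longlonglongrightarrow> (\<integral>\<omega>. X \<omega> $ i \<partial>\<Omega>)"
    by (intro lipschitz_stats_limit[where L=1 and h="\<lambda>x. x $ i"] X_integrable) auto
  moreover have "tree_expectation m n (\<lambda>t. scaled_stats m n t $ i) = 0" if n: "n \<ge> 1" for n
  proof -
    have "tree_expectation m n (wiener_martingale m n) = 0" "tree_expectation m n (path_martingale m n) = 0"
      using tree_martingale.mean_zero[OF tree_martingale_wiener n] tree_martingale.mean_zero[OF tree_martingale_path n] by simp_all
    then have "tree_expectation m n (\<lambda>t. scaled_stats m n t $ 1) = 0" "tree_expectation m n (\<lambda>t. scaled_stats m n t $ 2) = 0"
      unfolding scaled_stats_martingales[OF n] vector_2 by simp_all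
    then show ?thesis using exhaust_2[of i] by metis
  qed
  then have "(\<lambda>n. tree_expectation m n (\<lambda>t. scaled_stats m n t $ i)) \<longlonglongrightarrow> 0"
    by (intro tendsto_eventually eventually_mono[OF eventually_ge_at_top[of 1]]) auto
  ultimately show ?thesis by (rule LIMSEQ_unique)
qed

lemma limit_law_M02: "limit_law \<in> M02"
  unfolding limit_law_def by (rule M02_I[OF prob_space_axioms X_measurable X_square X_mean])

section \<open>Passing to the limit in the recursion\<close>

text \<open>The expectation of the test function under the limit map given the shares. As a
  continuous function of the shares it can be fed to \<open>urn_shares_limit\<close>.\<close>

definition smoothed :: "(real^2 \<Rightarrow> real) \<Rightarrow> (nat \<Rightarrow> real) \<Rightarrow> real" where
  "smoothed h V = (\<integral>\<omega>. h (toll_map m V (\<lambda>r. X (\<omega> r))) \<partial>copies m \<Omega>)"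

context
  fixes h :: "real^2 \<Rightarrow> real" and L :: real
  assumes L: "L \<ge> 0" and lip: "\<And>x y. \<bar>h x - h y\<bar> \<le> L * norm (x - y)"
begin

lemma lip_continuous: "continuous_on UNIV h"
proof (rule lipschitz_on_continuous_on)
  show "L-lipschitz_on UNIV h" using L lip by (intro lipschitz_onI) (auto simp: dist_norm)
qed

lemma lip_measurable: "h \<in> borel_measurable borel"
  by (rule borel_measurable_continuous_onI[OF lip_continuous])

lemma lip_growth: "\<bar>h x\<bar> \<le> \<bar>h 0\<bar> + L * norm x"
  using lip[of x 0] by simp

lemma lip_toll_measurable:
  assumes x: "\<And>r. r \<in> {1..m+1} \<Longrightarrow> x r \<in> borel_measurable \<Omega>"
  shows "(\<lambda>\<omega>. h (toll_map m V (\<lambda>r. x r (\<omega> r)) + e)) \<in> borel_measurable (copies m \<Omega>)"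
proof -
  have lin: "(\<lambda>y. A_mat m V r *v y) \<in> borel_measurable borel" for r
    by (intro borel_measurable_continuous_onI linear_continuous_on matrix_vector_mul_bounded_linear)
  have c: "(\<lambda>\<omega>. A_mat m V r *v x r (\<omega> r)) \<in> borel_measurable (copies m \<Omega>)" if r: "r \<in> {1..m+1}" for r
    using measurable_compose[OF measurable_compose[OF measurable_component_singleton[OF r, of "\<lambda>_. \<Omega>"] x[OF r]] lin] .
  show ?thesis
    unfolding toll_map_def
    by (rule measurable_compose[OF _ lip_measurable]) (intro borel_measurable_add borel_measurable_sum borel_measurable_const c)
qed

lemma component_norm_integrable:
  fixes f :: "(nat \<Rightarrow> node) \<Rightarrow> real^2"
  assumes r: "r \<in> {1..m+1}" and f: "f \<in> borel_measurable \<Omega>" "integrable \<Omega> (\<lambda>\<omega>. norm (f \<omega>))"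
  shows "integrable (copies m \<Omega>) (\<lambda>\<omega>. norm (f (\<omega> r)))" "(\<integral>\<omega>. norm (f (\<omega> r)) \<partial>copies m \<Omega>) = (\<integral>\<omega>. norm (f \<omega>) \<partial>\<Omega>)"
  using PiM_component_integral[OF finite_atLeastAtMost r measurable_compose[OF f(1) borel_measurable_norm]] f(2) by blast+

lemma lip_toll_integrable:
  assumes V: "V \<in> simplex_functions m" and x: "\<And>r. r \<in> {1..m+1} \<Longrightarrow> x r \<in> borel_measurable \<Omega>"
    and i: "\<And>r. r \<in> {1..m+1} \<Longrightarrow> integrable \<Omega> (\<lambda>\<omega>. norm (x r \<omega>))"
  shows "integrable (copies m \<Omega>) (\<lambda>\<omega>. h (toll_map m V (\<lambda>r. x r (\<omega> r)) + e))"
proof (rule Bochner_Integration.integrable_bound)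
  interpret P: prob_space "copies m \<Omega>" by (rule prob_space_copies[OF prob_space_axioms])
  let ?w = "\<lambda>\<omega>. \<bar>h 0\<bar> + L * ((real m + 2) * (\<Sum>r=1..m+1. V r * norm (x r (\<omega> r))) + norm (b_vec m V) + norm e)"
  show "integrable (copies m \<Omega>) ?w"
    by (intro Bochner_Integration.integrable_add integrable_mult_right Bochner_Integration.integrable_sum P.integrable_const component_norm_integrable(1) x i)
  show "AE \<omega> in copies m \<Omega>. norm (h (toll_map m V (\<lambda>r. x r (\<omega> r)) + e)) \<le> norm (?w \<omega>)"
  proof (rule AE_I2)
    fix \<omega> :: "nat \<Rightarrow> nat \<Rightarrow> node"
    let ?t = "toll_map m V (\<lambda>r. x r (\<omega> r))"
    have "\<bar>h (?t + e)\<bar> \<le> \<bar>h 0\<bar> + L * norm (?t + e)" by (rule lip_growth)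
    also have "\<dots> \<le> ?w \<omega>"
      using L norm_triangle_ineq[of ?t e] toll_map_norm[OF V, of "\<lambda>r. x r (\<omega> r)"]
      by (intro add_left_mono mult_left_mono) linarith+
    finally show "norm (h (?t + e)) \<le> norm (?w \<omega>)" unfolding real_norm_def by (rule order_trans[OF _ abs_ge_self])
  qed
qed (rule lip_toll_measurable[OF x])

text \<open>Dominated convergence along sequences of shares: for a fixed input the toll map is
  continuous in the shares, and its growth is controlled uniformly over the simplex.\<close>

lemma smoothed_continuous: "continuous_on (simplex_functions m) (smoothed h)"
proof (rule continuous_on_sequentiallyI)
  interpret P: prob_space "copies m \<Omega>" by (rule prob_space_copies[OF prob_space_axioms])
  fix u V assume u: "\<forall>n. u n \<in> simplex_functions m" and V: "V \<in> simplex_functions m" and lim: "u \<longlonglongrightarrow> V"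
  obtain B where B: "\<And>V. V \<in> simplex_functions m \<Longrightarrow> norm (b_vec m V) \<le> B" using b_vec_bounded by blast
  have coord: "(\<lambda>n. u n r) \<longlonglongrightarrow> V r" for r
    by (rule continuous_on_tendsto_compose[OF continuous_on_coordinate[of UNIV r] lim]) auto
  have b: "(\<lambda>n. b_vec m (u n) $ i) \<longlonglongrightarrow> b_vec m V $ i" for i
    by (rule continuous_on_tendsto_compose[OF continuous_on_b_vec lim V]) (simp add: u)
  have t: "(\<lambda>n. (u n r)\<^sup>2 * a + real m * u n r * (1 - u n r) * c) \<longlonglongrightarrow> (V r)\<^sup>2 * a + real m * V r * (1 - V r) * c"
    "(\<lambda>n. u n r * c) \<longlonglongrightarrow> V r * c" for r and a c :: real
    by (rule tendsto_add[OF tendsto_mult[OF tendsto_power[OF coord] tendsto_const]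
          tendsto_mult[OF tendsto_mult[OF tendsto_mult[OF tendsto_const coord] tendsto_diff[OF tendsto_const coord]] tendsto_const]],
        rule tendsto_mult[OF coord tendsto_const])
  have toll: "(\<lambda>n. h (toll_map m (u n) x)) \<longlonglongrightarrow> h (toll_map m V x)" for x
  proof (rule continuous_on_tendsto_compose[OF lip_continuous])
    have "(\<lambda>n. toll_map m (u n) x $ 1) \<longlonglongrightarrow> toll_map m V x $ 1"
      unfolding toll_map_nth by (rule tendsto_add[OF tendsto_sum[OF t(1)] b])
    moreover have "(\<lambda>n. toll_map m (u n) x $ 2) \<longlonglongrightarrow> toll_map m V x $ 2"
      unfolding toll_map_nth by (rule tendsto_add[OF tendsto_sum[OF t(2)] b])
    ultimately have "(\<lambda>n. toll_map m (u n) x $ i) \<longlonglongrightarrow> toll_map m V x $ i" for i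
      using exhaust_2[of i] by auto
    then show "(\<lambda>n. toll_map m (u n) x) \<longlonglongrightarrow> toll_map m V x"
      by (intro vec_tendstoI)
  qed auto
  let ?w = "\<lambda>\<omega>. \<bar>h 0\<bar> + L * ((real m + 2) * (\<Sum>r=1..m+1. norm (X (\<omega> r))) + B)"
  have meas: "(\<lambda>\<omega>. h (toll_map m V (\<lambda>r. X (\<omega> r)))) \<in> borel_measurable (copies m \<Omega>)" for V
    using lip_toll_measurable[of "\<lambda>_. X" V 0] X_measurable by simp
  show "(\<lambda>n. smoothed h (u n)) \<longlonglongrightarrow> smoothed h V"
    unfolding smoothed_def
  proof (rule integral_dominated_convergence[where w = ?w])
    show "integrable (copies m \<Omega>) ?w"
      by (intro Bochner_Integration.integrable_add integrable_mult_right Bochner_Integration.integrable_sum P.integrable_const component_norm_integrable(1) X_measurable X_integrable)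
    show "AE \<omega> in copies m \<Omega>. (\<lambda>n. h (toll_map m (u n) (\<lambda>r. X (\<omega> r)))) \<longlonglongrightarrow> h (toll_map m V (\<lambda>r. X (\<omega> r)))"
      using toll by (intro AE_I2)
    show "AE \<omega> in copies m \<Omega>. norm (h (toll_map m (u n) (\<lambda>r. X (\<omega> r)))) \<le> ?w \<omega>" for n
    proof (rule AE_I2)
      fix \<omega> :: "nat \<Rightarrow> nat \<Rightarrow> node"
      have un: "u n \<in> simplex_functions m" using u by blast
      let ?t = "toll_map m (u n) (\<lambda>r. X (\<omega> r))"
      have "norm ?t \<le> (real m + 2) * (\<Sum>r=1..m+1. u n r * norm (X (\<omega> r))) + norm (b_vec m (u n))"
        by (rule toll_map_norm[OF un])
      also have "\<dots> \<le> (real m + 2) * (\<Sum>r=1..m+1. norm (X (\<omega> r))) + B"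
        using simplex_functions_le_1[OF un] un
        by (intro add_mono mult_left_mono sum_mono B mult_left_le_one_le) (auto simp: simplex_functions_def)
      finally show "norm (h ?t) \<le> ?w \<omega>"
        using lip_growth[of ?t] L unfolding real_norm_def by (meson add_left_mono mult_left_mono order_trans)
    qed
  qed (rule meas)+
qed

lemma smoothed_measurable: "smoothed h \<in> borel_measurable (\<Pi>\<^sub>M r\<in>{1..m+1}. borel)"
proof -
  interpret P: prob_space "copies m \<Omega>" by (rule prob_space_copies[OF prob_space_axioms])
  have "(\<lambda>p. h (toll_map m (snd p) (\<lambda>r. X (fst p r)))) \<in> borel_measurable (copies m \<Omega> \<Otimes>\<^sub>M limit_shares m)"
    by (rule measurable_compose[OF toll_map_copies_measurable[OF X_measurable] lip_measurable])
  from measurable_compose[OF measurable_pair_swap' this]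
  have "(\<lambda>(V, \<omega>). h (toll_map m V (\<lambda>r. X (\<omega> r)))) \<in> borel_measurable (limit_shares m \<Otimes>\<^sub>M copies m \<Omega>)"
    by (simp add: case_prod_unfold)
  then have "(\<lambda>V. \<integral>\<omega>. h (toll_map m V (\<lambda>r. X (\<omega> r))) \<partial>copies m \<Omega>) \<in> borel_measurable (limit_shares m)"
    by (rule P.borel_measurable_lebesgue_integral)
  then show ?thesis
    unfolding smoothed_def[abs_def] by (subst (asm) measurable_cong_sets[OF sets_dirichlet refl])
qed

text \<open>The independent components are realised as trees grown along independent histories, and
  each is compared with the limit vector of its own history. Lipschitz continuity then bounds the
  error by the gaps weighted with the shares.\<close>

lemma component_replacement:
  assumes I: "I \<in> set_pmf (urn m k)"
  defines "V \<equiv> share m (k + 2) I"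
  shows "\<bar>measure_pmf.expectation (tree_family m I) (\<lambda>s. h (toll_map m V (\<lambda>r. scaled_stats m (I r) (s r)) + toll_error m (k + 2) I))
      - smoothed h V\<bar> \<le> L * ((real m + 2) * (\<Sum>r=1..m+1. V r * gap (I r)) + norm (toll_error m (k + 2) I))"
proof -
  let ?e = "toll_error m (k + 2) I" and ?P = "copies m \<Omega>" and ?R = "{1..m+1}"
  let ?x = "\<lambda>r \<omega>. scaled_stats m (I r) (grow m (I r) \<omega>)"
  interpret P: prob_space ?P by (rule prob_space_copies[OF prob_space_axioms])
  note I1 = urn_ge_1[OF I]
  have V: "V \<in> simplex_functions m" unfolding V_def by (rule share_simplex[OF I])
  have xm: "?x r \<in> borel_measurable \<Omega>" for r by (rule grow_measurable)
  have xi: "integrable \<Omega> (\<lambda>\<omega>. norm (?x r \<omega>))" for r by (rule tree_expectation_grow(2)[OF I1])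
  have gi: "integrable ?P (\<lambda>\<omega>. norm (?x r (\<omega> r) - X (\<omega> r)))" "(\<integral>\<omega>. norm (?x r (\<omega> r) - X (\<omega> r)) \<partial>?P) = gap (I r)"
    if r: "r \<in> ?R" for r
    using component_norm_integrable[OF r borel_measurable_diff[OF xm[of r] X_measurable] gap_limit(1)[OF I1]] unfolding gap_def by blast+
  have cong: "toll_map m V (\<lambda>r. scaled_stats m (I r) (if r \<in> ?R then grow m (I r) (\<omega> r) else single_tree)) = toll_map m V (\<lambda>r. ?x r (\<omega> r))" for \<omega>
    by (rule toll_map_cong) (simp only: if_True)
  have "measure_pmf.expectation (tree_family m I) (\<lambda>s. h (toll_map m V (\<lambda>r. scaled_stats m (I r) (s r)) + ?e))
    = (\<integral>\<omega>. h (toll_map m V (\<lambda>r. scaled_stats m (I r) (if r \<in> ?R then grow m (I r) (\<omega> r) else single_tree)) + ?e) \<partial>?P)"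
  proof (rule Pi_pmf_expectation_copies[OF _ prob_space_axioms])
    show "(\<lambda>\<omega>. h (toll_map m V (\<lambda>r. scaled_stats m (I r) (if r \<in> ?R then grow m (I r) (\<omega> r) else single_tree)) + ?e)) \<in> borel_measurable ?P"
      unfolding cong by (rule lip_toll_measurable[OF xm])
  qed (use finite_set_recursive_tree[OF I1] in \<open>simp_all add: distr_grow\<close>)
  then have eq: "measure_pmf.expectation (tree_family m I) (\<lambda>s. h (toll_map m V (\<lambda>r. scaled_stats m (I r) (s r)) + ?e))
    = (\<integral>\<omega>. h (toll_map m V (\<lambda>r. ?x r (\<omega> r)) + ?e) \<partial>?P)" unfolding cong .
  have i1: "integrable ?P (\<lambda>\<omega>. h (toll_map m V (\<lambda>r. ?x r (\<omega> r)) + ?e))" by (rule lip_toll_integrable[OF V xm xi])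
  have i2: "integrable ?P (\<lambda>\<omega>. h (toll_map m V (\<lambda>r. X (\<omega> r))))"
    using lip_toll_integrable[OF V X_measurable X_integrable(1), of 0] by simp
  have i3: "integrable ?P (\<lambda>\<omega>. L * ((real m + 2) * (\<Sum>r\<in>?R. V r * norm (?x r (\<omega> r) - X (\<omega> r))) + norm ?e))"
    by (intro Bochner_Integration.integrable_add integrable_mult_right Bochner_Integration.integrable_sum P.integrable_const gi)
  have "\<bar>(\<integral>\<omega>. h (toll_map m V (\<lambda>r. ?x r (\<omega> r)) + ?e) \<partial>?P) - smoothed h V\<bar>
    = \<bar>\<integral>\<omega>. h (toll_map m V (\<lambda>r. ?x r (\<omega> r)) + ?e) - h (toll_map m V (\<lambda>r. X (\<omega> r))) \<partial>?P\<bar>"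
    unfolding smoothed_def by (simp only: Bochner_Integration.integral_diff[OF i1 i2])
  also have "\<dots> \<le> (\<integral>\<omega>. \<bar>h (toll_map m V (\<lambda>r. ?x r (\<omega> r)) + ?e) - h (toll_map m V (\<lambda>r. X (\<omega> r)))\<bar> \<partial>?P)"
    by (rule integral_abs_bound)
  also have "\<dots> \<le> (\<integral>\<omega>. L * ((real m + 2) * (\<Sum>r\<in>?R. V r * norm (?x r (\<omega> r) - X (\<omega> r))) + norm ?e) \<partial>?P)"
  proof (rule integral_mono[OF integrable_abs[OF Bochner_Integration.integrable_diff[OF i1 i2]] i3])
    fix \<omega> :: "nat \<Rightarrow> nat \<Rightarrow> node"
    let ?a = "toll_map m V (\<lambda>r. ?x r (\<omega> r))" and ?b = "toll_map m V (\<lambda>r. X (\<omega> r))"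
    have "?a + ?e - ?b = (?a - ?b) + ?e" by simp
    then have "norm (?a + ?e - ?b) \<le> norm (?a - ?b) + norm ?e" by (simp only: norm_triangle_ineq)
    also have "\<dots> \<le> (real m + 2) * (\<Sum>r\<in>?R. V r * norm (?x r (\<omega> r) - X (\<omega> r))) + norm ?e"
      by (intro add_right_mono toll_map_diff[OF V])
    finally show "\<bar>h (?a + ?e) - h ?b\<bar> \<le> L * ((real m + 2) * (\<Sum>r\<in>?R. V r * norm (?x r (\<omega> r) - X (\<omega> r))) + norm ?e)"
      using lip[of "?a + ?e" ?b] L by (meson mult_left_mono order_trans)
  qed
  also have "\<dots> = L * ((real m + 2) * (\<Sum>r\<in>?R. V r * gap (I r)) + norm ?e)"
  proof -
    have "has_bochner_integral ?P (\<lambda>\<omega>. norm (?x r (\<omega> r) - X (\<omega> r))) (gap (I r))" if "r \<in> ?R" for r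
      using gi[OF that] by (simp only: has_bochner_integral_iff)
    moreover have "has_bochner_integral ?P (\<lambda>\<omega>. norm ?e) (norm ?e)"
      using P.integrable_const[of "norm ?e"] P.prob_space by (simp add: has_bochner_integral_iff)
    ultimately have "has_bochner_integral ?P (\<lambda>\<omega>. L * ((real m + 2) * (\<Sum>r\<in>?R. V r * norm (?x r (\<omega> r) - X (\<omega> r))) + norm ?e))
      (L * ((real m + 2) * (\<Sum>r\<in>?R. V r * gap (I r)) + norm ?e))"
      by (intro has_bochner_integral_mult_right has_bochner_integral_add has_bochner_integral_sum)
    then show ?thesis by (simp only: has_bochner_integral_iff)
  qed
  finally show ?thesis unfolding eq .
qed

lemma gap_nonneg: "gap n \<ge> 0"
  unfolding gap_def by (intro Bochner_Integration.integral_nonneg) simp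

lemma replacement_small:
  assumes \<epsilon>: "\<epsilon> > 0"
  shows "\<exists>K. \<forall>k\<ge>K. \<forall>I\<in>set_pmf (urn m k).
    \<bar>measure_pmf.expectation (tree_family m I) (\<lambda>s. h (toll_map m (share m (k + 2) I) (\<lambda>r. scaled_stats m (I r) (s r)) + toll_error m (k + 2) I))
      - smoothed h (share m (k + 2) I)\<bar> \<le> \<epsilon>"
proof -
  \<comment> \<open>The m + 1 weighted gaps pass through the matrix bound m + 2, and the toll error
    adds one; L + 1 keeps the constant positive when L is zero.\<close>
  define C where "C = (L + 1) * ((real m + 2) * (real m + 1) + 1)"
  have C: "C > 0" using L unfolding C_def by (intro mult_pos_pos add_nonneg_pos) auto
  define \<delta> where "\<delta> = \<epsilon> / C"
  have \<delta>: "\<delta> > 0" using \<epsilon> C by (simp add: \<delta>_def)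
  from share_weighted_small[OF m gap_limit(2) \<delta>] obtain K1 where
    K1: "\<And>n j. n \<ge> K1 \<Longrightarrow> j \<in> {1..n} \<Longrightarrow> tree_size m j / tree_size m n * \<bar>gap j\<bar> \<le> \<delta>" by blast
  from toll_error_small[OF m \<delta>] obtain K2 where
    K2: "\<And>k I. k \<ge> K2 \<Longrightarrow> I \<in> set_pmf (urn m k) \<Longrightarrow> norm (toll_error m (k + 2) I) \<le> \<delta>" by blast
  have "L * ((real m + 2) * (\<Sum>r=1..m+1. share m (k + 2) I r * gap (I r)) + norm (toll_error m (k + 2) I)) \<le> \<epsilon>"
    if k: "k \<ge> max K1 K2" and I: "I \<in> set_pmf (urn m k)" for k I
  proof -
    have "share m (k + 2) I r * gap (I r) \<le> \<delta>" if r: "r \<in> {1..m+1}" for r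
    proof -
      have "I r \<in> {1..k + 2}" using urn_ge_1[OF I, of r] urn_le[OF I, of r] by simp
      then show ?thesis using K1[of "k + 2" "I r"] k r gap_nonneg[of "I r"] by (simp add: share_def)
    qed
    then have "(\<Sum>r=1..m+1. share m (k + 2) I r * gap (I r)) \<le> (\<Sum>r=1..m+1. \<delta>)" by (rule sum_mono)
    then have "(\<Sum>r=1..m+1. share m (k + 2) I r * gap (I r)) \<le> (real m + 1) * \<delta>" by (simp add: algebra_simps)
    then have "(real m + 2) * (\<Sum>r=1..m+1. share m (k + 2) I r * gap (I r)) + norm (toll_error m (k + 2) I)
      \<le> (real m + 2) * ((real m + 1) * \<delta>) + \<delta>"
      using K2[OF _ I] k by (intro add_mono mult_left_mono) auto
    also have "\<dots> = ((real m + 2) * (real m + 1) + 1) * \<delta>" by (simp add: algebra_simps)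
    finally have "L * ((real m + 2) * (\<Sum>r=1..m+1. share m (k + 2) I r * gap (I r)) + norm (toll_error m (k + 2) I))
      \<le> L * (((real m + 2) * (real m + 1) + 1) * \<delta>)" using L by (rule mult_left_mono)
    also have "\<dots> \<le> C * \<delta>"
      using L \<delta> unfolding C_def mult.assoc by (intro mult_right_mono) auto
    also have "\<dots> = \<epsilon>" using C by (simp add: \<delta>_def)
    finally show ?thesis .
  qed
  then show ?thesis using component_replacement by (meson order_trans)
qed

lemma law_expectation:
  "tree_expectation m (k + 2) (\<lambda>t. h (scaled_stats m (k + 2) t)) = urn_expectation m k (\<lambda>I.
     measure_pmf.expectation (tree_family m I) (\<lambda>s. h (toll_map m (share m (k + 2) I) (\<lambda>r. scaled_stats m (I r) (s r)) + toll_error m (k + 2) I)))"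
proof -
  let ?F = "\<lambda>I s. toll_map m (share m (k + 2) I) (\<lambda>r. scaled_stats m (I r) (s r)) + toll_error m (k + 2) I"
  have fin: "finite (set_pmf (map_pmf (?F I) (tree_family m I)))" if I: "I \<in> set_pmf (urn m k)" for I
  proof -
    have "set_pmf (tree_family m I) \<subseteq> PiE_dflt {1..m+1} single_tree (\<lambda>r. set_pmf (recursive_tree m (I r)))"
      using set_Pi_pmf_subset'[of "{1..m+1}" single_tree "\<lambda>r. recursive_tree m (I r)"] by (simp add: comp_def)
    moreover have "finite (PiE_dflt {1..m+1} single_tree (\<lambda>r. set_pmf (recursive_tree m (I r))))"
      using finite_set_recursive_tree[OF urn_ge_1[OF I]] by (intro finite_PiE_dflt) simp_all
    ultimately have "finite (set_pmf (tree_family m I))" by (rule finite_subset)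
    then show ?thesis by simp
  qed
  have "tree_expectation m (k + 2) (\<lambda>t. h (scaled_stats m (k + 2) t)) = measure_pmf.expectation (map_pmf (scaled_stats m (k + 2)) (recursive_tree m (k + 2))) h"
    by (rule integral_map_pmf[symmetric])
  also have "\<dots> = (\<Sum>I\<in>set_pmf (urn m k). pmf (urn m k) I *\<^sub>R measure_pmf.expectation (map_pmf (?F I) (tree_family m I)) h)"
    unfolding scaled_stats_law by (rule pmf_expectation_bind[OF finite_set_urn fin subset_refl])
  also have "\<dots> = urn_expectation m k (\<lambda>I. measure_pmf.expectation (tree_family m I) (\<lambda>s. h (?F I s)))"
    unfolding integral_map_pmf by (rule integral_measure_pmf[OF finite_set_urn, symmetric]) (simp add: set_pmf_iff)
  finally show ?thesis .
qed

text \<open>The same expectations are evaluated twice: directly, by convergence to \<open>X\<close>,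
  and after cutting at the root, by replacing the components with their limits and the urn shares
  with Dirichlet shares.\<close>

theorem limit_identity:
  "(\<integral>\<omega>. h (X \<omega>) \<partial>\<Omega>) = (\<integral>V. smoothed h V \<partial>limit_shares m)"
proof -
  have hX: "integrable \<Omega> (\<lambda>\<omega>. h (X \<omega>))"
  proof (rule Bochner_Integration.integrable_bound)
    show "integrable \<Omega> (\<lambda>\<omega>. \<bar>h 0\<bar> + L * norm (X \<omega>))" using X_integrable(1) by auto
    show "AE \<omega> in \<Omega>. norm (h (X \<omega>)) \<le> norm (\<bar>h 0\<bar> + L * norm (X \<omega>))"
      using lip_growth by (intro AE_I2) (simp only: real_norm_def, meson abs_ge_self order_trans)
  qed (rule measurable_compose[OF X_measurable lip_measurable])
  let ?A = "\<lambda>k. tree_expectation m (k + 2) (\<lambda>t. h (scaled_stats m (k + 2) t))"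
  let ?B = "\<lambda>k. urn_expectation m k (\<lambda>I. smoothed h (share m (k + 2) I))"
  have "?A \<longlonglongrightarrow> (\<integral>\<omega>. h (X \<omega>) \<partial>\<Omega>)"
    using LIMSEQ_ignore_initial_segment[OF lipschitz_stats_limit[OF L lip hX], of 2] .
  moreover have "?B \<longlonglongrightarrow> (\<integral>V. smoothed h V \<partial>limit_shares m)"
    by (rule urn_shares_limit[OF m smoothed_continuous smoothed_measurable])
  ultimately have diff: "(\<lambda>k. ?A k - ?B k) \<longlonglongrightarrow> (\<integral>\<omega>. h (X \<omega>) \<partial>\<Omega>) - (\<integral>V. smoothed h V \<partial>limit_shares m)"
    by (rule tendsto_diff)
  have "(\<lambda>k. ?A k - ?B k) \<longlonglongrightarrow> 0"
  proof (rule LIMSEQ_I)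
    fix \<epsilon> :: real assume "\<epsilon> > 0"
    then have "\<epsilon> / 2 > 0" by simp
    from replacement_small[OF this] obtain K where K: "\<And>k I. k \<ge> K \<Longrightarrow> I \<in> set_pmf (urn m k) \<Longrightarrow>
      \<bar>measure_pmf.expectation (tree_family m I) (\<lambda>s. h (toll_map m (share m (k + 2) I) (\<lambda>r. scaled_stats m (I r) (s r)) + toll_error m (k + 2) I))
      - smoothed h (share m (k + 2) I)\<bar> \<le> \<epsilon> / 2" by blast
    have "norm (?A k - ?B k - 0) < \<epsilon>" if "k \<ge> K" for k
    proof -
      let ?E = "\<lambda>I. measure_pmf.expectation (tree_family m I) (\<lambda>s. h (toll_map m (share m (k + 2) I) (\<lambda>r. scaled_stats m (I r) (s r)) + toll_error m (k + 2) I))"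
      have "?A k - ?B k = urn_expectation m k (\<lambda>I. ?E I - smoothed h (share m (k + 2) I))"
        unfolding law_expectation by (rule Bochner_Integration.integral_diff[OF integrable_urn integrable_urn, symmetric])
      then have "\<bar>?A k - ?B k\<bar> \<le> urn_expectation m k (\<lambda>I. \<bar>?E I - smoothed h (share m (k + 2) I)\<bar>)"
        by (simp only: integral_abs_bound)
      also have "\<dots> \<le> urn_expectation m k (\<lambda>I. \<epsilon> / 2)"
        by (intro integral_mono_AE integrable_urn AE_pmfI K that)
      also have "\<dots> < \<epsilon>" using \<open>\<epsilon> > 0\<close> by simp
      finally show ?thesis by simp
    qed
    then show "\<exists>no. \<forall>k\<ge>no. norm (?A k - ?B k - 0) < \<epsilon>" by blast
  qed
  from LIMSEQ_unique[OF diff this] show ?thesis by simp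
qed

end

section \<open>The fixed point and Wasserstein convergence\<close>

text \<open>The coordinates are Lipschitz, so \<open>limit_identity\<close> applies to them. Its
  left-hand side vanishes because \<open>X\<close> is centred, and for centred components the
  conditional mean of the toll map is the toll itself.\<close>

lemma b_vec_mean: "(\<integral>V. b_vec m V $ i \<partial>limit_shares m) = 0"
proof -
  have lip: "\<bar>x $ i - y $ i\<bar> \<le> 1 * norm (x - y)" for x y :: "real^2" using component_le_norm_cart[of "x - y" i] by simp
  have "(\<integral>\<omega>. X \<omega> $ i \<partial>\<Omega>) = (\<integral>V. smoothed (\<lambda>x. x $ i) V \<partial>limit_shares m)"
    by (rule limit_identity[OF _ lip]) simp
  also have "smoothed (\<lambda>x. x $ i) = (\<lambda>V. b_vec m V $ i)"
    unfolding smoothed_def[abs_def] by (rule ext) (rule toll_map_conditional_mean[OF prob_space_axioms X_integrable(2) X_mean])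
  finally show ?thesis by (simp add: X_mean)
qed

lemma limit_law_fixed_point: "T_map m limit_law = limit_law"
proof -
  have T: "T_map m limit_law \<in> M02" by (rule T_map_M02[OF m b_vec_mean limit_law_M02])
  show ?thesis
  proof (rule measure_eqI_lipschitz)
    fix h :: "real^2 \<Rightarrow> real" assume "\<exists>L\<ge>0. \<forall>x y. \<bar>h x - h y\<bar> \<le> L * dist x y"
    then obtain L where L: "L \<ge> 0" "\<And>x y. \<bar>h x - h y\<bar> \<le> L * norm (x - y)" by (auto simp: dist_norm)
    have "integral\<^sup>L (T_map m limit_law) h = (\<integral>V. smoothed h V \<partial>limit_shares m)"
      unfolding limit_law_def smoothed_def
      by (rule toll_map_expectation(2)[OF m prob_space_axioms X_measurable X_square lip_measurable[OF L] L(1) lip_growth[OF L]])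
    also have "\<dots> = (\<integral>\<omega>. h (X \<omega>) \<partial>\<Omega>)" by (rule limit_identity[OF L, symmetric])
    also have "\<dots> = integral\<^sup>L limit_law h"
      unfolding limit_law_def by (rule integral_distr[OF X_measurable lip_measurable[OF L], symmetric])
    finally show "integral\<^sup>L (T_map m limit_law) h = integral\<^sup>L limit_law h" .
  qed (use M02_D[OF T] M02_D[OF limit_law_M02] in auto)
qed

text \<open>The normalised vector and its limit are functions of the same history; their joint law
  is a coupling, and its mean square cost bounds the infimum.\<close>

lemma wasserstein_limit: "(\<lambda>n. wasserstein2 (normalized_law m n) limit_law) \<longlonglongrightarrow> 0"
proof -
  let ?c = "\<lambda>n. tree_size m n * tree_size m (Suc n) / (real n)\<^sup>2" and ?c' = "\<lambda>n. tree_size m n / real n"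
  let ?\<xi> = "\<lambda>n t. vector [?c n * wiener_martingale m n t, ?c' n * path_martingale m n t] :: real^2"
  note lim = scaled_martingales_limit(2)[OF tree_size_ratio_limit(2,3)[OF m]]
  have le: "wasserstein2 (normalized_law m n) limit_law \<le> sqrt (\<integral>\<omega>. (norm (?\<xi> n (grow m n \<omega>) - X \<omega>))\<^sup>2 \<partial>\<Omega>)"
    and ge: "0 \<le> wasserstein2 (normalized_law m n) limit_law" if n: "n \<ge> 1" for n
  proof -
    have pos: "tree_size m n > 0" "tree_size m (Suc n) > 0" using n by (auto intro: tree_size_pos)
    have "normalized_law m n = distr (measure_pmf (recursive_tree m n)) borel (?\<xi> n)"
      unfolding normalized_law_def expectation_wiener_index[OF n] expectation_path_length[OF n]
      using pos by (intro distr_cong refl) (simp add: wiener_martingale_def path_martingale_def)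
    also have "\<dots> = distr \<Omega> borel (?\<xi> n \<circ> grow m n)"
      unfolding distr_grow[symmetric] by (rule distr_distr) auto
    finally have law: "normalized_law m n = distr \<Omega> borel (\<lambda>\<omega>. ?\<xi> n (grow m n \<omega>))" by (simp add: comp_def)
    let ?\<pi> = "distr \<Omega> (borel \<Otimes>\<^sub>M borel) (\<lambda>\<omega>. (?\<xi> n (grow m n \<omega>), X \<omega>))"
    have \<pi>: "?\<pi> \<in> couplings (normalized_law m n) limit_law"
      unfolding law limit_law_def by (rule couplings_I[OF prob_space_axioms grow_measurable X_measurable])
    have pm: "(\<lambda>\<omega>. (?\<xi> n (grow m n \<omega>), X \<omega>)) \<in> \<Omega> \<rightarrow>\<^sub>M borel \<Otimes>\<^sub>M borel"
      using grow_measurable X_measurable by (rule measurable_Pair)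
    have cost: "(\<integral>p. (norm (fst p - snd p))\<^sup>2 \<partial>?\<pi>) = (\<integral>\<omega>. (norm (?\<xi> n (grow m n \<omega>) - X \<omega>))\<^sup>2 \<partial>\<Omega>)"
      by (subst integral_distr[OF pm]) simp_all
    have "wasserstein2 (normalized_law m n) limit_law \<le> sqrt (\<integral>p. (norm (fst p - snd p))\<^sup>2 \<partial>?\<pi>)"
      unfolding wasserstein2_def by (rule cINF_lower[OF _ \<pi>]) (auto intro!: bdd_belowI2[where m=0])
    then show "wasserstein2 (normalized_law m n) limit_law \<le> sqrt (\<integral>\<omega>. (norm (?\<xi> n (grow m n \<omega>) - X \<omega>))\<^sup>2 \<partial>\<Omega>)"
      unfolding cost .
    show "0 \<le> wasserstein2 (normalized_law m n) limit_law"
      unfolding wasserstein2_def using \<pi> by (intro cINF_greatest) auto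
  qed
  show ?thesis
  proof (rule tendsto_sandwich[OF _ _ tendsto_const])
    show "\<forall>\<^sub>F n in sequentially. 0 \<le> wasserstein2 (normalized_law m n) limit_law"
      using eventually_ge_at_top[of 1] by eventually_elim (rule ge)
    show "\<forall>\<^sub>F n in sequentially. wasserstein2 (normalized_law m n) limit_law \<le> sqrt (\<integral>\<omega>. (norm (?\<xi> n (grow m n \<omega>) - X \<omega>))\<^sup>2 \<partial>\<Omega>)"
      using eventually_ge_at_top[of 1] by eventually_elim (rule le)
    show "(\<lambda>n. sqrt (\<integral>\<omega>. (norm (?\<xi> n (grow m n \<omega>) - X \<omega>))\<^sup>2 \<partial>\<Omega>)) \<longlonglongrightarrow> 0"
      using tendsto_real_sqrt[OF lim] by (simp only: real_sqrt_zero)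
  qed
qed

end

theorem theorem7p1:
  fixes m :: nat
  assumes "m \<ge> 1"
  shows "(\<forall>\<nu>\<in>M02. T_map m \<nu> \<in> M02) \<and>
    (\<exists>\<nu>\<in>M02. T_map m \<nu> = \<nu> \<and> (\<forall>\<mu>\<in>M02. T_map m \<mu> = \<mu> \<longrightarrow> \<mu> = \<nu>) \<and>
       (\<lambda>n. wasserstein2 (normalized_law m n) \<nu>) \<longlonglongrightarrow> 0)"
proof -
  obtain Y Z where "tree_limit m Y Z"
    by (rule tree_process_limit[OF assms]) (blast intro: tree_limit.intro[OF assms])
  then interpret tree_limit m Y Z .
  have "\<forall>\<nu>\<in>M02. T_map m \<nu> \<in> M02" using T_map_M02[OF assms b_vec_mean] by blast
  moreover have "\<forall>\<mu>\<in>M02. T_map m \<mu> = \<mu> \<longrightarrow> \<mu> = limit_law"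
    using T_map_fixed_point_unique[OF assms _ limit_law_M02 _ limit_law_fixed_point] by blast
  ultimately show ?thesis using limit_law_M02 limit_law_fixed_point wasserstein_limit by blast
qed

end
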